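(* Let $f\in L^2_{\mathrm{per}}(Y)$, let $A\in\mathcal{M}(\lambda,\Lambda)$ for some $\lambda,\Lambda>0$, and suppose that $A$ satisfies the Cordes condition with constant $\delta\in(0,1]$. Let $r\in L^2_{\mathrm{per}}(Y)$ denote the unique invariant measure to $A$ and let $C_\delta:=(1-\sqrt{1-\delta})^{-1}$. Consider the problem $$-D^2:(qA)=f\quad\text{in }Y,\qquad q\ \text{is }Y\text{-periodic}.\qquad(\ast)$$ Then: (i) There exists a solution $q\in L^2_{\mathrm{per}}(Y)$ to $(\ast)$ if, and only if, $f\in L^2_{\mathrm{per},0}(Y)$. (ii) If $f\in L^2_{\mathrm{per},0}(Y)$ and $q_1,q_2\in L^2_{\mathrm{per}}(Y)$ are solutions to $(\ast)$, then $q_1-q_2=cr$ with $c:=\int_Y(q_1-q_2)$. In particular, the problem $(\ast)$ has a unique solution if $\int_Yq$ is prescribed. (iii) If $f\in L^2_{\mathrm{per},0}(Y)$, then the unique solution $q_0\in L^2_{\mathrm{per},0}(Y)$ to $(\ast)$ subject to $\int_Yq_0=0$ satisfies the bound $$\|q_0\|_{L^2(Y)}\le\frac{n\Lambda}{\pi^2\lambda^2}C_\delta\left(1+\|r\|_{L^2(Y)}\right)\|f\|_{L^2(Y)}.$$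
   Context: $Y:=(0,1)^n$; "$Y$-periodic" means $\mathbb{Z}^n$-periodic. For $\lambda,\Lambda>0$, $\mathcal{M}(\lambda,\Lambda)$ denotes the set of all $Y$-periodic $A\in L^\infty(\mathbb{R}^n;\mathbb{R}^{n\times n}_{\mathrm{sym}})$ such that $\lambda|\xi|^2\le A\xi\cdot\xi\le\Lambda|\xi|^2$ a.e. in $\mathbb{R}^n$ for all $\xi\in\mathbb{R}^n\setminus\{0\}$. For matrices, $P:Q:=\sum_{i,j}p_{ij}q_{ij}$ and $|P|:=\sqrt{P:P}$. $A$ satisfies the Cordes condition with constant $\delta\in(0,1]$ if $\frac{|A|^2}{(\mathrm{tr}(A))^2}\le\frac{1}{n-1+\delta}$ a.e. in $\mathbb{R}^n$. $L^2_{\mathrm{per}}(Y)$, $H^k_{\mathrm{per}}(Y)$ are the usual spaces of $Y$-periodic functions, and $L^2_{\mathrm{per},0}(Y):=\{\varphi\in L^2_{\mathrm{per}}(Y):\int_Y\varphi=0\}$. A solution to $(\ast)$ is a function $q\in L^2_{\mathrm{per}}(Y)$ with $(q,-A:D^2\varphi)_{L^2(Y)}=(f,\varphi)_{L^2(Y)}$ for any $\varphi\in H^2_{\mathrm{per}}(Y)$. An invariant measure to $A$ is a function $r\in L^2_{\mathrm{per}}(Y)$ with $\int_Yr=1$ and $(r,-A:D^2\varphi)_{L^2(Y)}=0$ for all $\varphi\in H^2_{\mathrm{per}}(Y)$; under the Cordes condition it exists and is unique. *)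

theory Defs
  imports "HOL-Analysis.Analysis"
begin

text \<open>
  Functions stand for their classes modulo Lebesgue null sets: membership in the
  spaces below is invariant under changes on a null set, and equality in $L^2$ is
  stated as equality almost everywhere.

  For matrices of type \<^typ>\<open>real^'n^'n\<close> the library inner product is
  the Frobenius product $P:Q$, and the library norm is $|P| = \sqrt{P:P}$.
\<close>

lemma inner_matrix_eq_frobenius:
  fixes P Q :: "real^'n^'n"
  shows "P \<bullet> Q = (\<Sum>i\<in>UNIV. \<Sum>j\<in>UNIV. P $ i $ j * Q $ i $ j)"
  by (simp add: inner_vec_def)

abbreviation unit_cell :: "(real^'n) set" where
  "unit_cell \<equiv> box 0 1"

definition periodic :: "(real^'n \<Rightarrow> 'b) \<Rightarrow> bool" where
  "periodic u \<longleftrightarrow>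
     (\<forall>k. (\<forall>i. k $ i \<in> \<int>) \<longrightarrow> (AE x in lebesgue. u (x + k) = u x))"

definition L2_per :: "(real^'n \<Rightarrow> real) set" where
  "L2_per = {u. u \<in> borel_measurable lebesgue \<and> periodic u \<and>
                set_integrable lebesgue unit_cell (\<lambda>x. (u x)\<^sup>2)}"

definition cell_integral :: "(real^'n \<Rightarrow> real) \<Rightarrow> real" where
  "cell_integral u = (LINT x:unit_cell|lebesgue. u x)"

definition L2_inner :: "(real^'n \<Rightarrow> real) \<Rightarrow> (real^'n \<Rightarrow> real) \<Rightarrow> real" where
  "L2_inner u v = cell_integral (\<lambda>x. u x * v x)"

definition L2_norm :: "(real^'n \<Rightarrow> real) \<Rightarrow> real" where
  "L2_norm u = sqrt (L2_inner u u)"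

definition L2_per0 :: "(real^'n \<Rightarrow> real) set" where
  "L2_per0 = {u \<in> L2_per. cell_integral u = 0}"

definition partial :: "'n \<Rightarrow> (real^'n \<Rightarrow> real) \<Rightarrow> real^'n \<Rightarrow> real" where
  "partial i u x = frechet_derivative u (at x) (axis i 1)"

primrec C_k :: "nat \<Rightarrow> (real^'n \<Rightarrow> real) set" where
  "C_k 0 = {u. continuous_on UNIV u}"
| "C_k (Suc k) = {u. (\<forall>x. u differentiable (at x)) \<and> (\<forall>i. partial i u \<in> C_k k)}"

definition test_functions :: "(real^'n \<Rightarrow> real) set" where
  "test_functions = {\<psi>. (\<forall>k. \<psi> \<in> C_k k) \<and> (\<exists>K. compact K \<and> (\<forall>x. x \<notin> K \<longrightarrow> \<psi> x = 0))}"

definition locally_integrable :: "(real^'n \<Rightarrow> real) \<Rightarrow> bool" where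
  "locally_integrable u \<longleftrightarrow> (\<forall>K. compact K \<longrightarrow> set_integrable lebesgue K u)"

definition has_weak_partial ::
    "(real^'n \<Rightarrow> real) \<Rightarrow> 'n \<Rightarrow> (real^'n \<Rightarrow> real) \<Rightarrow> bool" where
  "has_weak_partial u i g \<longleftrightarrow> locally_integrable u \<and> locally_integrable g \<and>
     (\<forall>\<psi>\<in>test_functions.
        (LINT x|lebesgue. u x * partial i \<psi> x) = - (LINT x|lebesgue. g x * \<psi> x))"

text \<open>
  $H^k_{\mathrm{per}}(Y)$: periodic functions on the whole space whose weak derivatives
  (on the whole space, so that no jumps across the boundary of the cell are allowed)
  up to order $k$ are square integrable over the cell.
\<close>

primrec H_per :: "nat \<Rightarrow> (real^'n \<Rightarrow> real) set" where
  "H_per 0 = L2_per"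
| "H_per (Suc k) = {u \<in> L2_per. \<forall>i. \<exists>g\<in>H_per k. has_weak_partial u i g}"

text \<open>
  The weak Hessian is a relation because it is unique only almost everywhere; the
  identities tested with it below are required for every representative.
\<close>

definition has_weak_hessian ::
    "(real^'n \<Rightarrow> real) \<Rightarrow> (real^'n \<Rightarrow> real^'n^'n) \<Rightarrow> bool" where
  "has_weak_hessian u H \<longleftrightarrow>
     (\<exists>g. \<forall>i. has_weak_partial u i (g i) \<and>
              (\<forall>j. has_weak_partial (g i) j (\<lambda>x. H x $ i $ j)))"

definition coeff_class :: "real \<Rightarrow> real \<Rightarrow> (real^'n \<Rightarrow> real^'n^'n) set" where
  "coeff_class l L = {A. A \<in> borel_measurable lebesgue \<and>
     (\<exists>C. AE x in lebesgue. norm (A x) \<le> C) \<and>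
     (AE x in lebesgue. transpose (A x) = A x) \<and>
     periodic A \<and>
     (\<forall>\<xi>. \<xi> \<noteq> 0 \<longrightarrow>
        (AE x in lebesgue. l * (norm \<xi>)\<^sup>2 \<le> (A x *v \<xi>) \<bullet> \<xi> \<and>
                           (A x *v \<xi>) \<bullet> \<xi> \<le> L * (norm \<xi>)\<^sup>2))}"

definition cordes :: "real \<Rightarrow> (real^'n \<Rightarrow> real^'n^'n) \<Rightarrow> bool" where
  "cordes \<delta> A \<longleftrightarrow>
     (AE x in lebesgue. (norm (A x))\<^sup>2 / (trace (A x))\<^sup>2 \<le> 1 / (real CARD('n) - 1 + \<delta>))"

definition is_solution ::
    "(real^'n \<Rightarrow> real^'n^'n) \<Rightarrow> (real^'n \<Rightarrow> real) \<Rightarrow> (real^'n \<Rightarrow> real) \<Rightarrow> bool" where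
  "is_solution A f q \<longleftrightarrow> q \<in> L2_per \<and>
     (\<forall>\<phi>\<in>H_per 2. \<forall>H. has_weak_hessian \<phi> H \<longrightarrow>
        L2_inner q (\<lambda>x. - (A x \<bullet> H x)) = L2_inner f \<phi>)"

definition is_invariant_measure ::
    "(real^'n \<Rightarrow> real^'n^'n) \<Rightarrow> (real^'n \<Rightarrow> real) \<Rightarrow> bool" where
  "is_invariant_measure A r \<longleftrightarrow> r \<in> L2_per \<and> cell_integral r = 1 \<and>
     (\<forall>\<phi>\<in>H_per 2. \<forall>H. has_weak_hessian \<phi> H \<longrightarrow>
        L2_inner r (\<lambda>x. - (A x \<bullet> H x)) = 0)"

definition C_cordes :: "real \<Rightarrow> real" where
  "C_cordes \<delta> = 1 / (1 - sqrt (1 - \<delta>))"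

end

theory Submission
  imports Defs
begin

text \<open>
  The Cordes condition says that a scalar multiple \<open>\<gamma> A\<close> of the coefficient, with
  \<open>\<gamma> = tr A / \<bar>A\<bar>\<^sup>2\<close>, is close to the identity matrix:
  \<open>\<bar>I - \<gamma> A\<bar>\<^sup>2 \<le> 1 - \<delta>\<close> (lemma \<open>pointwise_bounds\<close>).  Substitute \<open>q = \<gamma> p\<close>
  and apply the inverse of the negative Laplacian to both sides.  With the Riesz transforms
  \<open>R\<^sub>i\<^sub>j = \<partial>\<^sub>i \<partial>\<^sub>j \<Delta>\<^sup>-\<^sup>1\<close> the equation becomes \<open>T p = (- \<Delta>)\<^sup>-\<^sup>1 f\<close>, where
  \<open>T p\<close> is the sum of all \<open>R\<^sub>i\<^sub>j (\<gamma> A\<^sub>i\<^sub>j p)\<close> (lemma \<open>is_solution_iff_T\<close>).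

  On functions of mean zero, \<open>R = (R\<^sub>i\<^sub>j)\<close> is an isometry into matrix fields, its trace is
  the identity, and its entries are self-adjoint.  Hence \<open>\<langle>w, p - T p\<rangle>\<close> is the integral of
  \<open>((I - \<gamma> A) : R w) p\<close>, and with \<open>w = p - T p\<close> it follows that
  \<open>I - T\<close> has norm at most \<open>\<kappa> = \<surd>(1 - \<delta>) < 1\<close> (lemma \<open>T_near_identity\<close>).  Banach's fixed point theorem
  yields exactly one solution \<open>p\<close> of mean zero, and it satisfies
  \<open>(1 - \<kappa>) \<parallel>p\<parallel> \<le> \<parallel>(- \<Delta>)\<^sup>-\<^sup>1 f\<parallel> \<le> \<parallel>f\<parallel> / (4 \<pi>\<^sup>2)\<close>.

  A solution of the homogeneous equation is therefore determined by the mean of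
  \<open>q / \<gamma>\<close>, so these solutions form a line.  The line contains the invariant measure \<open>r\<close>,
  which gives uniqueness up to multiples of \<open>r\<close> (lemma \<open>homogeneous_solution\<close>).  The
  solution of mean zero is \<open>q - (\<integral> q) r\<close> for the solution \<open>q = \<gamma> p\<close> just found, whence
  the factor \<open>1 + \<parallel>r\<parallel>\<close> in the bound.

  The passage to Fourier coefficients rests on three facts about periodic functions: the
  plane waves are complete (theorem \<open>fourier_complete\<close>), every square summable family of
  coefficients with the symmetry of a real function is attained (lemma \<open>riesz_fischer\<close>), and weak derivatives, which are defined
  through compactly supported test functions, act on the coefficients as multipliers (lemma
  \<open>fourier_weak_partial\<close>).
\<close>

section \<open>The space of square integrable periodic functions\<close>

abbreviation cell_measure :: "(real^'n) measure" where
  "cell_measure \<equiv> restrict_space lebesgue unit_cell"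

lemma cell_integral_eq: "cell_integral u = (LINT x|cell_measure. u x)"
  unfolding cell_integral_def set_lebesgue_integral_def
  by (subst integral_restrict_space) auto

lemma emeasure_cell: "emeasure (cell_measure :: (real^'n) measure) unit_cell = 1"
proof -
  have *: "(1::real^'n) \<bullet> b = 1" if "b \<in> Basis" for b
    using that by (auto simp: Basis_vec_def inner_axis)
  then show ?thesis
    by (subst emeasure_restrict_space) (auto simp: emeasure_lborel_box_eq)
qed

lemma space_cell [simp]: "space (cell_measure :: (real^'n) measure) = unit_cell"
  by (simp add: space_restrict_space)

lemma finite_measure_cell: "finite_measure (cell_measure :: (real^'n) measure)"
  by (intro finite_measureI) (simp add: emeasure_cell)

lemma measure_cell: "measure (cell_measure :: (real^'n) measure) unit_cell = 1"
  by (simp add: measure_def emeasure_cell)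

lemma measurable_cell: "u \<in> borel_measurable lebesgue \<Longrightarrow> u \<in> borel_measurable cell_measure"
  by (rule measurable_restrict_space1)

lemma integrable_cell_const [simp, intro]:
  "integrable (cell_measure :: (real^'n) measure) (\<lambda>x. c::real)"
proof -
  interpret finite_measure "cell_measure :: (real^'n) measure" by (rule finite_measure_cell)
  show ?thesis by simp
qed

lemma cell_integral_const [simp]: "cell_integral (\<lambda>x. c) = c"
  by (simp add: cell_integral_eq measure_cell)

lemma AE_cell_iff: "(AE x in cell_measure. P x) \<longleftrightarrow> (AE x in lebesgue. x \<in> unit_cell \<longrightarrow> P x)"
  by (subst AE_restrict_space_iff) auto

lemma AE_lebesgue_cell: "(AE x in lebesgue. P x) \<Longrightarrow> (AE x in cell_measure. P x)"
  by (auto simp: AE_cell_iff)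

lemma integrable_cell_bound:
  assumes "integrable cell_measure g" "f \<in> borel_measurable lebesgue"
    and "AE x in cell_measure. \<bar>f x\<bar> \<le> (g x :: real)"
  shows "integrable cell_measure (f :: real^'n \<Rightarrow> real)"
  by (rule Bochner_Integration.integrable_bound[OF assms(1) measurable_cell[OF assms(2)]])
     (use assms(3) in eventually_elim, auto)

lemma cell_integral_cong_AE:
  assumes "AE x in lebesgue. u x = v x"
    and "u \<in> borel_measurable lebesgue" "v \<in> borel_measurable lebesgue"
  shows "cell_integral u = cell_integral v"
  unfolding cell_integral_eq
  by (rule integral_cong_AE) (use assms in \<open>auto intro: measurable_cell AE_lebesgue_cell\<close>)

lemma L2_per_iff:
  "u \<in> L2_per \<longleftrightarrow> u \<in> borel_measurable lebesgue \<and> periodic u \<and>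
     integrable cell_measure (\<lambda>x. (u x)\<^sup>2)"
  unfolding L2_per_def set_integrable_def
  by (subst integrable_restrict_space) auto

lemma L2_per_measurable [intro]: "u \<in> L2_per \<Longrightarrow> u \<in> borel_measurable lebesgue"
  by (simp add: L2_per_iff)

lemma periodic_const: "periodic (\<lambda>x. c)"
  by (simp add: periodic_def)

lemma periodic_comp:
  assumes "periodic u" shows "periodic (\<lambda>x. F (u x))"
  unfolding periodic_def
proof (intro allI impI)
  fix k :: "real^'a" assume k: "\<forall>i. k $ i \<in> \<int>"
  have "AE x in lebesgue. u (x + k) = u x" using assms k by (auto simp: periodic_def)
  then show "AE x in lebesgue. F (u (x + k)) = F (u x)" by eventually_elim simp
qed

lemma periodic_comp2:
  assumes "periodic u" "periodic v" shows "periodic (\<lambda>x. F (u x) (v x))"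
  unfolding periodic_def
proof (intro allI impI)
  fix k :: "real^'a" assume k: "\<forall>i. k $ i \<in> \<int>"
  have "AE x in lebesgue. u (x + k) = u x" "AE x in lebesgue. v (x + k) = v x"
    using assms k by (auto simp: periodic_def)
  then show "AE x in lebesgue. F (u (x + k)) (v (x + k)) = F (u x) (v x)" by eventually_elim simp
qed

lemma L2_per_bounded:
  fixes u :: "real^'n \<Rightarrow> real"
  assumes "u \<in> borel_measurable lebesgue" "periodic u" "AE x in lebesgue. \<bar>u x\<bar> \<le> C"
  shows "u \<in> L2_per"
  unfolding L2_per_iff
proof (intro conjI assms)
  show "integrable cell_measure (\<lambda>x. (u x)\<^sup>2)"
  proof (rule integrable_cell_bound[where g = "\<lambda>x. C\<^sup>2"])
    have "AE x in lebesgue. \<bar>(u x)\<^sup>2\<bar> \<le> C\<^sup>2"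
      using assms(3) by eventually_elim (metis abs_ge_zero abs_power2 order_trans power2_abs power_mono)
    then show "AE x in cell_measure. \<bar>(u x)\<^sup>2\<bar> \<le> C\<^sup>2" by (rule AE_lebesgue_cell)
  qed (use assms in measurable)
qed

lemma L2_per_const [simp, intro]: "(\<lambda>x. c) \<in> L2_per"
  by (rule L2_per_bounded[where C = "\<bar>c\<bar>"]) (auto simp: periodic_const)

lemma L2_mult_integrable:
  assumes "u \<in> L2_per" "v \<in> L2_per"
  shows "integrable cell_measure (\<lambda>x. u x * v x)"
proof (rule integrable_cell_bound[where g = "\<lambda>x. (u x)\<^sup>2 + (v x)\<^sup>2"])
  have "\<bar>a * b\<bar> \<le> a\<^sup>2 + b\<^sup>2" for a b :: real
  proof -
    have "0 \<le> (\<bar>a\<bar> - \<bar>b\<bar>)\<^sup>2" "0 \<le> \<bar>a\<bar> * \<bar>b\<bar>" by auto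
    then show ?thesis unfolding power2_diff abs_mult power2_abs by linarith
  qed
  then show "AE x in cell_measure. \<bar>u x * v x\<bar> \<le> (u x)\<^sup>2 + (v x)\<^sup>2" by simp
qed (use assms in \<open>auto simp: L2_per_iff\<close>)

lemma L2_per_integrable: "u \<in> L2_per \<Longrightarrow> integrable cell_measure u"
  using L2_mult_integrable[of u "\<lambda>x. 1"] by simp

lemma L2_per_add [intro]:
  assumes "u \<in> L2_per" "v \<in> L2_per" shows "(\<lambda>x. u x + v x) \<in> L2_per"
  unfolding L2_per_iff
proof (intro conjI)
  show "periodic (\<lambda>x. u x + v x)"
    using assms by (intro periodic_comp2[where F = "(+)"]) (auto simp: L2_per_iff)
  have "integrable cell_measure (\<lambda>x. (u x)\<^sup>2 + (v x)\<^sup>2 + 2 * (u x * v x))"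
    using assms L2_mult_integrable[OF assms] by (auto simp: L2_per_iff)
  then show "integrable cell_measure (\<lambda>x. (u x + v x)\<^sup>2)"
    by (simp add: power2_sum mult.assoc)
qed (use assms in \<open>intro borel_measurable_add L2_per_measurable\<close>)

lemma L2_per_mult_bounded:
  assumes "u \<in> L2_per" "b \<in> borel_measurable lebesgue" "periodic b"
    and "AE x in lebesgue. \<bar>b x\<bar> \<le> C"
  shows "(\<lambda>x. b x * u x) \<in> L2_per"
  unfolding L2_per_iff
proof (intro conjI)
  show "periodic (\<lambda>x. b x * u x)"
    using assms by (intro periodic_comp2[where F = "(*)"]) (auto simp: L2_per_iff)
  show "integrable cell_measure (\<lambda>x. (b x * u x)\<^sup>2)"
  proof (rule integrable_cell_bound[where g = "\<lambda>x. C\<^sup>2 * (u x)\<^sup>2"])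
    have "AE x in lebesgue. \<bar>(b x * u x)\<^sup>2\<bar> \<le> C\<^sup>2 * (u x)\<^sup>2"
      using assms(4)
      by eventually_elim
        (metis abs_ge_zero abs_mult abs_of_nonneg mult_right_mono power2_abs power_mono
          power_mult_distrib zero_le_power2)
    then show "AE x in cell_measure. \<bar>(b x * u x)\<^sup>2\<bar> \<le> C\<^sup>2 * (u x)\<^sup>2" by (rule AE_lebesgue_cell)
  qed (use assms in \<open>auto simp: L2_per_iff intro!: borel_measurable_power borel_measurable_times\<close>)
qed (use assms(1,2) in \<open>auto simp: L2_per_iff intro: borel_measurable_times\<close>)

lemma L2_per_scale [intro]: "u \<in> L2_per \<Longrightarrow> (\<lambda>x. c * u x) \<in> L2_per"
  by (rule L2_per_mult_bounded[where C = "\<bar>c\<bar>"]) (auto simp: periodic_const)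

lemma L2_per_uminus [intro]: "u \<in> L2_per \<Longrightarrow> (\<lambda>x. - u x) \<in> L2_per"
  using L2_per_scale[of u "-1"] by simp

lemma L2_per_diff [intro]: "u \<in> L2_per \<Longrightarrow> v \<in> L2_per \<Longrightarrow> (\<lambda>x. u x - v x) \<in> L2_per"
  using L2_per_add[of u "\<lambda>x. - v x"] by auto

lemma L2_per_sum [intro]:
  "(\<And>i. i \<in> I \<Longrightarrow> u i \<in> L2_per) \<Longrightarrow> (\<lambda>x. \<Sum>i\<in>I. u i x) \<in> L2_per"
  by (induction I rule: infinite_finite_induct) auto

lemma L2_inner_eq: "L2_inner u v = (LINT x|cell_measure. u x * v x)"
  by (simp add: L2_inner_def cell_integral_eq)

lemma L2_inner_commute: "L2_inner u v = L2_inner v u"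
  by (simp add: L2_inner_def mult.commute)

lemma L2_inner_add_right:
  "u \<in> L2_per \<Longrightarrow> v \<in> L2_per \<Longrightarrow> w \<in> L2_per \<Longrightarrow>
    L2_inner u (\<lambda>x. v x + w x) = L2_inner u v + L2_inner u w"
  by (simp add: L2_inner_eq algebra_simps Bochner_Integration.integral_add L2_mult_integrable)

lemma L2_inner_diff_right:
  "u \<in> L2_per \<Longrightarrow> v \<in> L2_per \<Longrightarrow> w \<in> L2_per \<Longrightarrow>
    L2_inner u (\<lambda>x. v x - w x) = L2_inner u v - L2_inner u w"
  by (simp add: L2_inner_eq algebra_simps Bochner_Integration.integral_diff L2_mult_integrable)

lemma L2_inner_scale_right: "L2_inner u (\<lambda>x. c * v x) = c * L2_inner u v"
  by (simp add: L2_inner_eq mult.left_commute)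

lemma L2_inner_uminus_right: "L2_inner u (\<lambda>x. - v x) = - L2_inner u v"
  using L2_inner_scale_right[of u "-1" v] by simp

lemma L2_inner_sum_right:
  assumes "u \<in> L2_per" "\<And>i. i \<in> I \<Longrightarrow> v i \<in> L2_per"
  shows "L2_inner u (\<lambda>x. \<Sum>i\<in>I. v i x) = (\<Sum>i\<in>I. L2_inner u (v i))"
  using assms(2)
proof (induction I rule: infinite_finite_induct)
  case (insert i I)
  then have "L2_inner u (\<lambda>x. v i x + (\<Sum>i\<in>I. v i x)) = L2_inner u (v i) + (\<Sum>i\<in>I. L2_inner u (v i))"
    using assms(1) L2_per_sum[of I v] by (subst L2_inner_add_right) auto
  then show ?case using insert by simp
qed (auto simp: L2_inner_def)

lemma L2_inner_add_left:
  "u \<in> L2_per \<Longrightarrow> v \<in> L2_per \<Longrightarrow> w \<in> L2_per \<Longrightarrow>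
    L2_inner (\<lambda>x. v x + w x) u = L2_inner v u + L2_inner w u"
  using L2_inner_add_right[of u v w] by (simp add: L2_inner_commute)

lemma L2_inner_diff_left:
  "u \<in> L2_per \<Longrightarrow> v \<in> L2_per \<Longrightarrow> w \<in> L2_per \<Longrightarrow>
    L2_inner (\<lambda>x. v x - w x) u = L2_inner v u - L2_inner w u"
  using L2_inner_diff_right[of u v w] by (simp add: L2_inner_commute)

lemma L2_inner_scale_left: "L2_inner (\<lambda>x. c * v x) u = c * L2_inner v u"
  using L2_inner_scale_right[of u c v] by (simp add: L2_inner_commute)

lemma L2_inner_self_nonneg [simp]: "0 \<le> L2_inner u u"
  by (simp add: L2_inner_eq)

lemma L2_norm_nonneg [simp]: "0 \<le> L2_norm u"
  by (simp add: L2_norm_def)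

lemma L2_norm_sq: "(L2_norm u)\<^sup>2 = L2_inner u u"
  by (simp add: L2_norm_def)

lemma L2_norm_scale: "L2_norm (\<lambda>x. c * u x) = \<bar>c\<bar> * L2_norm u"
proof -
  have "L2_inner (\<lambda>x. c * u x) (\<lambda>x. c * u x) = c\<^sup>2 * L2_inner u u"
    by (simp add: L2_inner_scale_left L2_inner_scale_right power2_eq_square)
  then show ?thesis by (simp add: L2_norm_def real_sqrt_mult)
qed

lemma L2_norm_uminus: "L2_norm (\<lambda>x. - u x) = L2_norm u"
  using L2_norm_scale[of "-1" u] by simp

lemma L2_inner_cong_AE:
  assumes "AE x in lebesgue. u x = u' x" "AE x in lebesgue. v x = v' x"
    and "u \<in> borel_measurable lebesgue" "u' \<in> borel_measurable lebesgue"
    and "v \<in> borel_measurable lebesgue" "v' \<in> borel_measurable lebesgue"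
  shows "L2_inner u v = L2_inner u' v'"
  unfolding L2_inner_def
  by (rule cell_integral_cong_AE) (use assms(1,2) in eventually_elim, use assms(3-) in auto)

lemma L2_norm_mono_AE:
  assumes "u \<in> L2_per" "v \<in> L2_per" "AE x in lebesgue. \<bar>u x\<bar> \<le> \<bar>v x\<bar>"
  shows "L2_norm u \<le> L2_norm v"
  unfolding L2_norm_def L2_inner_eq
proof (intro real_sqrt_le_mono integral_mono_AE L2_mult_integrable assms(1,2))
  have "AE x in lebesgue. u x * u x \<le> v x * v x"
    using assms(3) by eventually_elim (metis abs_le_square_iff power2_eq_square)
  then show "AE x in cell_measure. u x * u x \<le> v x * v x" by (rule AE_lebesgue_cell)
qed

text \<open>
  The form is only positive semidefinite on functions, so the case of a null function
  \<open>v\<close> needs its own argument.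
\<close>

lemma L2_Cauchy_Schwarz:
  assumes u: "u \<in> L2_per" and v: "v \<in> L2_per"
  shows "\<bar>L2_inner u v\<bar> \<le> L2_norm u * L2_norm v"
proof -
  define a b c where "a = L2_inner u u" and "b = L2_inner u v" and "c = L2_inner v v"
  have q: "0 \<le> a - 2 * t * b + t\<^sup>2 * c" for t
  proof -
    have "0 \<le> L2_inner (\<lambda>x. u x - t * v x) (\<lambda>x. u x - t * v x)" by simp
    also have "\<dots> = a - 2 * t * b + t\<^sup>2 * c"
      using u v L2_per_scale[OF v, of t] L2_per_diff[OF u L2_per_scale[OF v, of t]]
      by (simp add: L2_inner_diff_left L2_inner_diff_right L2_inner_scale_left
          L2_inner_scale_right a_def b_def c_def L2_inner_commute[of v u]
          power2_eq_square algebra_simps)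
    finally show ?thesis .
  qed
  have "0 \<le> a" "0 \<le> c" by (auto simp: a_def c_def)
  have "b\<^sup>2 \<le> a * c"
  proof (cases "c = 0")
    case True
    have "b = 0"
    proof (rule ccontr)
      assume "b \<noteq> 0"
      then show False using q[of "(a + 1) / (2 * b)"] True by simp
    qed
    then show ?thesis using \<open>0 \<le> a\<close> \<open>0 \<le> c\<close> by simp
  next
    case False
    then have "0 < c" using \<open>0 \<le> c\<close> by simp
    then show ?thesis using q[of "b / c"] by (simp add: field_simps power2_eq_square)
  qed
  then have "sqrt (b\<^sup>2) \<le> sqrt (a * c)" by (rule real_sqrt_le_mono)
  then show ?thesis by (simp add: L2_norm_def a_def b_def c_def real_sqrt_mult)
qed

lemma L2_norm_triangle:
  assumes u: "u \<in> L2_per" and v: "v \<in> L2_per"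
  shows "L2_norm (\<lambda>x. u x + v x) \<le> L2_norm u + L2_norm v"
proof (rule power2_le_imp_le)
  have "(L2_norm (\<lambda>x. u x + v x))\<^sup>2 = (L2_norm u)\<^sup>2 + 2 * L2_inner u v + (L2_norm v)\<^sup>2"
    using assms L2_per_add[OF u v]
    by (simp add: L2_norm_sq L2_inner_add_left L2_inner_add_right L2_inner_commute[of v u])
  also have "\<dots> \<le> (L2_norm u + L2_norm v)\<^sup>2"
    using L2_Cauchy_Schwarz[OF u v] by (simp add: power2_sum)
  finally show "(L2_norm (\<lambda>x. u x + v x))\<^sup>2 \<le> (L2_norm u + L2_norm v)\<^sup>2" .
qed simp

lemma L2_norm_triangle3:
  assumes "u \<in> L2_per" "v \<in> L2_per" "w \<in> L2_per"
  shows "L2_norm (\<lambda>x. u x - w x) \<le> L2_norm (\<lambda>x. u x - v x) + L2_norm (\<lambda>x. v x - w x)"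
  using L2_norm_triangle[of "\<lambda>x. u x - v x" "\<lambda>x. v x - w x"] assms by auto

lemma L2_norm_1: "L2_norm (\<lambda>x. 1) = 1"
  by (simp add: L2_norm_def L2_inner_def)

lemma cell_integral_le_norm: "u \<in> L2_per \<Longrightarrow> \<bar>cell_integral u\<bar> \<le> L2_norm u"
  using L2_Cauchy_Schwarz[of u "\<lambda>x. 1"] by (simp add: L2_norm_1 L2_inner_def)

lemma cell_integral_abs_le_norm: "u \<in> L2_per \<Longrightarrow> cell_integral (\<lambda>x. \<bar>u x\<bar>) \<le> L2_norm u"
proof -
  assume u: "u \<in> L2_per"
  have "(\<lambda>x. \<bar>u x\<bar>) \<in> L2_per"
    using u by (auto simp: L2_per_iff intro!: periodic_comp[where F = abs])
  from cell_integral_le_norm[OF this] show ?thesis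
    by (simp add: L2_norm_def L2_inner_def)
qed

lemma cell_integral_add: "u \<in> L2_per \<Longrightarrow> v \<in> L2_per \<Longrightarrow>
    cell_integral (\<lambda>x. u x + v x) = cell_integral u + cell_integral v"
  by (simp add: cell_integral_eq L2_per_integrable)

lemma cell_integral_diff: "u \<in> L2_per \<Longrightarrow> v \<in> L2_per \<Longrightarrow>
    cell_integral (\<lambda>x. u x - v x) = cell_integral u - cell_integral v"
  by (simp add: cell_integral_eq L2_per_integrable)

lemma cell_integral_scale: "cell_integral (\<lambda>x. c * u x) = c * cell_integral u"
  by (simp add: cell_integral_eq)

text \<open>
  The cell has finite measure, so a Cauchy sequence in \<open>L\<^sup>2\<close> is one in \<open>L\<^sup>1\<close> and a
  subsequence converges almost everywhere.  Its pointwise limit inherits periodicity.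
\<close>

lemma L2_complete:
  fixes u :: "nat \<Rightarrow> real^'n \<Rightarrow> real"
  assumes u: "\<And>m. u m \<in> L2_per"
    and Cauchy: "\<And>e. 0 < e \<Longrightarrow> \<exists>N. \<forall>i\<ge>N. \<forall>j\<ge>N. L2_norm (\<lambda>x. u i x - u j x) < e"
  obtains v where "v \<in> L2_per" "(\<lambda>m. L2_norm (\<lambda>x. u m x - v x)) \<longlonglongrightarrow> 0"
proof -
  have [measurable]: "u m \<in> borel_measurable lebesgue" for m
    using u by auto
  have uc [measurable]: "u m \<in> borel_measurable cell_measure" for m
    by (rule measurable_cell) simp
  have L1: "\<exists>N. \<forall>i\<ge>N. \<forall>j\<ge>N. (LINT x|cell_measure. norm (u i x - u j x)) < e" if "0 < e" for e
  proof -
    obtain N where N: "\<forall>i\<ge>N. \<forall>j\<ge>N. L2_norm (\<lambda>x. u i x - u j x) < e"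
      using Cauchy[OF \<open>0 < e\<close>] by blast
    have "(LINT x|cell_measure. norm (u i x - u j x)) \<le> L2_norm (\<lambda>x. u i x - u j x)" for i j
      using cell_integral_abs_le_norm[OF L2_per_diff[OF u u], of i j] by (simp add: cell_integral_eq)
    then show ?thesis using N by (meson order_le_less_trans)
  qed
  obtain r where r: "strict_mono r" "AE x in cell_measure. Cauchy (\<lambda>i. u (r i) x)"
    by (rule cauchy_L1_AE_cauchy_subseq[of cell_measure u, OF L2_per_integrable[OF u] L1])
  define v where "v x = lim (\<lambda>i. u (r i) x)" for x
  have vm [measurable]: "v \<in> borel_measurable lebesgue"
    unfolding v_def by measurable
  have vc [measurable]: "v \<in> borel_measurable cell_measure"
    by (rule measurable_cell) (rule vm)
  have vp: "periodic v"
    unfolding periodic_def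
  proof (intro allI impI)
    fix k :: "real^'n" assume k: "\<forall>i. k $ i \<in> \<int>"
    have "AE x in lebesgue. u m (x + k) = u m x" for m
      using u[of m] k unfolding L2_per_iff periodic_def by blast
    then have "AE x in lebesgue. \<forall>m. u m (x + k) = u m x" by (simp add: AE_all_countable)
    then show "AE x in lebesgue. v (x + k) = v x" by eventually_elim (simp add: v_def)
  qed
  have lim: "AE x in cell_measure. (\<lambda>i. u (r i) x) \<longlonglongrightarrow> v x"
    using r(2) by eventually_elim (simp add: v_def Cauchy_convergent_iff convergent_LIMSEQ_iff)
  \<comment> \<open>Fatou's lemma along the subsequence turns the pointwise limit into a limit in the mean.\<close>
  have fatou: "(\<integral>\<^sup>+x. ennreal ((u m x - v x)\<^sup>2) \<partial>cell_measure) \<le> ennreal (e\<^sup>2)"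
    if N: "\<forall>i\<ge>N. \<forall>j\<ge>N. L2_norm (\<lambda>x. u i x - u j x) < e" and "m \<ge> N" for m N e
  proof -
    have "(\<integral>\<^sup>+x. ennreal ((u m x - v x)\<^sup>2) \<partial>cell_measure)
        = (\<integral>\<^sup>+x. liminf (\<lambda>i. ennreal ((u m x - u (r i) x)\<^sup>2)) \<partial>cell_measure)"
    proof (rule nn_integral_cong_AE)
      show "AE x in cell_measure.
          ennreal ((u m x - v x)\<^sup>2) = liminf (\<lambda>i. ennreal ((u m x - u (r i) x)\<^sup>2))"
        using lim
      proof eventually_elim
        case (elim x)
        then have "(\<lambda>i. ennreal ((u m x - u (r i) x)\<^sup>2)) \<longlonglongrightarrow> ennreal ((u m x - v x)\<^sup>2)"
          by (intro tendsto_intros)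
        from lim_imp_Liminf[OF sequentially_bot this] show ?case by simp
      qed
    qed
    also have "\<dots> \<le> liminf (\<lambda>i. \<integral>\<^sup>+x. ennreal ((u m x - u (r i) x)\<^sup>2) \<partial>cell_measure)"
      by (rule nn_integral_liminf) measurable
    also have "\<dots> \<le> ennreal (e\<^sup>2)"
    proof (rule Liminf_le)
      have "(\<integral>\<^sup>+x. ennreal ((u m x - u (r i) x)\<^sup>2) \<partial>cell_measure) \<le> ennreal (e\<^sup>2)" if "i \<ge> N" for i
      proof -
        have d: "(\<lambda>x. u m x - u (r i) x) \<in> L2_per" using u by auto
        have "(\<integral>\<^sup>+x. ennreal ((u m x - u (r i) x)\<^sup>2) \<partial>cell_measure)
            = ennreal (LINT x|cell_measure. (u m x - u (r i) x)\<^sup>2)"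
          using d by (intro nn_integral_eq_integral) (auto simp: L2_per_iff)
        also have "(LINT x|cell_measure. (u m x - u (r i) x)\<^sup>2) = (L2_norm (\<lambda>x. u m x - u (r i) x))\<^sup>2"
          by (subst L2_norm_sq) (simp add: L2_inner_eq power2_eq_square)
        also have "\<dots> \<le> e\<^sup>2"
          using N \<open>m \<ge> N\<close> \<open>i \<ge> N\<close> seq_suble[OF r(1), of i] by (intro power_mono) (auto intro: less_imp_le)
        finally show ?thesis by (simp add: ennreal_leI)
      qed
      then show "\<forall>\<^sub>F i in sequentially. (\<integral>\<^sup>+x. ennreal ((u m x - u (r i) x)\<^sup>2) \<partial>cell_measure) \<le> ennreal (e\<^sup>2)"
        by (auto simp: eventually_sequentially)
    qed simp
    finally show ?thesis .
  qed
  have diff: "(\<lambda>x. u m x - v x) \<in> L2_per \<and> L2_norm (\<lambda>x. u m x - v x) \<le> e"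
    if N: "\<forall>i\<ge>N. \<forall>j\<ge>N. L2_norm (\<lambda>x. u i x - u j x) < e" and "m \<ge> N" "0 < e" for m N e
  proof -
    have "integrable cell_measure (\<lambda>x. (u m x - v x)\<^sup>2)"
      using fatou[OF N \<open>m \<ge> N\<close>] by (intro integrableI_bounded) (auto intro: le_less_trans)
    moreover have "periodic (\<lambda>x. u m x - v x)"
      using u[of m] vp by (intro periodic_comp2[where F = "(-)"]) (auto simp: L2_per_iff)
    ultimately have "(\<lambda>x. u m x - v x) \<in> L2_per" by (simp add: L2_per_iff)
    moreover have "(L2_norm (\<lambda>x. u m x - v x))\<^sup>2 \<le> e\<^sup>2"
      using fatou[OF N \<open>m \<ge> N\<close>] \<open>integrable cell_measure (\<lambda>x. (u m x - v x)\<^sup>2)\<close>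
      by (subst (asm) nn_integral_eq_integral)
         (auto simp: L2_norm_sq L2_inner_eq power2_eq_square[of "u m _ - v _"])
    ultimately show ?thesis using \<open>0 < e\<close> by (auto intro: power2_le_imp_le)
  qed
  show ?thesis
  proof
    obtain N where N: "\<forall>i\<ge>N. \<forall>j\<ge>N. L2_norm (\<lambda>x. u i x - u j x) < 1"
      using Cauchy[of 1] by auto
    have "(\<lambda>x. u N x - (u N x - v x)) \<in> L2_per"
      by (rule L2_per_diff[OF u conjunct1[OF diff[OF N]]]) auto
    then show "v \<in> L2_per" by simp
    show "(\<lambda>m. L2_norm (\<lambda>x. u m x - v x)) \<longlonglongrightarrow> 0"
    proof (rule LIMSEQ_I)
      fix e :: real assume "0 < e"
      then obtain N where N: "\<forall>i\<ge>N. \<forall>j\<ge>N. L2_norm (\<lambda>x. u i x - u j x) < e / 2"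
        using Cauchy[of "e / 2"] by auto
      then show "\<exists>N. \<forall>m\<ge>N. norm (L2_norm (\<lambda>x. u m x - v x) - 0) < e"
        using diff[OF N] \<open>0 < e\<close> by (intro exI[of _ N]) fastforce
    qed
  qed
qed

section \<open>Translations and unfolding of periodic functions\<close>

lemma lebesgue_distr_translation: "distr lebesgue lebesgue (\<lambda>x. x + k) = (lebesgue :: 'a::euclidean_space measure)"
  and translation_measurable_lebesgue [measurable]: "(\<lambda>x. x + k) \<in> lebesgue \<rightarrow>\<^sub>M (lebesgue :: 'a measure)"
proof -
  have *: "(\<lambda>x. k + (\<Sum>j\<in>Basis. (1 * (x \<bullet> j)) *\<^sub>R j)) = (\<lambda>x::'a. x + k)"
    by (auto simp: euclidean_representation add.commute)
  show "distr lebesgue lebesgue (\<lambda>x. x + k) = (lebesgue :: 'a measure)"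
    using lebesgue_affine_euclidean[of "\<lambda>_::'a. 1" k] unfolding * by (simp add: density_1)
  show "(\<lambda>x. x + k) \<in> lebesgue \<rightarrow>\<^sub>M (lebesgue :: 'a measure)"
    using lebesgue_affine_measurable[of "\<lambda>_::'a. 1" k] unfolding * by simp
qed

lemma AE_lebesgue_translation:
  fixes k :: "'a::euclidean_space"
  assumes "AE x in lebesgue. P x" shows "AE x in lebesgue. P (x + k)"
  by (rule AE_distrD[OF translation_measurable_lebesgue])
     (subst lebesgue_distr_translation, rule assms)

lemma integral_lebesgue_translation:
  fixes f :: "'a::euclidean_space \<Rightarrow> real"
  assumes "f \<in> borel_measurable lebesgue"
  shows "(LINT x|lebesgue. f (x + k)) = (LINT x|lebesgue. f x)"
  using integral_distr[OF translation_measurable_lebesgue assms, of k]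
  by (simp add: lebesgue_distr_translation)

lemma integrable_lebesgue_translation:
  fixes f :: "'a::euclidean_space \<Rightarrow> real"
  assumes "integrable lebesgue f"
  shows "integrable lebesgue (\<lambda>x. f (x + k))"
  using integrable_distr[OF translation_measurable_lebesgue, of k f] assms
  by (simp add: lebesgue_distr_translation)

definition lattice_vec :: "int^'n \<Rightarrow> real^'n" where
  "lattice_vec k = (\<chi> i. of_int (k $ i))"

definition floor_vec :: "real^'n \<Rightarrow> int^'n" where
  "floor_vec x = (\<chi> i. \<lfloor>x $ i\<rfloor>)"

lemma lattice_vec_nth [simp]: "lattice_vec k $ i = of_int (k $ i)"
  by (simp add: lattice_vec_def)

lemma lattice_vec_uminus [simp]: "lattice_vec (- k) = - lattice_vec k"
  by (simp add: vec_eq_iff)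

lemma floor_vec_nth [simp]: "floor_vec x $ i = \<lfloor>x $ i\<rfloor>"
  by (simp add: floor_vec_def)

lemma periodic_lattice: "periodic u \<Longrightarrow> AE x in lebesgue. u (x + lattice_vec k) = u x"
  by (auto simp: periodic_def)

lemma mem_unit_cell: "(x :: real^'n) \<in> unit_cell \<longleftrightarrow> (\<forall>i. 0 < x $ i \<and> x $ i < 1)"
  by (simp add: mem_box_cart)

lemma AE_coordinate_noninteger: "AE x in lebesgue. \<forall>i. (x :: real^'n) $ i \<notin> \<int>"
proof -
  have "AE x in lebesgue. (x :: real^'n) $ i \<noteq> of_int m" for i m
  proof -
    have "negligible {x :: real^'n. x \<bullet> axis i 1 = of_int m}"
      by (rule negligible_standard_hyperplane) (auto simp: axis_in_Basis_iff)
    then have "AE x in lebesgue. x \<notin> {x :: real^'n. x \<bullet> axis i 1 = of_int m}"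
      unfolding negligible_iff_null_sets by (rule AE_not_in)
    then show ?thesis by eventually_elim (simp add: inner_axis)
  qed
  then have "AE x in lebesgue. \<forall>i m. (x :: real^'n) $ i \<noteq> of_int m"
    by (simp add: AE_all_countable)
  then show ?thesis by eventually_elim (auto elim!: Ints_cases)
qed

lemma floor_vec_eq_0_iff:
  assumes "\<forall>i. (x :: real^'n) $ i \<notin> \<int>"
  shows "floor_vec x = 0 \<longleftrightarrow> x \<in> unit_cell"
proof -
  have "(\<lfloor>x $ i\<rfloor> = 0) = (0 < x $ i \<and> x $ i < 1)" for i
    using assms by (auto simp: floor_eq_iff less_le) (metis Ints_0)
  then show ?thesis by (simp add: mem_unit_cell vec_eq_iff)
qed

lemma floor_vec_add_lattice [simp]: "floor_vec (x + lattice_vec k) = floor_vec x + k"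
  by (simp add: vec_eq_iff)

text \<open>
  Almost every point is a lattice translate of a point of the open cell, and there are only
  countably many translates.
\<close>

lemma periodic_AE_zero:
  fixes u :: "real^'n \<Rightarrow> real"
  assumes "periodic u" "AE x in cell_measure. u x = 0"
  shows "AE x in lebesgue. u x = 0"
proof -
  have "AE x in lebesgue. x \<in> unit_cell \<longrightarrow> u x = 0"
    using assms(2) by (simp add: AE_cell_iff)
  then have "AE x in lebesgue. x + lattice_vec k \<in> unit_cell \<longrightarrow> u (x + lattice_vec k) = 0" for k
    by (rule AE_lebesgue_translation)
  then have "AE x in lebesgue. \<forall>k. x + lattice_vec k \<in> unit_cell \<longrightarrow> u (x + lattice_vec k) = 0"
    by (simp add: AE_all_countable)
  moreover have "AE x in lebesgue. \<forall>k. u (x + lattice_vec k) = u x"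
    using periodic_lattice[OF assms(1)] by (simp add: AE_all_countable)
  ultimately show ?thesis using AE_coordinate_noninteger
  proof eventually_elim
    case (elim x)
    define y where "y = x + lattice_vec (- floor_vec x)"
    have "\<forall>i. y $ i \<notin> \<int>"
    proof (rule allI, rule notI)
      fix i assume "y $ i \<in> \<int>"
      then have "y $ i + of_int \<lfloor>x $ i\<rfloor> \<in> \<int>" by (intro Ints_add) auto
      then show False using elim(3) by (simp add: y_def)
    qed
    moreover have "floor_vec y = 0" unfolding y_def by (simp only: floor_vec_add_lattice) simp
    ultimately have "y \<in> unit_cell" by (simp add: floor_vec_eq_0_iff)
    then have "u y = 0" using elim(1) unfolding y_def by blast
    then show ?case using elim(2) unfolding y_def by metis
  qed
qed

lemma L2_norm_eq_0_iff:
  assumes "u \<in> L2_per"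
  shows "L2_norm u = 0 \<longleftrightarrow> (AE x in lebesgue. u x = 0)"
proof -
  have "L2_norm u = 0 \<longleftrightarrow> (AE x in cell_measure. u x * u x = 0)"
    unfolding L2_norm_def L2_inner_eq
    using integral_nonneg_eq_0_iff_AE[OF L2_mult_integrable[OF assms assms]] by simp
  also have "\<dots> \<longleftrightarrow> (AE x in lebesgue. u x = 0)"
    using periodic_AE_zero[of u] assms AE_lebesgue_cell[of "\<lambda>x. u x = 0"] by (auto simp: L2_per_iff)
  finally show ?thesis .
qed

text \<open>
  Cutting the support of \<open>\<psi>\<close> into lattice translates of the cell moves the whole integral
  back onto the cell.  This is the bridge between integrals against compactly supported test
  functions on the whole space and integrals of periodic functions over the cell.
\<close>

lemma periodic_unfold:
  fixes u \<psi> :: "real^'n \<Rightarrow> real"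
  assumes u: "u \<in> borel_measurable lebesgue" "periodic u" "integrable cell_measure u"
    and \<psi>: "\<psi> \<in> borel_measurable lebesgue" "\<And>x. \<bar>\<psi> x\<bar> \<le> C"
    and F: "finite F" "\<And>x. \<psi> x \<noteq> 0 \<Longrightarrow> floor_vec x \<in> F"
  shows "integrable lebesgue (\<lambda>x. u x * \<psi> x)"
    and "(LINT x|lebesgue. u x * \<psi> x) = cell_integral (\<lambda>x. u x * (\<Sum>k\<in>F. \<psi> (x + lattice_vec k)))"
proof -
  note [measurable] = u(1) \<psi>(1)
  define piece where "piece k x = (if floor_vec x = k then u x * \<psi> x else 0)" for k x
  have floor_m [measurable]: "Measurable.pred lebesgue (\<lambda>x. floor_vec x = k)" for k :: "int^'n"
  proof -
    have 1: "(\<lambda>x::real^'n. x $ i) \<in> borel_measurable lebesgue" for i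
      by (rule measurable_completion) simp
    have "Measurable.pred lebesgue (\<lambda>x::real^'n. \<forall>i. \<lfloor>x $ i\<rfloor> = k $ i)"
      using 1 by measurable
    then show ?thesis by (simp add: vec_eq_iff)
  qed
  have cell: "integrable cell_measure (\<lambda>x. u x * \<psi> (x + lattice_vec k))" for k
  proof (rule integrable_cell_bound[where g = "\<lambda>x. C * \<bar>u x\<bar>"])
    show "integrable cell_measure (\<lambda>x. C * \<bar>u x\<bar>)" using u(3) by auto
    show "(\<lambda>x. u x * \<psi> (x + lattice_vec k)) \<in> borel_measurable lebesgue" by measurable
    show "AE x in cell_measure. \<bar>u x * \<psi> (x + lattice_vec k)\<bar> \<le> C * \<bar>u x\<bar>"
    proof (intro AE_I2)
      fix x
      show "\<bar>u x * \<psi> (x + lattice_vec k)\<bar> \<le> C * \<bar>u x\<bar>"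
        using mult_right_mono[OF \<psi>(2)[of "x + lattice_vec k"], of "\<bar>u x\<bar>"]
        by (simp add: abs_mult mult.commute)
    qed
  qed
  have shifted: "AE x in lebesgue. piece k (x + lattice_vec k)
      = indicator unit_cell x *\<^sub>R (u x * \<psi> (x + lattice_vec k))" for k
    using AE_coordinate_noninteger periodic_lattice[OF u(2), of k]
  proof eventually_elim
    case (elim x)
    then show ?case
      using floor_vec_eq_0_iff[OF elim(1)]
      by (simp add: piece_def indicator_def)
  qed
  have shift_int: "integrable lebesgue (\<lambda>x. indicator unit_cell x *\<^sub>R (u x * \<psi> (x + lattice_vec k)))" for k
    using cell[of k] by (subst (asm) integrable_restrict_space) auto
  have piece_m [measurable]: "piece k \<in> borel_measurable lebesgue" for k
    unfolding piece_def by measurable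
  have piece_shift: "integrable lebesgue (\<lambda>x. piece k (x + lattice_vec k))" for k
    using integrable_cong_AE[OF _ _ shifted[of k]] shift_int[of k] by simp
  have piece_int: "integrable lebesgue (piece k)" for k
    using integrable_lebesgue_translation[OF piece_shift[of k], of "- lattice_vec k"] by simp
  have piece_integral: "(LINT x|lebesgue. piece k x) = (LINT x|cell_measure. u x * \<psi> (x + lattice_vec k))" for k
  proof -
    have "(LINT x|lebesgue. piece k x) = (LINT x|lebesgue. piece k (x + lattice_vec k))"
      by (rule integral_lebesgue_translation[symmetric]) simp
    also have "\<dots> = (LINT x|lebesgue. indicator unit_cell x *\<^sub>R (u x * \<psi> (x + lattice_vec k)))"
      using shifted shift_int[of k] by (intro integral_cong_AE) auto
    also have "\<dots> = (LINT x|cell_measure. u x * \<psi> (x + lattice_vec k))"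
      by (subst integral_restrict_space) auto
    finally show ?thesis .
  qed
  have decomp: "(\<lambda>x. u x * \<psi> x) = (\<lambda>x. \<Sum>k\<in>F. piece k x)"
  proof
    fix x show "u x * \<psi> x = (\<Sum>k\<in>F. piece k x)"
      using F by (cases "\<psi> x = 0") (auto simp: piece_def)
  qed
  show "integrable lebesgue (\<lambda>x. u x * \<psi> x)"
    unfolding decomp using piece_int by auto
  show "(LINT x|lebesgue. u x * \<psi> x) = cell_integral (\<lambda>x. u x * (\<Sum>k\<in>F. \<psi> (x + lattice_vec k)))"
    unfolding decomp cell_integral_eq
    using piece_int cell by (simp add: piece_integral sum_distrib_left)
qed

lemma finite_floor_vec_image:
  assumes "bounded (K :: (real^'n) set)"
  shows "finite (floor_vec ` K)"
proof -
  obtain B where B: "\<And>x. x \<in> K \<Longrightarrow> norm x \<le> B" using assms by (auto simp: bounded_iff)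
  have "finite {k :: int^'n. \<forall>i. k $ i \<in> {\<lfloor>-B\<rfloor>..\<lfloor>B\<rfloor>}}"
  proof (rule finite_subset)
    show "{k :: int^'n. \<forall>i. k $ i \<in> {\<lfloor>-B\<rfloor>..\<lfloor>B\<rfloor>}} \<subseteq> vec_lambda ` (Pi\<^sub>E UNIV (\<lambda>_. {\<lfloor>-B\<rfloor>..\<lfloor>B\<rfloor>}))"
    proof
      fix k :: "int^'n" assume "k \<in> {k. \<forall>i. k $ i \<in> {\<lfloor>-B\<rfloor>..\<lfloor>B\<rfloor>}}"
      then have "k = vec_lambda (vec_nth k)" "vec_nth k \<in> Pi\<^sub>E UNIV (\<lambda>_. {\<lfloor>-B\<rfloor>..\<lfloor>B\<rfloor>})" by auto
      then show "k \<in> vec_lambda ` (Pi\<^sub>E UNIV (\<lambda>_. {\<lfloor>-B\<rfloor>..\<lfloor>B\<rfloor>}))" by (rule image_eqI)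
    qed
  qed (intro finite_imageI finite_PiE; simp)
  moreover have "floor_vec ` K \<subseteq> {k :: int^'n. \<forall>i. k $ i \<in> {\<lfloor>-B\<rfloor>..\<lfloor>B\<rfloor>}}"
  proof safe
    fix x i assume "x \<in> K"
    then have "\<bar>x $ i\<bar> \<le> B" using B[of x] component_le_norm_cart[of x i] by simp
    then have "\<lfloor>-B\<rfloor> \<le> \<lfloor>x $ i\<rfloor>" "\<lfloor>x $ i\<rfloor> \<le> \<lfloor>B\<rfloor>" by (intro floor_mono; simp)+
    then show "floor_vec x $ i \<in> {\<lfloor>-B\<rfloor>..\<lfloor>B\<rfloor>}" by simp
  qed
  ultimately show ?thesis by (rule finite_subset[rotated])
qed

section \<open>Functions are determined by their integrals over boxes\<close>

text \<open>
  Boxes generate the Borel sets and are stable under intersection, so the integrals over all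
  Borel sets vanish.  A Borel representative is used because this argument does not reach the
  Lebesgue sets.
\<close>

lemma AE_zero_if_box_integrals_zero:
  fixes w :: "'a::euclidean_space \<Rightarrow> real"
  assumes w: "integrable lebesgue w"
    and box: "\<And>a b. (LINT x:box a b|lebesgue. w x) = 0"
  shows "AE x in lebesgue. w x = 0"
proof -
  obtain w' where w' [measurable]: "w' \<in> borel_measurable lborel" and eq: "AE x in lborel. w x = w' x"
    using completion_ex_borel_measurable_real[of w lborel] w by auto
  have eqL: "AE x in lebesgue. w x = w' x" using eq by (rule AE_completion)
  have w'L: "integrable lebesgue w'"
    using integrable_cong_AE[OF _ _ eqL] w by (simp add: measurable_completion)
  then have int: "integrable lborel w'" by (simp add: integrable_completion)
  have setint: "set_integrable lborel A w'" if "A \<in> sets borel" for A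
    unfolding set_integrable_def using int that by (intro integrable_mult_indicator) auto
  have box': "(LINT x:box a b|lborel. w' x) = 0" for a b
  proof -
    have "(LINT x:box a b|lborel. w' x) = (LINT x:box a b|lebesgue. w' x)"
      unfolding set_lebesgue_integral_def by (rule integral_completion[symmetric]) measurable
    also have "\<dots> = (LINT x:box a b|lebesgue. w x)"
      unfolding set_lebesgue_integral_def
    proof (rule integral_cong_AE)
      show "(\<lambda>x. indicat_real (box a b) x *\<^sub>R w' x) \<in> borel_measurable lebesgue"
        by (rule measurable_completion) measurable
      show "(\<lambda>x. indicat_real (box a b) x *\<^sub>R w x) \<in> borel_measurable lebesgue"
        using w by (intro borel_measurable_scaleR borel_measurable_indicator) auto
    qed (use eqL in eventually_elim, simp)
    finally show ?thesis using box by simp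
  qed
  have total: "(LINT x:UNIV|lborel. w' x) = 0"
  proof -
    define B where "B n = box (- (real n *\<^sub>R One)) (real n *\<^sub>R (One::'a))" for n
    have "(\<lambda>n. LINT x:B n|lborel. w' x) \<longlonglongrightarrow> (LINT x:(\<Union>n. B n)|lborel. w' x)"
    proof (rule set_integral_cont_up)
      show "incseq B" by (rule monoI) (force simp: B_def mem_box)
    qed (auto simp: B_def intro!: setint)
    moreover have "(\<Union>n. B n) = UNIV" unfolding B_def by (rule UN_box_eq_UNIV)
    ultimately show ?thesis by (simp add: B_def box' LIMSEQ_const_iff)
  qed
  have "(LINT x:A|lborel. w' x) = 0" if "A \<in> sets lborel" for A
  proof -
    have "Int_stable (range (\<lambda>(a, b). box a b :: 'a set))"
      by (auto simp: Int_stable_def box_Int_box)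
    moreover have "range (\<lambda>(a, b). box a b :: 'a set) \<subseteq> Pow UNIV" by auto
    moreover have "A \<in> sigma_sets UNIV (range (\<lambda>(a, b). box a b))"
      using that by (simp add: borel_eq_box)
    ultimately show ?thesis
    proof (induction rule: sigma_sets_induct_disjoint)
      case (basic A) then show ?case by (auto simp: box')
    next
      case empty show ?case by (simp add: set_lebesgue_integral_def)
    next
      case (compl A)
      then have A: "A \<in> sets borel" by (simp add: borel_eq_box)
      have "(LINT x:A \<union> (UNIV - A)|lborel. w' x)
          = (LINT x:A|lborel. w' x) + (LINT x:UNIV - A|lborel. w' x)"
        by (rule set_integral_Un) (use A in \<open>auto intro!: setint\<close>)
      then show ?case using compl total by simp
    next
      case (union F)
      then have F: "\<And>i. F i \<in> sets borel" by (simp add: borel_eq_box subset_eq)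
      have "(LINT x:(\<Union>i. F i)|lborel. w' x) = (\<Sum>i. (LINT x:F i|lborel. w' x))"
        using union F by (intro lebesgue_integral_countable_add setint)
          (auto simp: disjoint_family_on_def intro!: setint)
      then show ?case using union by simp
    qed
  qed
  then have "AE x in lborel. w' x = 0" by (rule sigma_finite_measure.density_zero[OF sigma_finite_lborel int])
  then have "AE x in lebesgue. w' x = 0" by (rule AE_completion)
  then show ?thesis using eqL by eventually_elim simp
qed

section \<open>Smooth functions\<close>

text \<open>
  The exponents \<open>m\<close> are there to make the family closed under differentiation; for
  \<open>m = 0\<close> it is the standard smooth function that is flat at the origin.
\<close>

definition flat :: "nat \<Rightarrow> real \<Rightarrow> real" where
  "flat m t = (if t \<le> 0 then 0 else (1 / t) ^ m * exp (- (1 / t)))"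

lemma flat_tendsto_0: "(flat m \<longlongrightarrow> 0) (at 0)"
proof -
  have "((\<lambda>t. flat m t) \<longlongrightarrow> 0) (at_left 0)"
  proof (rule tendsto_eventually)
    show "\<forall>\<^sub>F t in at_left 0. flat m t = 0"
      by (auto simp: eventually_at_filter flat_def)
  qed
  moreover have "((\<lambda>t. flat m t) \<longlongrightarrow> 0) (at_right 0)"
  proof -
    have "((\<lambda>t::real. (inverse t) ^ m / exp (inverse t)) \<longlongrightarrow> 0) (at_right 0)"
      by (rule filterlim_compose[OF tendsto_power_div_exp_0 filterlim_inverse_at_top_right])
    moreover have "\<forall>\<^sub>F t in at_right 0. (inverse t) ^ m / exp (inverse t) = flat m t"
      by (auto simp: eventually_at_filter flat_def exp_minus field_simps)
    ultimately show ?thesis by (rule Lim_transform_eventually)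
  qed
  ultimately show ?thesis by (simp add: filterlim_split_at)
qed

lemma flat_has_derivative:
  "(flat m has_real_derivative flat (m + 2) t - real m * flat (m + 1) t) (at t)"
proof -
  consider "t < 0" | "t = 0" | "t > 0" by linarith
  then show ?thesis
  proof cases
    case 1
    have "((\<lambda>t. 0) has_real_derivative 0) (at t)" by simp
    then have "(flat m has_real_derivative 0) (at t)"
      by (rule has_field_derivative_transform_within_open[where S = "{..<0}"])
         (use 1 in \<open>auto simp: flat_def\<close>)
    then show ?thesis using 1 by (simp add: flat_def)
  next
    case 2
    have "(\<lambda>h. (flat m (0 + h) - flat m 0) / h) = flat (m + 1)"
      by (auto simp: flat_def fun_eq_iff)
    then have "(flat m has_real_derivative 0) (at 0)"
      unfolding DERIV_def using flat_tendsto_0[of "m + 1"] by simp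
    then show ?thesis using 2 by (simp add: flat_def)
  next
    case 3
    have "((\<lambda>t. (1 / t) ^ m * exp (- (1 / t))) has_real_derivative
        flat (m + 2) t - real m * flat (m + 1) t) (at t)"
    proof -
      have 1: "((\<lambda>y::real. y ^ m * exp (- y)) has_real_derivative
          real m * y ^ (m - 1) * exp (- y) - y ^ m * exp (- y)) (at y)" for y
        by (rule derivative_eq_intros refl | simp)+
      have 2: "((\<lambda>t::real. 1 / t) has_real_derivative - ((1 / t) * (1 / t))) (at t)"
        using 3 by (auto intro!: derivative_eq_intros)
      have fl: "flat k t = (1 / t) ^ k * exp (- (1 / t))" for k
        using 3 by (simp add: flat_def)
      have "(real m * y ^ (m - 1) * e - y ^ m * e) * - (y * y) = y ^ (m + 2) * e - real m * (y ^ (m + 1) * e)"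
        for y e :: real
        by (cases m) (simp_all add: ring_distribs)
      then show ?thesis unfolding fl by (rule DERIV_cong[OF DERIV_chain2[OF 1 2]])
    qed
    then show ?thesis
      by (rule has_field_derivative_transform_within_open[where S = "{0<..}"])
         (use 3 in \<open>auto simp: flat_def\<close>)
  qed
qed

text \<open>
  A family of explicit functions that is closed under partial differentiation, hence consists
  of functions of class \<open>C\<^sup>\<infinity>\<close>.  It is rich enough to contain the
  trigonometric functions, bump functions, and their products.
\<close>

inductive smooth_expr :: "(real^'n \<Rightarrow> real) \<Rightarrow> bool" where
  const: "smooth_expr (\<lambda>x. c)"
| cos: "smooth_expr (\<lambda>x. cos (a \<bullet> x + b))"
| flat: "smooth_expr (\<lambda>x. flat m (a \<bullet> x + b))"
| add: "smooth_expr F \<Longrightarrow> smooth_expr G \<Longrightarrow> smooth_expr (\<lambda>x. F x + G x)"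
| mult: "smooth_expr F \<Longrightarrow> smooth_expr G \<Longrightarrow> smooth_expr (\<lambda>x. F x * G x)"
| inverse: "smooth_expr F \<Longrightarrow> (\<And>x. F x \<noteq> 0) \<Longrightarrow> smooth_expr (\<lambda>x. inverse (F x))"

lemma partialI:
  assumes "(F has_derivative D) (at x)" shows "partial i F x = D (axis i 1)"
  unfolding partial_def using frechet_derivative_at[OF assms] by simp

lemma differentiable_has_partial:
  assumes "F differentiable (at x)"
  obtains D where "(F has_derivative D) (at x)" "\<And>i. partial i F x = D (axis i 1)"
  using assms partialI unfolding differentiable_def by blast

lemma partial_mult:
  assumes "F differentiable (at x)" "G differentiable (at x)"
  shows "partial i (\<lambda>x. F x * G x) x = F x * partial i G x + partial i F x * G x"
proof -
  obtain D E where "(F has_derivative D) (at x)" "partial i F x = D (axis i 1)"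
    "(G has_derivative E) (at x)" "partial i G x = E (axis i 1)"
    using assms by (meson differentiable_has_partial)
  then show ?thesis using partialI[OF has_derivative_mult[of F D x UNIV G E]] by simp
qed

lemma partial_add:
  assumes "F differentiable (at x)" "G differentiable (at x)"
  shows "partial i (\<lambda>x. F x + G x) x = partial i F x + partial i G x"
proof -
  obtain D E where "(F has_derivative D) (at x)" "partial i F x = D (axis i 1)"
    "(G has_derivative E) (at x)" "partial i G x = E (axis i 1)"
    using assms by (meson differentiable_has_partial)
  then show ?thesis using partialI[OF has_derivative_add[of F D "at x" G E]] by simp
qed

lemma partial_inverse:
  fixes F :: "real^'n \<Rightarrow> real"
  assumes "F differentiable (at x)" "F x \<noteq> 0"
  shows "(\<lambda>x. inverse (F x)) differentiable (at x)"
    and "partial i (\<lambda>x. inverse (F x)) x = - (inverse (F x) * partial i F x * inverse (F x))"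
proof -
  obtain D where D: "(F has_derivative D) (at x)" "partial i F x = D (axis i 1)"
    using assms(1) by (meson differentiable_has_partial)
  from Deriv.has_derivative_inverse[OF assms(2) D(1)]
  have "((\<lambda>x. inverse (F x)) has_derivative (\<lambda>h. - (inverse (F x) * D h * inverse (F x)))) (at x)" .
  then show "(\<lambda>x. inverse (F x)) differentiable (at x)"
    and "partial i (\<lambda>x. inverse (F x)) x = - (inverse (F x) * partial i F x * inverse (F x))"
    using D(2) by (auto intro: differentiableI simp: partialI)
qed

lemma smooth_expr_uminus: "smooth_expr F \<Longrightarrow> smooth_expr (\<lambda>x. - F x)"
  using smooth_expr.mult[OF smooth_expr.const[of "-1"], of F] by simp

lemma smooth_expr_diff: "smooth_expr F \<Longrightarrow> smooth_expr G \<Longrightarrow> smooth_expr (\<lambda>x. F x - G x)"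
  using smooth_expr.add[OF _ smooth_expr_uminus, of F G] by simp

lemma smooth_expr_prod:
  "finite I \<Longrightarrow> (\<And>i. i \<in> I \<Longrightarrow> smooth_expr (F i)) \<Longrightarrow> smooth_expr (\<lambda>x. \<Prod>i\<in>I. F i x)"
  by (induction I rule: finite_induct) (auto intro: smooth_expr.intros)

text \<open>The chain rule for the generators \<open>cos\<close> and \<open>flat\<close>.\<close>

lemma smooth_expr_affine:
  assumes g: "\<And>t. (g has_real_derivative g' t) (at t)"
    and expr: "smooth_expr (\<lambda>x. g' (a \<bullet> x + b))"
  shows "(\<lambda>x. g (a \<bullet> x + b)) differentiable (at x)"
    and "smooth_expr (partial i (\<lambda>x. g (a \<bullet> x + b)))"
proof -
  have D: "((\<lambda>x. g (a \<bullet> x + b)) has_derivative (\<lambda>h. (a \<bullet> h) * g' (a \<bullet> x + b))) (at x)" for x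
  proof -
    have "((\<lambda>x. a \<bullet> x + b) has_derivative (\<lambda>h. a \<bullet> h)) (at x)"
      by (auto intro!: derivative_eq_intros)
    from DERIV_compose_FDERIV[OF g this] show ?thesis by simp
  qed
  then show "(\<lambda>x. g (a \<bullet> x + b)) differentiable (at x)" by (rule differentiableI)
  have "partial i (\<lambda>x. g (a \<bullet> x + b)) = (\<lambda>x. (a \<bullet> axis i 1) * g' (a \<bullet> x + b))"
    using partialI[OF D] by (simp add: fun_eq_iff)
  then show "smooth_expr (partial i (\<lambda>x. g (a \<bullet> x + b)))"
    using smooth_expr.mult[OF smooth_expr.const expr] by simp
qed

lemma smooth_expr_derivative:
  fixes F :: "real^'n \<Rightarrow> real"
  assumes "smooth_expr F"
  shows "(\<forall>x. F differentiable (at x)) \<and> (\<forall>i. smooth_expr (partial i F))"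
  using assms
proof (induction rule: smooth_expr.induct)
  case (const c)
  have D: "((\<lambda>x. c) has_derivative (\<lambda>h. 0)) (at x)" for x :: "real^'n" by simp
  have "partial i (\<lambda>x. c) = (\<lambda>x. 0)" for i :: 'n
    using partialI[OF D] by (simp add: fun_eq_iff)
  then show ?case using smooth_expr.const by simp
next
  case (cos a b)
  have 1: "(cos has_real_derivative - sin t) (at t)" for t :: real
    by (auto intro!: derivative_eq_intros)
  have 2: "smooth_expr (\<lambda>x. - sin (a \<bullet> x + b))"
  proof -
    have "cos (a \<bullet> x + (b + pi / 2)) = - sin (a \<bullet> x + b)" for x
      using cos_add[of "a \<bullet> x + b" "pi / 2"] by (simp add: add.assoc)
    then show ?thesis using smooth_expr.cos[of a "b + pi / 2"] by simp
  qed
  show ?case using smooth_expr_affine[where g = cos, OF 1 2] by blast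
next
  case (flat m a b)
  have "smooth_expr (\<lambda>x. flat (m + 2) (a \<bullet> x + b) - real m * flat (m + 1) (a \<bullet> x + b))"
    by (intro smooth_expr_diff smooth_expr.intros)
  then show ?case using smooth_expr_affine[where g = "flat m", OF flat_has_derivative] by blast
next
  case (add F G)
  then have "partial i (\<lambda>x. F x + G x) = (\<lambda>x. partial i F x + partial i G x)" for i
    using partial_add by blast
  then show ?case using add.IH by (auto intro: smooth_expr.intros differentiable_add)
next
  case (mult F G)
  then have "partial i (\<lambda>x. F x * G x) = (\<lambda>x. F x * partial i G x + partial i F x * G x)" for i
    using partial_mult by blast
  then show ?case using mult by (auto intro!: smooth_expr.add smooth_expr.mult differentiable_mult)
next
  case (inverse F)
  then have *: "partial i (\<lambda>x. inverse (F x)) = (\<lambda>x. - (inverse (F x) * partial i F x * inverse (F x)))" for i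
    using partial_inverse(2) by blast
  show ?case
  proof (intro conjI allI)
    show "(\<lambda>x. inverse (F x)) differentiable (at x)" for x
      using inverse by (intro partial_inverse) auto
    show "smooth_expr (partial i (\<lambda>x. inverse (F x)))" for i
      unfolding * using inverse by (intro smooth_expr_uminus smooth_expr.mult smooth_expr.inverse) auto
  qed
qed

lemma smooth_expr_differentiable: "smooth_expr F \<Longrightarrow> F differentiable (at x)"
  using smooth_expr_derivative by blast

lemma smooth_expr_partial: "smooth_expr F \<Longrightarrow> smooth_expr (partial i F)"
  using smooth_expr_derivative by blast

lemma continuous_on_UNIV_if_differentiable:
  fixes F :: "real^'n \<Rightarrow> real"
  shows "(\<And>x. F differentiable (at x)) \<Longrightarrow> continuous_on UNIV F"
  by (simp add: continuous_on_eq_continuous_at differentiable_imp_continuous_within)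

lemma smooth_expr_continuous: "smooth_expr F \<Longrightarrow> continuous_on UNIV F"
  by (intro continuous_on_UNIV_if_differentiable smooth_expr_differentiable)

lemma smooth_expr_C_k: "smooth_expr F \<Longrightarrow> F \<in> C_k k"
  by (induction k arbitrary: F)
     (auto intro: smooth_expr_continuous smooth_expr_differentiable smooth_expr_partial)

lemma smooth_expr_test_function:
  "smooth_expr F \<Longrightarrow> compact K \<Longrightarrow> (\<And>x. x \<notin> K \<Longrightarrow> F x = 0) \<Longrightarrow> F \<in> test_functions"
  unfolding test_functions_def using smooth_expr_C_k by blast

lemma borel_measurable_lebesgue_continuous:
  "continuous_on UNIV F \<Longrightarrow> (F :: real^'n \<Rightarrow> real) \<in> borel_measurable lebesgue"
  by (intro measurable_completion) (simp add: borel_measurable_continuous_onI)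

lemma test_function_properties:
  assumes "\<psi> \<in> test_functions"
  obtains K where "compact K" "\<And>x. x \<notin> K \<Longrightarrow> \<psi> x = 0" "\<And>x i. x \<notin> K \<Longrightarrow> partial i \<psi> x = 0"
    "\<And>x. \<psi> differentiable (at x)" "continuous_on UNIV \<psi>" "\<And>i. continuous_on UNIV (partial i \<psi>)"
proof -
  obtain K where K: "compact K" "\<And>x. x \<notin> K \<Longrightarrow> \<psi> x = 0"
    using assms by (auto simp: test_functions_def)
  have "\<psi> \<in> C_k (Suc (Suc 0))" using assms unfolding test_functions_def by blast
  then have d: "\<And>x. \<psi> differentiable (at x)" "\<And>i x. partial i \<psi> differentiable (at x)" by auto
  have "partial i \<psi> x = 0" if "x \<notin> K" for x i
  proof -
    have "((\<lambda>x. 0) has_derivative (\<lambda>h. 0)) (at x)" by simp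
    then have "(\<psi> has_derivative (\<lambda>h. 0)) (at x)"
      by (rule has_derivative_transform_within_open[where s = "- K"])
         (use K that in \<open>auto intro: compact_imp_closed\<close>)
    then show ?thesis by (rule partialI)
  qed
  then show thesis
    using K d by (intro that[of K] continuous_on_UNIV_if_differentiable) auto
qed

lemma compact_support_bounded:
  fixes F :: "real^'n \<Rightarrow> real"
  assumes "continuous_on UNIV F" "compact K" "\<And>x. x \<notin> K \<Longrightarrow> F x = 0"
  obtains M where "0 \<le> M" "\<And>x. \<bar>F x\<bar> \<le> M"
proof -
  have "compact (F ` K)"
    using assms by (intro compact_continuous_image) (auto intro: continuous_on_subset)
  then obtain M where "\<And>x. x \<in> K \<Longrightarrow> \<bar>F x\<bar> \<le> M"
    by (fastforce dest!: compact_imp_bounded simp: bounded_iff)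
  then have "\<bar>F x\<bar> \<le> max M 0" for x using assms(3)[of x] by (cases "x \<in> K") (auto simp: le_max_iff_disj)
  then show thesis by (intro that[of "max M 0"]) auto
qed

lemma integrable_locally_integrable_mult:
  fixes F :: "real^'n \<Rightarrow> real"
  assumes u: "locally_integrable u"
    and F: "continuous_on UNIV F" "compact K" "\<And>x. x \<notin> K \<Longrightarrow> F x = 0"
  shows "integrable lebesgue (\<lambda>x. u x * F x)"
proof -
  obtain M where M: "0 \<le> M" "\<And>x. \<bar>F x\<bar> \<le> M" using compact_support_bounded[OF F] by blast
  have int: "integrable lebesgue (\<lambda>x. indicator K x *\<^sub>R u x)"
    using u F(2) by (simp add: locally_integrable_def set_integrable_def)
  have "integrable lebesgue (\<lambda>x. (indicator K x *\<^sub>R u x) * F x)"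
  proof (rule Bochner_Integration.integrable_bound[where f = "\<lambda>x. M * (indicator K x *\<^sub>R u x)"])
    show "integrable lebesgue (\<lambda>x. M * (indicator K x *\<^sub>R u x))" using int by (rule integrable_mult_right)
    show "(\<lambda>x. (indicator K x *\<^sub>R u x) * F x) \<in> borel_measurable lebesgue"
      by (intro borel_measurable_times borel_measurable_integrable[OF int]
          borel_measurable_lebesgue_continuous F)
    show "AE x in lebesgue. norm ((indicator K x *\<^sub>R u x) * F x) \<le> norm (M * (indicator K x *\<^sub>R u x))"
    proof (rule AE_I2)
      fix x
      show "norm ((indicator K x *\<^sub>R u x) * F x) \<le> norm (M * (indicator K x *\<^sub>R u x))"
        using mult_right_mono[OF M(2)[of x], of "\<bar>indicator K x * u x\<bar>"] M(1)
        by (simp add: abs_mult mult.commute mult.left_commute)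
    qed
  qed
  moreover have "(\<lambda>x. (indicator K x *\<^sub>R u x) * F x) = (\<lambda>x. u x * F x)"
    using F(3) by (fastforce simp: indicator_def fun_eq_iff)
  ultimately show ?thesis by (simp only:)
qed

lemma locally_integrable_continuous:
  fixes F :: "real^'n \<Rightarrow> real"
  assumes "continuous_on UNIV F"
  shows "locally_integrable F"
  unfolding locally_integrable_def
proof (intro allI impI)
  fix K :: "(real^'n) set" assume "compact K"
  then have "integrable lborel (\<lambda>x. indicator K x *\<^sub>R F x)"
    by (rule borel_integrable_compact) (auto intro: continuous_on_subset[OF assms])
  then have "integrable lebesgue (\<lambda>x. indicator K x *\<^sub>R F x)"
    by (subst integrable_completion) auto
  then show "set_integrable lebesgue K F" by (simp add: set_integrable_def)
qed

section \<open>Integration by parts\<close>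

text \<open>
  The integral of \<open>h\<close> is invariant under translations in direction \<open>i\<close>,
  so the integrals of the difference quotients vanish, and these converge boundedly to the
  partial derivative.
\<close>

lemma integral_partial_compact_support:
  fixes h :: "real^'n \<Rightarrow> real"
  assumes diff: "\<And>x. h differentiable (at x)" and cont: "continuous_on UNIV (partial i h)"
    and K: "compact K" "\<And>x. x \<notin> K \<Longrightarrow> h x = 0" "\<And>x. x \<notin> K \<Longrightarrow> partial i h x = 0"
  shows "(LINT x|lebesgue. partial i h x) = 0"
proof -
  let ?e = "axis i 1 :: real^'n"
  define q where "q n x = (h (x + (1 / real (Suc n)) *\<^sub>R ?e) - h x) * real (Suc n)" for n x
  have contH: "continuous_on UNIV h" using diff by (rule continuous_on_UNIV_if_differentiable)
  have hm [measurable]: "h \<in> borel_measurable lebesgue" and pm: "partial i h \<in> borel_measurable lebesgue"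
    using contH cont by (auto intro: borel_measurable_lebesgue_continuous)
  have hint: "integrable lebesgue h"
    using integrable_locally_integrable_mult[OF locally_integrable_continuous[of "\<lambda>x. 1"] contH K(1,2)]
    by simp
  obtain R where R: "\<And>x. x \<in> K \<Longrightarrow> norm x \<le> R"
    using compact_imp_bounded[OF K(1)] by (auto simp: bounded_iff)
  obtain M where M: "0 \<le> M" "\<And>x. \<bar>partial i h x\<bar> \<le> M"
    using compact_support_bounded[OF cont K(1,3)] by blast
  have line: "((\<lambda>t. h (x + t *\<^sub>R ?e)) has_real_derivative partial i h (x + t *\<^sub>R ?e)) (at t)" for x t
  proof -
    obtain D where D: "(h has_derivative D) (at (x + t *\<^sub>R ?e))" "partial i h (x + t *\<^sub>R ?e) = D ?e"
      using differentiable_has_partial[OF diff] by metis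
    interpret D: bounded_linear D using D(1) by (rule has_derivative_bounded_linear)
    have "((\<lambda>t. h (x + t *\<^sub>R ?e)) has_derivative (\<lambda>s. D (s *\<^sub>R ?e))) (at t)"
      by (rule has_derivative_compose[where f = "\<lambda>t. x + t *\<^sub>R ?e" and g = h, OF _ D(1)]) (auto intro!: derivative_eq_intros)
    then show ?thesis by (simp add: has_field_derivative_def D D.scaleR mult.commute[of _ "D ?e"])
  qed
  have lim: "(\<lambda>n. q n x) \<longlonglongrightarrow> partial i h x" for x
  proof -
    have "((\<lambda>s. (h (x + s *\<^sub>R ?e) - h x) / s) \<longlongrightarrow> partial i h x) (at 0)"
      using line[of x 0] by (simp add: DERIV_def)
    moreover have "filterlim (\<lambda>n. 1 / real (Suc n)) (at 0) sequentially"
      unfolding filterlim_at using LIMSEQ_inverse_real_of_nat by (auto simp: divide_inverse)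
    ultimately have "(\<lambda>n. (h (x + (1 / real (Suc n)) *\<^sub>R ?e) - h x) / (1 / real (Suc n))) \<longlonglongrightarrow> partial i h x"
      by (rule filterlim_compose)
    then show ?thesis by (simp add: q_def)
  qed
  have bound: "\<bar>q n x\<bar> \<le> M * indicator (cball 0 (R + 1)) x" for n x
  proof (cases "x \<in> cball 0 (R + 1)")
    case True
    have "\<exists>z. 0 < z \<and> z < 1 / real (Suc n) \<and>
        h (x + (1 / real (Suc n)) *\<^sub>R ?e) - h (x + 0 *\<^sub>R ?e) = (1 / real (Suc n) - 0) * partial i h (x + z *\<^sub>R ?e)"
      by (rule MVT2) (auto intro: line)
    then obtain z where "q n x = partial i h (x + z *\<^sub>R ?e)" by (auto simp: q_def field_simps)
    then show ?thesis using M True by simp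
  next
    case False
    define s where "s = 1 / real (Suc n)"
    have "0 \<le> s" "s \<le> 1" by (auto simp: s_def divide_le_eq_1)
    then have "norm x - 1 \<le> norm (x + s *\<^sub>R ?e)"
      using norm_triangle_ineq4[of "x + s *\<^sub>R ?e" "s *\<^sub>R ?e"] by simp
    then have "norm x - 1 \<le> norm (x + (1 / real (Suc n)) *\<^sub>R ?e)" unfolding s_def .
    then have "x \<notin> K" "x + (1 / real (Suc n)) *\<^sub>R ?e \<notin> K" using False R by force+
    then show ?thesis using K(2) False by (simp add: q_def)
  qed
  have "(\<lambda>n. LINT x|lebesgue. q n x) \<longlonglongrightarrow> (LINT x|lebesgue. partial i h x)"
  proof (rule integral_dominated_convergence[where w = "\<lambda>x. M * indicator (cball 0 (R + 1)) x"])
    have "integrable lebesgue (indicator (cball 0 (R + 1)) :: real^'n \<Rightarrow> real)"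
      using emeasure_lborel_cball_finite by (intro integrable_real_indicator) auto
    then show "integrable lebesgue (\<lambda>x::real^'n. M * indicator (cball 0 (R + 1)) x)"
      by (rule integrable_mult_right)
    show "q n \<in> borel_measurable lebesgue" for n unfolding q_def by measurable
  qed (use lim bound pm in auto)
  moreover have "(LINT x|lebesgue. q n x) = 0" for n
  proof -
    have "(LINT x|lebesgue. h (x + (1 / real (Suc n)) *\<^sub>R ?e) - h x) = 0"
      using hint by (subst Bochner_Integration.integral_diff)
        (auto intro: integrable_lebesgue_translation simp: integral_lebesgue_translation)
    then show ?thesis unfolding q_def by (simp only: integral_mult_left_zero)
  qed
  ultimately show ?thesis by (simp add: LIMSEQ_const_iff)
qed

lemma has_weak_partial_classical:
  fixes v :: "real^'n \<Rightarrow> real"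
  assumes diff: "\<And>x. v differentiable (at x)" and cont: "continuous_on UNIV (partial i v)"
  shows "has_weak_partial v i (partial i v)"
  unfolding has_weak_partial_def
proof (intro conjI ballI)
  have cv: "continuous_on UNIV v" using diff by (rule continuous_on_UNIV_if_differentiable)
  show "locally_integrable v" "locally_integrable (partial i v)"
    using cv cont by (auto intro: locally_integrable_continuous)
  fix \<psi> :: "real^'n \<Rightarrow> real" assume "\<psi> \<in> test_functions"
  then obtain K where K: "compact K" "\<And>x. x \<notin> K \<Longrightarrow> \<psi> x = 0" "\<And>x i. x \<notin> K \<Longrightarrow> partial i \<psi> x = 0"
    and \<psi>: "\<And>x. \<psi> differentiable (at x)" "continuous_on UNIV \<psi>" "\<And>i. continuous_on UNIV (partial i \<psi>)"
    using test_function_properties by metis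
  have p: "partial i (\<lambda>x. v x * \<psi> x) = (\<lambda>x. v x * partial i \<psi> x + partial i v x * \<psi> x)"
    using partial_mult[OF diff \<psi>(1)] by (simp add: fun_eq_iff)
  have "(LINT x|lebesgue. partial i (\<lambda>x. v x * \<psi> x) x) = 0"
  proof (rule integral_partial_compact_support)
    show "continuous_on UNIV (partial i (\<lambda>x. v x * \<psi> x))"
      unfolding p using cv cont \<psi> by (intro continuous_intros)
  qed (use K diff \<psi> in \<open>auto simp: p intro: differentiable_mult\<close>)
  moreover have "integrable lebesgue (\<lambda>x. v x * partial i \<psi> x)"
    by (rule integrable_locally_integrable_mult[OF locally_integrable_continuous[OF cv] \<psi>(3) K(1,3)])
  moreover have "integrable lebesgue (\<lambda>x. partial i v x * \<psi> x)"
    by (rule integrable_locally_integrable_mult[OF locally_integrable_continuous[OF cont] \<psi>(2) K(1,2)])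
  ultimately show "(LINT x|lebesgue. v x * partial i \<psi> x) = - (LINT x|lebesgue. partial i v x * \<psi> x)"
    by (simp add: p)
qed

section \<open>Cutoff functions and the fundamental lemma\<close>

text \<open>A smooth transition from \<open>0\<close> for \<open>t \<le> 0\<close> to \<open>1\<close> for \<open>t \<ge> 1\<close>.\<close>

definition step :: "real \<Rightarrow> real" where
  "step t = flat 0 t * inverse (flat 0 t + flat 0 (1 - t))"

lemma flat_0_pos: "0 < t \<Longrightarrow> 0 < flat 0 t" and flat_0_nonneg: "0 \<le> flat 0 t"
  by (auto simp: flat_def)

lemma step_denominator_pos: "0 < flat 0 t + flat 0 (1 - t)"
  using flat_0_pos[of t] flat_0_pos[of "1 - t"] flat_0_nonneg[of t] flat_0_nonneg[of "1 - t"]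
  by (cases "0 < t") auto

lemma step_eq_0: "t \<le> 0 \<Longrightarrow> step t = 0"
  by (simp add: step_def flat_def)

lemma step_eq_1: "1 \<le> t \<Longrightarrow> step t = 1"
  using step_denominator_pos[of t] by (simp add: step_def flat_def)

lemma step_range: "0 \<le> step t" "step t \<le> 1"
  using step_denominator_pos[of t] flat_0_nonneg[of t] flat_0_nonneg[of "1 - t"]
  by (auto simp: step_def field_simps)

lemma smooth_expr_step: "smooth_expr (\<lambda>x. step (a \<bullet> x + b))"
proof -
  have "(\<lambda>x. flat 0 ((- a) \<bullet> x + (1 - b))) = (\<lambda>x. flat 0 (1 - (a \<bullet> x + b)))"
    by (simp add: algebra_simps)
  then have 1: "smooth_expr (\<lambda>x. flat 0 (1 - (a \<bullet> x + b)))"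
    using smooth_expr.flat[of 0 "- a" "1 - b"] by (simp only:)
  show ?thesis unfolding step_def
    by (intro smooth_expr.mult smooth_expr.inverse smooth_expr.add smooth_expr.flat 1)
       (rule less_imp_neq[OF step_denominator_pos, symmetric])
qed

definition box_bump :: "nat \<Rightarrow> real^'n \<Rightarrow> real^'n \<Rightarrow> real^'n \<Rightarrow> real" where
  "box_bump m a b x = (\<Prod>i\<in>UNIV. step (real m * (x $ i - a $ i)) * step (real m * (b $ i - x $ i)))"

lemma smooth_expr_coordinate_step: "smooth_expr (\<lambda>x::real^'n. step (c * x $ i + d))"
  using smooth_expr_step[of "axis i c" d] by (simp add: inner_axis')

lemma smooth_expr_box_bump: "smooth_expr (box_bump m a (b :: real^'n))"
proof -
  have "smooth_expr (\<lambda>x::real^'n. \<Prod>i\<in>UNIV. step (real m * x $ i + (- real m * a $ i))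
      * step ((- real m) * x $ i + real m * b $ i))"
    by (intro smooth_expr_prod smooth_expr.mult smooth_expr_coordinate_step) auto
  then show ?thesis unfolding box_bump_def by (simp add: algebra_simps)
qed

lemma box_bump_range: "0 \<le> box_bump m a b x" "box_bump m a b x \<le> 1"
  unfolding box_bump_def
  by (auto intro!: prod_nonneg prod_le_1 mult_nonneg_nonneg mult_le_one simp: step_range)

lemma box_bump_outside:
  assumes "x \<notin> box a b" shows "box_bump m a b x = 0"
proof -
  obtain i where "x $ i \<le> a $ i \<or> b $ i \<le> x $ i"
    using assms by (auto simp: mem_box_cart not_less)
  then have "step (real m * (x $ i - a $ i)) * step (real m * (b $ i - x $ i)) = 0"
    by (auto simp: step_eq_0 mult_nonneg_nonpos)
  then show ?thesis unfolding box_bump_def by (intro prod_zero) auto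
qed

lemma box_bump_tendsto: "(\<lambda>m. box_bump m a b x) \<longlonglongrightarrow> indicator (box a b) x"
proof (cases "x \<in> box a b")
  case False
  then show ?thesis by (simp add: box_bump_outside)
next
  case True
  have ev: "\<forall>\<^sub>F m in sequentially. 1 \<le> real m * c" if "0 < c" for c
  proof -
    have "filterlim (\<lambda>m. real m * c) at_top sequentially"
      by (rule filterlim_at_top_mult_tendsto_pos[OF tendsto_const that filterlim_real_sequentially])
    then show ?thesis by (simp add: filterlim_at_top)
  qed
  have "\<forall>\<^sub>F m in sequentially. \<forall>i. 1 \<le> real m * (x $ i - a $ i) \<and> 1 \<le> real m * (b $ i - x $ i)"
    using True by (intro eventually_all_finite eventually_conj ev) (auto simp: mem_box_cart)
  then have "\<forall>\<^sub>F m in sequentially. box_bump m a b x = indicator (box a b) x"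
    by eventually_elim (use True in \<open>simp add: box_bump_def step_eq_1\<close>)
  then show ?thesis by (rule tendsto_eventually)
qed

lemma box_bump_test_function: "box_bump m a b \<in> test_functions"
  by (rule smooth_expr_test_function[OF smooth_expr_box_bump compact_cbox[of a b]])
     (meson box_bump_outside box_subset_cbox subsetD)

text \<open>
  Smooth bumps converge boundedly to the indicators of boxes, so testing against smooth
  functions determines all integrals over boxes.
\<close>

lemma fundamental_lemma:
  fixes w :: "real^'n \<Rightarrow> real"
  assumes w: "locally_integrable w"
    and test: "\<And>\<psi>. \<psi> \<in> test_functions \<Longrightarrow> (LINT x|lebesgue. w x * \<psi> x) = 0"
  shows "AE x in lebesgue. w x = 0"
proof -
  have cint: "integrable lebesgue (\<lambda>x. indicator (cbox a b) x * w x)" for a b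
    using w compact_cbox[of a b] unfolding locally_integrable_def set_integrable_def by force
  have bint: "integrable lebesgue (\<lambda>x. indicator (box a b) x * w x)" for a b
  proof -
    have "integrable lebesgue (\<lambda>x. indicator (box a b) x *\<^sub>R (indicator (cbox a b) x * w x))"
      by (rule integrable_mult_indicator[OF _ cint]) simp
    moreover have "(\<lambda>x. indicator (box a b) x *\<^sub>R (indicator (cbox a b) x * w x))
        = (\<lambda>x. indicator (box a b) x * w x)"
      using box_subset_cbox[of a b] by (auto simp: indicator_def fun_eq_iff)
    ultimately show ?thesis by (simp only:)
  qed
  have box: "(LINT x|lebesgue. indicator (box a b) x * w x) = 0" for a b
  proof -
    have bm: "box_bump m a b \<in> borel_measurable lebesgue" for m
      by (intro borel_measurable_lebesgue_continuous smooth_expr_continuous smooth_expr_box_bump)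
    have eq: "w x * box_bump m a b x = (indicator (box a b) x * w x) * box_bump m a b x" for m x
      using box_bump_outside[of x a b m] by (cases "x \<in> box a b") auto
    have "(\<lambda>m. LINT x|lebesgue. w x * box_bump m a b x) \<longlonglongrightarrow> (LINT x|lebesgue. indicator (box a b) x * w x)"
    proof (rule integral_dominated_convergence[where w = "\<lambda>x. \<bar>indicator (box a b) x * w x\<bar>"])
      show "(\<lambda>x. indicator (box a b) x * w x) \<in> borel_measurable lebesgue" using bint by auto
      show "(\<lambda>x. w x * box_bump m a b x) \<in> borel_measurable lebesgue" for m
        unfolding eq by (rule borel_measurable_times[OF borel_measurable_integrable[OF bint] bm])
      show "integrable lebesgue (\<lambda>x. \<bar>indicator (box a b) x * w x\<bar>)" using bint by (rule integrable_abs)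
      show "AE x in lebesgue. (\<lambda>m. w x * box_bump m a b x) \<longlonglongrightarrow> indicator (box a b) x * w x"
        by (intro AE_I2, subst mult.commute[of "indicator _ _"])
           (intro tendsto_mult tendsto_const box_bump_tendsto)
      show "AE x in lebesgue. norm (w x * box_bump m a b x) \<le> \<bar>indicator (box a b) x * w x\<bar>" for m
        unfolding eq using box_bump_range[of m a b]
        by (intro AE_I2) (simp add: abs_mult mult_left_le)
    qed
    then show ?thesis by (simp add: test box_bump_test_function LIMSEQ_const_iff)
  qed
  have "AE x in lebesgue. indicator (box (- (real n *\<^sub>R One)) (real n *\<^sub>R One)) x * w x = 0" for n
  proof (rule AE_zero_if_box_integrals_zero[OF bint])
    fix a b :: "real^'n"
    obtain c d where cd: "box a b \<inter> box (- (real n *\<^sub>R One)) (real n *\<^sub>R One) = box c d"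
      unfolding box_Int_box by blast
    have "(LINT x:box a b|lebesgue. indicator (box (- (real n *\<^sub>R One)) (real n *\<^sub>R One)) x * w x)
        = (LINT x|lebesgue. indicator (box c d) x * w x)"
      unfolding set_lebesgue_integral_def cd[symmetric]
      by (simp add: indicator_inter_arith mult.assoc)
    then show "(LINT x:box a b|lebesgue. indicator (box (- (real n *\<^sub>R One)) (real n *\<^sub>R One)) x * w x) = 0"
      using box by simp
  qed
  then have "AE x in lebesgue. \<forall>n::nat. indicator (box (- (real n *\<^sub>R One)) (real n *\<^sub>R One)) x * w x = 0"
    unfolding AE_all_countable by blast
  then show ?thesis
  proof eventually_elim
    case (elim x)
    obtain n :: nat where "x \<in> box (- (real n *\<^sub>R One)) (real n *\<^sub>R One)"
      using UN_box_eq_UNIV by blast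
    then show ?case using elim[rule_format, of n] by simp
  qed
qed

text \<open>
  Allowing \<open>u\<close> and \<open>u'\<close> to differ on a null set makes the lemma applicable twice in a row,
  to the first and then to the second derivatives.
\<close>

lemma weak_partial_unique:
  fixes u u' g g' :: "real^'n \<Rightarrow> real"
  assumes "has_weak_partial u i g" "has_weak_partial u' i g'"
    and eq: "AE x in lebesgue. u x = u' x"
  shows "AE x in lebesgue. g x = g' x"
proof -
  have "AE x in lebesgue. g x - g' x = 0"
  proof (rule fundamental_lemma)
    show "locally_integrable (\<lambda>x. g x - g' x)"
      using assms unfolding has_weak_partial_def locally_integrable_def by (auto intro: set_integral_diff)
    fix \<psi> :: "real^'n \<Rightarrow> real" assume \<psi>: "\<psi> \<in> test_functions"
    then obtain K where K: "compact K" "\<And>x. x \<notin> K \<Longrightarrow> \<psi> x = 0" "\<And>x. x \<notin> K \<Longrightarrow> partial i \<psi> x = 0"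
      "continuous_on UNIV \<psi>" "continuous_on UNIV (partial i \<psi>)"
      using test_function_properties by metis
    have int: "integrable lebesgue (\<lambda>x. v x * \<psi> x)" "integrable lebesgue (\<lambda>x. v x * partial i \<psi> x)"
      if "locally_integrable v" for v
      using integrable_locally_integrable_mult[OF that K(4,1,2)]
        integrable_locally_integrable_mult[OF that K(5,1,3)] by auto
    have li: "locally_integrable u" "locally_integrable g" "locally_integrable u'" "locally_integrable g'"
      using assms by (auto simp: has_weak_partial_def)
    have "(LINT x|lebesgue. u x * partial i \<psi> x) = (LINT x|lebesgue. u' x * partial i \<psi> x)"
      by (rule integral_cong_AE) (use int li eq in auto)
    then have "(LINT x|lebesgue. g x * \<psi> x) = (LINT x|lebesgue. g' x * \<psi> x)"
      using assms(1,2) \<psi> unfolding has_weak_partial_def by auto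
    then show "(LINT x|lebesgue. (g x - g' x) * \<psi> x) = 0"
      using int li by (simp add: left_diff_distrib)
  qed
  then show ?thesis by eventually_elim simp
qed

section \<open>Plane waves and weak derivatives of periodic functions\<close>

text \<open>
  Each factor is supported in \<open>[0, 2]\<close>, and its integer translates telescope to the constant
  one.  So the lattice translates of the product form a partition of unity.
\<close>

definition cell_cutoff :: "real^'n \<Rightarrow> real" where
  "cell_cutoff x = (\<Prod>i\<in>UNIV. step (x $ i) - step (x $ i - 1))"

text \<open>
  The lattice cells that meet the cube \<open>[0, 2]\<^sup>n\<close>; the entry \<open>2\<close> accounts for its far faces.
\<close>

definition support_cells :: "(int^'n) set" where
  "support_cells = {k. \<forall>i. k $ i \<in> {0, 1, 2}}"

lemma support_cells_eq_image: "(support_cells :: (int^'n) set) = vec_lambda ` (Pi\<^sub>E UNIV (\<lambda>_. {0, 1, 2}))"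
proof (rule set_eqI)
  fix k :: "int^'n"
  have "k \<in> support_cells \<longleftrightarrow> vec_nth k \<in> Pi\<^sub>E UNIV (\<lambda>_. {0, 1, 2})"
    by (auto simp: support_cells_def)
  also have "\<dots> \<longleftrightarrow> k \<in> vec_lambda ` (Pi\<^sub>E UNIV (\<lambda>_. {0, 1, 2}))"
    by (metis (no_types, lifting) image_iff vec_lambda_eta vec_lambda_inverse UNIV_I)
  finally show "k \<in> support_cells \<longleftrightarrow> k \<in> vec_lambda ` (Pi\<^sub>E UNIV (\<lambda>_. {0, 1, 2}))" .
qed

lemma smooth_expr_cell_cutoff: "smooth_expr cell_cutoff"
proof -
  have "smooth_expr (\<lambda>x::real^'n. \<Prod>i\<in>UNIV. step (1 * x $ i + 0) - step (1 * x $ i + (- 1)))"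
    by (intro smooth_expr_prod smooth_expr_diff smooth_expr_coordinate_step) auto
  then show ?thesis unfolding cell_cutoff_def by simp
qed

lemma finite_support_cells: "finite (support_cells :: (int^'n) set)"
  unfolding support_cells_eq_image by (intro finite_imageI finite_PiE) auto

lemma floor_vec_support_cells:
  assumes "x \<in> cbox 0 2" shows "floor_vec x \<in> support_cells"
proof -
  have "\<lfloor>x $ i\<rfloor> \<in> {0, 1, 2}" for i
  proof -
    have "0 \<le> x $ i" "x $ i < 3" using assms by (auto simp: mem_box_cart intro: le_less_trans)
    then have "0 \<le> \<lfloor>x $ i\<rfloor>" "\<lfloor>x $ i\<rfloor> < 3" by (simp_all only: floor_less_iff zero_le_floor of_int_numeral)
    then have "\<lfloor>x $ i\<rfloor> = 0 \<or> \<lfloor>x $ i\<rfloor> = 1 \<or> \<lfloor>x $ i\<rfloor> = 2" by linarith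
    then show ?thesis by simp
  qed
  then show ?thesis by (simp add: support_cells_def)
qed

lemma cell_cutoff_outside:
  assumes "x \<notin> cbox 0 2" shows "cell_cutoff x = 0"
proof -
  obtain i where "x $ i < 0 \<or> 2 < x $ i"
    using assms by (auto simp: mem_box_cart not_le)
  then have "step (x $ i) - step (x $ i - 1) = 0"
    by (auto simp: step_eq_0 step_eq_1)
  then show ?thesis unfolding cell_cutoff_def by (intro prod_zero) auto
qed

lemma cell_cutoff_partition_of_unity:
  assumes "x \<in> unit_cell"
  shows "(\<Sum>k\<in>support_cells. cell_cutoff (x + lattice_vec k)) = 1"
proof -
  define h where "h i (j::int) = step (x $ i + of_int j) - step (x $ i + of_int j - 1)" for i j
  have inj: "inj_on vec_lambda (Pi\<^sub>E UNIV (\<lambda>_. {0, 1, 2}) :: ('a \<Rightarrow> int) set)"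
    by (auto intro!: inj_onI simp: vec_lambda_inject)
  have "(\<Sum>k\<in>support_cells. cell_cutoff (x + lattice_vec k)) = (\<Sum>k\<in>support_cells. \<Prod>i\<in>UNIV. h i (k $ i))"
    by (simp add: cell_cutoff_def h_def)
  also have "\<dots> = (\<Sum>f\<in>Pi\<^sub>E UNIV (\<lambda>_. {0, 1, 2}). \<Prod>i\<in>UNIV. h i (f i))"
    unfolding support_cells_eq_image by (subst sum.reindex[OF inj]) simp
  also have "\<dots> = (\<Prod>i\<in>UNIV. \<Sum>j\<in>{0, 1, 2}. h i j)"
    by (rule prod_sum_PiE[symmetric]) auto
  also have "\<dots> = (\<Prod>i\<in>(UNIV :: 'a set). 1)"
  proof (rule prod.cong)
    fix i
    have "0 < x $ i" "x $ i < 1" using assms by (auto simp: mem_unit_cell)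
    then show "(\<Sum>j\<in>{0, 1, 2}. h i j) = 1" by (simp add: h_def step_eq_0 step_eq_1)
  qed simp
  finally show ?thesis by simp
qed

text \<open>
  Plane waves with a phase: sines are cosines with another phase, and differentiation is a
  shift of the phase by \<open>\<pi> / 2\<close>.
\<close>

definition wave :: "int^'n \<Rightarrow> real \<Rightarrow> real^'n \<Rightarrow> real" where
  "wave k b x = cos (2 * pi * (lattice_vec k \<bullet> x) + b)"

lemma wave_abs_le_1: "\<bar>wave k b x\<bar> \<le> 1"
  by (simp add: wave_def)

lemma wave_expand: "wave k b x = cos b * wave k 0 x + sin b * wave k (pi / 2) x"
  by (simp add: wave_def cos_add)

lemma wave_uminus: "wave (- k) b x = wave k (- b) x"
  using cos_minus[of "2 * pi * (lattice_vec k \<bullet> x) - b"] by (simp add: wave_def)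

lemma wave_zero [simp]: "wave 0 b x = cos b"
proof -
  have "lattice_vec (0 :: int^'a) = 0" by (simp add: vec_eq_iff)
  then show ?thesis by (simp add: wave_def)
qed

lemma wave_add_pi: "wave k (b + pi) x = - wave k b x"
  by (simp add: wave_def cos_add)

lemma wave_mult: "wave k b x * wave l d x = (wave (k + l) (b + d) x + wave (k - l) (b - d) x) / 2"
proof -
  have "lattice_vec (k + l) = lattice_vec k + lattice_vec l" "lattice_vec (k - l) = lattice_vec k - lattice_vec l"
    by (simp_all add: vec_eq_iff)
  then have
    "2 * pi * (lattice_vec (k + l) \<bullet> x) + (b + d)
      = (2 * pi * (lattice_vec k \<bullet> x) + b) + (2 * pi * (lattice_vec l \<bullet> x) + d)"
    "2 * pi * (lattice_vec (k - l) \<bullet> x) + (b - d)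
      = (2 * pi * (lattice_vec k \<bullet> x) + b) - (2 * pi * (lattice_vec l \<bullet> x) + d)"
    by (simp_all only: inner_add_left inner_diff_left ring_distribs)
  then show ?thesis by (simp only: wave_def cos_times_cos add.commute)
qed

lemma smooth_expr_wave: "smooth_expr (wave k b)"
  unfolding wave_def[abs_def] using smooth_expr.cos[of "(2 * pi) *\<^sub>R lattice_vec k" b] by simp

lemma wave_borel_measurable: "wave k b \<in> borel_measurable lebesgue"
  by (intro borel_measurable_lebesgue_continuous smooth_expr_continuous smooth_expr_wave)

lemma wave_lattice: assumes "\<forall>i. m $ i \<in> \<int>" shows "wave k b (x + m) = wave k b x"
proof -
  have "lattice_vec k \<bullet> m \<in> \<int>"
    using assms by (auto simp: inner_vec_def intro!: Ints_sum Ints_mult)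
  then obtain n :: int where n: "lattice_vec k \<bullet> m = of_int n" by (auto elim: Ints_cases)
  have "wave k b (x + m) = cos ((2 * pi * (lattice_vec k \<bullet> x) + b) + 2 * pi * of_int n)"
    by (simp add: wave_def inner_add_right n algebra_simps)
  also have "\<dots> = wave k b x"
    by (subst cos_add) (simp add: wave_def)
  finally show ?thesis .
qed

lemma periodic_wave: "periodic (wave k b)"
  by (simp add: periodic_def wave_lattice)

lemma wave_L2_per [simp, intro]: "wave k b \<in> L2_per"
  by (rule L2_per_bounded[where C = 1]) (auto simp: wave_borel_measurable periodic_wave wave_abs_le_1)

lemma mult_wave_L2_per [intro]: "u \<in> L2_per \<Longrightarrow> (\<lambda>x. u x * wave k b x) \<in> L2_per"
  using L2_per_mult_bounded[of u "wave k b" 1]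
  by (simp add: wave_borel_measurable periodic_wave wave_abs_le_1 mult.commute)

lemma partial_wave: "partial i (wave k b) x = 2 * pi * of_int (k $ i) * wave k (b + pi / 2) x"
proof -
  have "(wave k b has_derivative (\<lambda>h. - sin (2 * pi * (lattice_vec k \<bullet> x) + b) * (2 * pi * (lattice_vec k \<bullet> h)))) (at x)"
    unfolding wave_def[abs_def] by (auto intro!: derivative_eq_intros)
  from partialI[OF this, of i] show ?thesis
    by (simp add: wave_def inner_axis cos_add flip: add.assoc)
qed

lemma has_weak_partial_wave: "has_weak_partial (wave k b) i (\<lambda>x. 2 * pi * of_int (k $ i) * wave k (b + pi / 2) x)"
proof -
  have "has_weak_partial (wave k b) i (partial i (wave k b))"
    by (intro has_weak_partial_classical smooth_expr_differentiable smooth_expr_continuous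
        smooth_expr_partial smooth_expr_wave)
  then show ?thesis unfolding partial_wave[abs_def] .
qed

text \<open>
  A periodic function is tested with the compactly supported function
  \<open>cell_cutoff * wave\<close>.  Since the lattice translates of \<open>cell_cutoff\<close> add up to
  one, those of its derivatives add up to zero, and unfolding leaves integrals over the cell.
\<close>

lemma weak_partial_wave_integral:
  fixes u g :: "real^'n \<Rightarrow> real"
  assumes u: "u \<in> L2_per" and g: "g \<in> L2_per" and w: "has_weak_partial u i g"
  shows "cell_integral (\<lambda>x. g x * wave k b x)
       = - (2 * pi * of_int (k $ i)) * cell_integral (\<lambda>x. u x * wave k (b + pi / 2) x)"
proof -
  have sc: "smooth_expr (cell_cutoff :: real^'n \<Rightarrow> real)" by (rule smooth_expr_cell_cutoff)
  have sp: "smooth_expr (partial i (cell_cutoff :: real^'n \<Rightarrow> real))" by (intro smooth_expr_partial sc)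
  note cut0 = cell_cutoff_outside
  have testw: "(\<lambda>x. cell_cutoff x * wave k b x) \<in> test_functions"
    by (rule smooth_expr_test_function[OF smooth_expr.mult[OF sc smooth_expr_wave] compact_cbox[of 0 2]])
       (simp add: cut0)
  have pc0: "partial i cell_cutoff x = 0" if "x \<notin> cbox (0::real^'n) 2" for x
  proof -
    have "(cell_cutoff has_derivative (\<lambda>h. 0)) (at x)"
      by (rule has_derivative_transform_within_open[where s = "- cbox 0 2" and f = "\<lambda>x. 0"])
         (use cut0 that in auto)
    then show ?thesis by (rule partialI)
  qed
  let ?F = "support_cells :: (int^'n) set"
  note one = cell_cutoff_partition_of_unity
  have zero: "(\<Sum>k\<in>?F. partial i cell_cutoff (x + lattice_vec k)) = 0" if "x \<in> unit_cell" for x :: "real^'n"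
  proof -
    have "\<exists>D. (cell_cutoff has_derivative D) (at (x + lattice_vec k))
        \<and> partial i cell_cutoff (x + lattice_vec k) = D (axis i 1)" for k
      using differentiable_has_partial[OF smooth_expr_differentiable[OF sc]] by metis
    then obtain D where D: "\<And>k. (cell_cutoff has_derivative D k) (at (x + lattice_vec k))"
      "\<And>k. partial i cell_cutoff (x + lattice_vec k) = D k (axis i 1)" by metis
    have "((\<lambda>x. cell_cutoff (x + lattice_vec k)) has_derivative D k) (at x)" for k
    proof -
      have "((\<lambda>x. x + lattice_vec k) has_derivative (\<lambda>h. h)) (at x)"
        by (auto intro!: derivative_eq_intros)
      from has_derivative_compose[OF this D(1)] show ?thesis .
    qed
    then have "((\<lambda>x. \<Sum>k\<in>?F. cell_cutoff (x + lattice_vec k)) has_derivative (\<lambda>h. \<Sum>k\<in>?F. D k h)) (at x)"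
      by (intro has_derivative_sum) auto
    then have "((\<lambda>x. 1) has_derivative (\<lambda>h. \<Sum>k\<in>?F. D k h)) (at x)"
      by (rule has_derivative_transform_within_open[where s = unit_cell]) (use that one in auto)
    from partialI[OF this, of i] partialI[of "\<lambda>x. 1" "\<lambda>h. 0" x i] show ?thesis by (simp add: D(2))
  qed
  have cut_int: "(LINT x|lebesgue. v x * cell_cutoff x) = cell_integral v"
    and pcut_int: "(LINT x|lebesgue. v x * partial i cell_cutoff x) = 0"
    and cut_integrable: "integrable lebesgue (\<lambda>x. v x * cell_cutoff x)"
      "integrable lebesgue (\<lambda>x. v x * partial i cell_cutoff x)"
    if v: "v \<in> L2_per" for v :: "real^'n \<Rightarrow> real"
  proof -
    have v': "v \<in> borel_measurable lebesgue" "periodic v" "integrable cell_measure v"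
      using v by (auto simp: L2_per_iff L2_per_integrable)
    obtain C where C: "\<And>x::real^'n. \<bar>cell_cutoff x\<bar> \<le> C"
      using compact_support_bounded[OF smooth_expr_continuous[OF sc] compact_cbox cut0] by metis
    obtain C' where C': "\<And>x::real^'n. \<bar>partial i cell_cutoff x\<bar> \<le> C'"
      using compact_support_bounded[OF smooth_expr_continuous[OF sp] compact_cbox pc0] by metis
    have cF: "floor_vec x \<in> ?F" if "cell_cutoff x \<noteq> 0" for x :: "real^'n"
      using cut0[of x] that by (intro floor_vec_support_cells) auto
    have pcF: "floor_vec x \<in> ?F" if "partial i cell_cutoff x \<noteq> 0" for x :: "real^'n"
      using pc0[of x] that by (intro floor_vec_support_cells) auto
    note un = periodic_unfold[OF v' borel_measurable_lebesgue_continuous[OF smooth_expr_continuous[OF sc]] C finite_support_cells cF]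
    note un' = periodic_unfold[OF v' borel_measurable_lebesgue_continuous[OF smooth_expr_continuous[OF sp]] C' finite_support_cells pcF]
    show "integrable lebesgue (\<lambda>x. v x * cell_cutoff x)"
      "integrable lebesgue (\<lambda>x. v x * partial i cell_cutoff x)"
      using un(1) un'(1) by auto
    have "cell_integral (\<lambda>x. v x * (\<Sum>k\<in>?F. cell_cutoff (x + lattice_vec k))) = cell_integral v"
      unfolding cell_integral_eq by (rule Bochner_Integration.integral_cong) (auto simp: one)
    then show "(LINT x|lebesgue. v x * cell_cutoff x) = cell_integral v"
      using un(2) by simp
    have "cell_integral (\<lambda>x. v x * (\<Sum>k\<in>?F. partial i cell_cutoff (x + lattice_vec k))) = cell_integral (\<lambda>x::real^'n. 0)"
      unfolding cell_integral_eq by (rule Bochner_Integration.integral_cong) (auto simp: zero)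
    then show "(LINT x|lebesgue. v x * partial i cell_cutoff x) = 0"
      using un'(2) by simp
  qed
  let ?c = "2 * pi * of_int (k $ i) :: real"
  have p: "partial i (\<lambda>x. cell_cutoff x * wave k b x) x
      = cell_cutoff x * (?c * wave k (b + pi / 2) x) + partial i cell_cutoff x * wave k b x" for x
    using partial_mult[OF smooth_expr_differentiable[OF sc] smooth_expr_differentiable[OF smooth_expr_wave]]
    by (simp add: partial_wave)
  have uw: "(\<lambda>x. u x * wave k d x) \<in> L2_per" for d using u by (rule mult_wave_L2_per)
  have "cell_integral (\<lambda>x. g x * wave k b x) = (LINT x|lebesgue. (g x * wave k b x) * cell_cutoff x)"
    by (rule cut_int[symmetric]) (rule mult_wave_L2_per[OF g])
  also have "\<dots> = (LINT x|lebesgue. g x * (cell_cutoff x * wave k b x))"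
    by (simp add: mult_ac)
  also have "\<dots> = - (LINT x|lebesgue. u x * partial i (\<lambda>x. cell_cutoff x * wave k b x) x)"
    using w testw unfolding has_weak_partial_def by simp
  also have "(LINT x|lebesgue. u x * partial i (\<lambda>x. cell_cutoff x * wave k b x) x)
      = (LINT x|lebesgue. ?c * ((u x * wave k (b + pi / 2) x) * cell_cutoff x) + (u x * wave k b x) * partial i cell_cutoff x)"
    by (simp add: p algebra_simps)
  also have "\<dots> = ?c * cell_integral (\<lambda>x. u x * wave k (b + pi / 2) x)"
    using uw by (simp add: cut_int pcut_int cut_integrable)
  finally show ?thesis by simp
qed

section \<open>Fourier coefficients\<close>

text \<open>
  The complex coefficient \<open>\<integral> u(x) exp(- 2 \<pi> \<i> k \<cdot> x) dx\<close>; the wave with phase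
  \<open>\<pi> / 2\<close> is minus the sine.
\<close>

definition fourier :: "(real^'n \<Rightarrow> real) \<Rightarrow> int^'n \<Rightarrow> complex" where
  "fourier u k = Complex (cell_integral (\<lambda>x. u x * wave k 0 x)) (cell_integral (\<lambda>x. u x * wave k (pi / 2) x))"

lemma fourier_weak_partial:
  assumes "u \<in> L2_per" "g \<in> L2_per" "has_weak_partial u i g"
  shows "fourier g k = of_real (2 * pi * of_int (k $ i)) * (\<i> * fourier u k)"
proof -
  have "cell_integral (\<lambda>x. u x * wave k pi x) = - cell_integral (\<lambda>x. u x * wave k 0 x)"
    using wave_add_pi[of k 0] cell_integral_scale[of "-1" "\<lambda>x. u x * wave k 0 x"] by simp
  then show ?thesis
    using weak_partial_wave_integral[OF assms, of k 0] weak_partial_wave_integral[OF assms, of k "pi / 2"]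
    by (simp add: fourier_def complex_eq_iff)
qed

lemma fourier_scale: "fourier (\<lambda>x. c * u x) k = of_real c * fourier u k"
  by (simp add: fourier_def complex_eq_iff cell_integral_scale mult.assoc)

lemma fourier_add:
  "u \<in> L2_per \<Longrightarrow> v \<in> L2_per \<Longrightarrow> fourier (\<lambda>x. u x + v x) k = fourier u k + fourier v k"
  by (simp add: fourier_def complex_eq_iff distrib_right cell_integral_add mult_wave_L2_per)

lemma fourier_diff:
  "u \<in> L2_per \<Longrightarrow> v \<in> L2_per \<Longrightarrow> fourier (\<lambda>x. u x - v x) k = fourier u k - fourier v k"
  by (simp add: fourier_def complex_eq_iff left_diff_distrib cell_integral_diff mult_wave_L2_per)

lemma fourier_zero [simp]: "fourier (\<lambda>x. 0) k = 0"
  by (simp add: fourier_def complex_eq_iff)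

lemma fourier_sum:
  "(\<And>i. i \<in> I \<Longrightarrow> u i \<in> L2_per) \<Longrightarrow> fourier (\<lambda>x. \<Sum>i\<in>I. u i x) k = (\<Sum>i\<in>I. fourier (u i) k)"
proof (induction I rule: infinite_finite_induct)
  case (insert i I)
  then show ?case using fourier_add[of "u i" "\<lambda>x. \<Sum>i\<in>I. u i x"] L2_per_sum[of I u] by simp
qed simp_all

lemma fourier_cong_AE:
  assumes "AE x in lebesgue. u x = v x" "u \<in> borel_measurable lebesgue" "v \<in> borel_measurable lebesgue"
  shows "fourier u k = fourier v k"
proof -
  have "cell_integral (\<lambda>x. u x * wave k b x) = cell_integral (\<lambda>x. v x * wave k b x)" for b
    by (rule cell_integral_cong_AE)
       (use assms(1) in eventually_elim, use assms(2,3) in \<open>auto intro: borel_measurable_times wave_borel_measurable\<close>)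
  then show ?thesis by (simp add: fourier_def)
qed

lemma fourier_uminus: "fourier u (- k) = cnj (fourier u k)"
proof -
  have "wave k (- (pi / 2)) x = - wave k (pi / 2) x" for x
    using wave_add_pi[of k "- (pi / 2)" x] by simp
  then show ?thesis
    using cell_integral_scale[of "-1" "\<lambda>x. u x * wave k (pi / 2) x"]
    by (simp add: fourier_def complex_eq_iff wave_uminus)
qed

lemma fourier_0: "fourier u 0 = of_real (cell_integral u)"
  by (simp add: fourier_def complex_eq_iff)

lemma L2_inner_wave:
  assumes "u \<in> L2_per"
  shows "L2_inner u (wave k b) = cos b * Re (fourier u k) + sin b * Im (fourier u k)"
proof -
  have "L2_inner u (wave k b) = L2_inner u (\<lambda>x. cos b * wave k 0 x + sin b * wave k (pi / 2) x)"
    by (simp flip: wave_expand)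
  also have "\<dots> = cos b * L2_inner u (wave k 0) + sin b * L2_inner u (wave k (pi / 2))"
    using assms by (subst L2_inner_add_right) (auto simp: L2_inner_scale_right)
  finally show ?thesis by (simp add: fourier_def L2_inner_def)
qed

lemma norm_fourier_le: "u \<in> L2_per \<Longrightarrow> cmod (fourier u k) \<le> 2 * L2_norm u"
proof -
  assume u: "u \<in> L2_per"
  have "L2_norm (wave k b) \<le> 1" for b
    using L2_norm_mono_AE[of "wave k b" "\<lambda>x. 1"] by (simp add: wave_abs_le_1 L2_norm_1)
  then have "\<bar>L2_inner u (wave k b)\<bar> \<le> L2_norm u" for b
    using L2_Cauchy_Schwarz[OF u wave_L2_per, of k b] mult_left_le[of "L2_norm (wave k b)" "L2_norm u"]
    by (meson L2_norm_nonneg order_trans)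
  from this[of 0] this[of "pi / 2"] show ?thesis
    using cmod_le[of "fourier u k"] by (simp add: fourier_def L2_inner_def)
qed

text \<open>Orthogonality is the relation between the coefficients of the constant one and of its
  derivative zero.\<close>

lemma cell_integral_wave:
  fixes k :: "int^'n"
  shows "cell_integral (wave k b) = (if k = 0 then cos b else 0)"
proof (cases "k = 0")
  case False
  then obtain i where i: "k $ i \<noteq> 0" by (auto simp: vec_eq_iff)
  have "has_weak_partial (\<lambda>x. 1) i (\<lambda>x. 0)"
  proof -
    have "wave 0 0 = (\<lambda>x::real^'n. 1)" by (simp add: fun_eq_iff)
    moreover have "has_weak_partial (wave 0 0) i (\<lambda>x. 0)"
      using has_weak_partial_wave[of 0 0 i] by simp
    ultimately show ?thesis by (simp only:)
  qed
  from weak_partial_wave_integral[OF _ _ this, of k "b - pi / 2"] show ?thesis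
    using i False by simp
next
  case True
  then have "wave k b = (\<lambda>x. cos b)" by (simp add: fun_eq_iff)
  then show ?thesis using True by (simp only: cell_integral_const simp_thms if_True)
qed

lemma cell_integral_wave_mult:
  "cell_integral (\<lambda>x. wave k b x * wave l d x)
    = ((if k = - l then cos (b + d) else 0) + (if k = l then cos (b - d) else 0)) / 2"
proof -
  have "cell_integral (\<lambda>x. wave k b x * wave l d x)
      = cell_integral (\<lambda>x. (1 / 2) * (wave (k + l) (b + d) x + wave (k - l) (b - d) x))"
    by (simp add: wave_mult)
  also have "\<dots> = (1 / 2) * (cell_integral (wave (k + l) (b + d)) + cell_integral (wave (k - l) (b - d)))"
    by (simp only: cell_integral_scale cell_integral_add[OF wave_L2_per wave_L2_per])
  finally show ?thesis by (simp add: cell_integral_wave eq_neg_iff_add_eq_0)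
qed

text \<open>
  The real part of \<open>c\<close> times the complex exponential with frequency \<open>k\<close>.
\<close>

definition mode :: "complex \<Rightarrow> int^'n \<Rightarrow> real^'n \<Rightarrow> real" where
  "mode c k x = Re c * wave k 0 x + Im c * wave k (pi / 2) x"

lemma Re_mult_cnj_self: "Re (z * cnj z) = (cmod z)\<^sup>2"
  unfolding cmod_power2 by (simp add: power2_eq_square)

lemma mode_L2_per [simp, intro]: "mode c k \<in> L2_per"
  unfolding mode_def[abs_def] by (intro L2_per_add L2_per_scale wave_L2_per)

lemma L2_inner_mode: "u \<in> L2_per \<Longrightarrow> L2_inner u (mode c k) = Re (c * cnj (fourier u k))"
  unfolding mode_def[abs_def]
  by (subst L2_inner_add_right) (auto simp: L2_inner_scale_right L2_inner_wave)

lemma fourier_wave: "fourier (wave k b) l = ((if k = l then cis b else 0) + (if k = - l then cis (- b) else 0)) / 2"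
  by (simp add: fourier_def complex_eq_iff cell_integral_wave_mult cos_add cos_diff)

lemma fourier_mode: "fourier (mode c k) l = ((if k = l then c else 0) + (if k = - l then cnj c else 0)) / 2"
  unfolding mode_def[abs_def]
  by (subst fourier_add) (auto simp: fourier_scale fourier_wave complex_eq_iff)

text \<open>The symmetry that characterizes the coefficients of real functions.\<close>

definition hermitian :: "(int^'n \<Rightarrow> complex) \<Rightarrow> bool" where
  "hermitian c \<longleftrightarrow> (\<forall>k. c (- k) = cnj (c k))"

lemma hermitian_fourier: "hermitian (fourier u)"
  by (simp add: hermitian_def fourier_uminus)

definition trig_poly :: "(int^'n \<Rightarrow> complex) \<Rightarrow> (int^'n) set \<Rightarrow> real^'n \<Rightarrow> real" where
  "trig_poly c F x = (\<Sum>k\<in>F. mode (c k) k x)"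

lemma trig_poly_L2_per [simp, intro]: "trig_poly c F \<in> L2_per"
  unfolding trig_poly_def[abs_def] by auto

lemma L2_inner_trig_poly:
  "u \<in> L2_per \<Longrightarrow> L2_inner u (trig_poly c F) = (\<Sum>k\<in>F. Re (c k * cnj (fourier u k)))"
  unfolding trig_poly_def[abs_def] by (subst L2_inner_sum_right) (auto simp: L2_inner_mode)

text \<open>
  Each mode contributes half of its coefficient at \<open>k\<close> and the conjugate half at
  \<open>- k\<close>; on a symmetric set of frequencies the halves from \<open>k\<close> and \<open>- k\<close> add up.
\<close>

lemma fourier_trig_poly:
  assumes F: "finite F" "\<And>k. - k \<in> F \<longleftrightarrow> k \<in> F" and c: "hermitian c"
  shows "fourier (trig_poly c F) l = (if l \<in> F then c l else 0)"
proof -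
  have "fourier (trig_poly c F) l
      = (\<Sum>k\<in>F. ((if k = l then c k else 0) + (if k = - l then cnj (c k) else 0)) / 2)"
    unfolding trig_poly_def[abs_def] by (subst fourier_sum) (auto simp: fourier_mode)
  also have "\<dots> = ((\<Sum>k\<in>F. if k = l then c k else 0) + (\<Sum>k\<in>F. if k = - l then cnj (c k) else 0)) / 2"
    by (simp add: sum.distrib flip: sum_divide_distrib)
  also have "\<dots> = (if l \<in> F then c l else 0)"
    using F c by (simp add: sum.delta' sum.delta hermitian_def)
  finally show ?thesis .
qed

lemma L2_norm_trig_poly:
  assumes "finite F" "\<And>k. - k \<in> F \<longleftrightarrow> k \<in> F" "hermitian c"
  shows "(L2_norm (trig_poly c F))\<^sup>2 = (\<Sum>k\<in>F. (cmod (c k))\<^sup>2)"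
  unfolding L2_norm_sq L2_inner_trig_poly[OF trig_poly_L2_per] fourier_trig_poly[OF assms]
  by (rule sum.cong) (simp_all only: Re_mult_cnj_self if_True)

definition freq_cube :: "nat \<Rightarrow> (int^'n) set" where
  "freq_cube N = {k. \<forall>i. \<bar>k $ i\<bar> \<le> int N}"

lemma finite_freq_cube [simp]: "finite (freq_cube N :: (int^'n) set)"
proof -
  have "freq_cube N \<subseteq> floor_vec ` cbox (lattice_vec (\<chi> i. - int N)) (lattice_vec (\<chi> i. int N) :: real^'n)"
  proof
    fix k :: "int^'n" assume "k \<in> freq_cube N"
    then have "\<bar>k $ i\<bar> \<le> int N" for i by (simp add: freq_cube_def)
    then have "- int N \<le> k $ i \<and> k $ i \<le> int N" for i by (simp add: abs_le_iff minus_le_iff)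
    then have "lattice_vec k \<in> cbox (lattice_vec (\<chi> i. - int N)) (lattice_vec (\<chi> i. int N))"
      by (simp add: mem_box_cart) (metis of_int_le_iff of_int_minus of_int_of_nat_eq)
    moreover have "k = floor_vec (lattice_vec k)" by (simp add: vec_eq_iff)
    ultimately show "k \<in> floor_vec ` cbox (lattice_vec (\<chi> i. - int N)) (lattice_vec (\<chi> i. int N))"
      by blast
  qed
  then show ?thesis by (rule finite_subset) (intro finite_floor_vec_image bounded_cbox)
qed

lemma freq_cube_uminus [simp]: "- k \<in> freq_cube N \<longleftrightarrow> k \<in> freq_cube N"
  by (simp add: freq_cube_def)

lemma freq_cube_mono: "M \<le> N \<Longrightarrow> freq_cube M \<subseteq> freq_cube N"
  unfolding freq_cube_def by (rule Collect_mono) (meson of_nat_mono order_trans)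

lemma eventually_mem_freq_cube: "\<forall>\<^sub>F N in sequentially. k \<in> freq_cube N"
proof -
  define N0 where "N0 = (\<Sum>i\<in>UNIV. nat \<bar>k $ i\<bar>)"
  have "k \<in> freq_cube N0"
    unfolding freq_cube_def
  proof (intro CollectI allI)
    fix i
    have "nat \<bar>k $ i\<bar> \<le> N0" unfolding N0_def by (rule member_le_sum) auto
    then show "\<bar>k $ i\<bar> \<le> int N0" by simp
  qed
  then show ?thesis using freq_cube_mono[of N0] by (auto simp: eventually_sequentially)
qed

section \<open>Completeness of the plane waves\<close>

text \<open>
  Functions orthogonal to all plane waves, and multipliers preserving this class.
  The multipliers contain the plane waves and form an algebra closed under bounded pointwise
  limits, so by Weierstrass approximation they contain continuous functions of plane waves and
  finally the indicators of boxes.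
\<close>

definition wave_null :: "(real^'n \<Rightarrow> real) \<Rightarrow> bool" where
  "wave_null w \<longleftrightarrow> w \<in> borel_measurable lebesgue \<and> integrable cell_measure w \<and>
     (\<forall>k b. cell_integral (\<lambda>x. w x * wave k b x) = 0)"

definition preserves_null :: "(real^'n \<Rightarrow> real) \<Rightarrow> bool" where
  "preserves_null G \<longleftrightarrow> G \<in> borel_measurable lebesgue \<and> (\<exists>C. \<forall>x. \<bar>G x\<bar> \<le> C) \<and>
     (\<forall>w. wave_null w \<longrightarrow> wave_null (\<lambda>x. w x * G x))"

lemma integrable_cell_mult_bounded:
  fixes w G :: "real^'n \<Rightarrow> real"
  assumes "w \<in> borel_measurable lebesgue" "integrable cell_measure w"
    and "G \<in> borel_measurable lebesgue" "\<And>x. \<bar>G x\<bar> \<le> C"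
  shows "integrable cell_measure (\<lambda>x. w x * G x)"
proof (rule integrable_cell_bound[where g = "\<lambda>x. C * \<bar>w x\<bar>"])
  show "AE x in cell_measure. \<bar>w x * G x\<bar> \<le> C * \<bar>w x\<bar>"
  proof (rule AE_I2)
    fix x
    show "\<bar>w x * G x\<bar> \<le> C * \<bar>w x\<bar>"
      using mult_left_mono[OF assms(4)[of x] abs_ge_zero[of "w x"]] by (simp add: abs_mult mult.commute)
  qed
qed (use assms in \<open>auto intro: borel_measurable_times\<close>)

lemma wave_null_integrable:
  "wave_null w \<Longrightarrow> integrable cell_measure (\<lambda>x. w x * wave k b x)"
  by (rule integrable_cell_mult_bounded[where C = 1])
     (auto simp: wave_null_def wave_borel_measurable wave_abs_le_1)

lemma wave_null_integral: "wave_null w \<Longrightarrow> cell_integral w = 0"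
  unfolding wave_null_def by (metis (no_types, lifting) cell_integral_eq cos_zero mult.right_neutral
      Bochner_Integration.integral_cong wave_zero)

lemma wave_null_scale: "wave_null w \<Longrightarrow> wave_null (\<lambda>x. c * w x)"
  by (auto simp: wave_null_def cell_integral_scale mult.assoc)

lemma wave_null_add: "wave_null w \<Longrightarrow> wave_null v \<Longrightarrow> wave_null (\<lambda>x. w x + v x)"
proof -
  assume wv: "wave_null w" "wave_null v"
  have "cell_integral (\<lambda>x. (w x + v x) * wave k b x)
      = cell_integral (\<lambda>x. w x * wave k b x) + cell_integral (\<lambda>x. v x * wave k b x)" for k b
    using wave_null_integrable[OF wv(1), of k b] wave_null_integrable[OF wv(2), of k b]
    by (simp add: cell_integral_eq distrib_right)
  then show ?thesis using wv by (auto simp: wave_null_def)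
qed

lemma preserves_null_const: "preserves_null (\<lambda>x. c)"
  using wave_null_scale by (fastforce simp: preserves_null_def mult.commute)

lemma preserves_null_add:
  assumes "preserves_null G" "preserves_null H" shows "preserves_null (\<lambda>x. G x + H x)"
proof -
  obtain C D where C: "\<And>x. \<bar>G x\<bar> \<le> C" and D: "\<And>x. \<bar>H x\<bar> \<le> D"
    using assms unfolding preserves_null_def by blast
  have "\<bar>G x + H x\<bar> \<le> C + D" for x using C[of x] D[of x] by linarith
  moreover have "wave_null (\<lambda>x. w x * (G x + H x))" if "wave_null w" for w
    using wave_null_add[of "\<lambda>x. w x * G x" "\<lambda>x. w x * H x"] assms that
    by (simp add: preserves_null_def distrib_left)
  moreover have "(\<lambda>x. G x + H x) \<in> borel_measurable lebesgue"
    using assms by (auto simp: preserves_null_def)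
  ultimately show ?thesis unfolding preserves_null_def by blast
qed

lemma preserves_null_mult:
  assumes "preserves_null G" "preserves_null H" shows "preserves_null (\<lambda>x. G x * H x)"
proof -
  obtain C D where C: "\<And>x. \<bar>G x\<bar> \<le> C" and D: "\<And>x. \<bar>H x\<bar> \<le> D"
    using assms unfolding preserves_null_def by blast
  have "\<bar>G x * H x\<bar> \<le> C * D" for x
    using mult_mono[OF C[of x] D[of x]] C[of x] by (simp add: abs_mult)
  moreover have "wave_null (\<lambda>x. w x * (G x * H x))" if "wave_null w" for w
    using assms that by (simp add: preserves_null_def flip: mult.assoc)
  moreover have "(\<lambda>x. G x * H x) \<in> borel_measurable lebesgue"
    using assms by (auto simp: preserves_null_def intro: borel_measurable_times)
  ultimately show ?thesis unfolding preserves_null_def by blast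
qed

lemma preserves_null_prod:
  "finite I \<Longrightarrow> (\<And>i. i \<in> I \<Longrightarrow> preserves_null (G i)) \<Longrightarrow> preserves_null (\<lambda>x. \<Prod>i\<in>I. G i x)"
  by (induction I rule: finite_induct) (auto intro: preserves_null_mult preserves_null_const)

lemma preserves_null_wave: "preserves_null (wave l d)"
proof -
  have "wave_null (\<lambda>x. w x * wave l d x)" if w: "wave_null w" for w
  proof -
    have "cell_integral (\<lambda>x. w x * wave l d x * wave k b x) = 0" for k b
    proof -
      have "cell_integral (\<lambda>x. w x * wave l d x * wave k b x)
          = cell_integral (\<lambda>x. (1 / 2) * (w x * wave (l + k) (d + b) x + w x * wave (l - k) (d - b) x))"
        by (simp add: wave_mult mult.assoc add_divide_distrib distrib_left)
      also have "\<dots> = (1 / 2) * (cell_integral (\<lambda>x. w x * wave (l + k) (d + b) x)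
          + cell_integral (\<lambda>x. w x * wave (l - k) (d - b) x))"
        unfolding cell_integral_eq integral_mult_right_zero
        by (subst Bochner_Integration.integral_add) (auto intro: wave_null_integrable[OF w])
      also have "\<dots> = 0" using w by (simp add: wave_null_def)
      finally show ?thesis .
    qed
    then show ?thesis
      using w wave_null_integrable[OF w, of l d] wave_borel_measurable[of l d]
      by (auto simp: wave_null_def intro: borel_measurable_times)
  qed
  then show ?thesis
    unfolding preserves_null_def using wave_abs_le_1[of l d] wave_borel_measurable[of l d] by blast
qed

lemma preserves_null_limit:
  assumes G: "\<And>n. preserves_null (G n)" and C: "\<And>n x. \<bar>G n x\<bar> \<le> C"
    and lim: "\<And>x. (\<lambda>n. G n x) \<longlonglongrightarrow> H x"
  shows "preserves_null H"
proof -
  have Gm: "G n \<in> borel_measurable lebesgue" for n using G by (simp add: preserves_null_def)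
  have Hm: "H \<in> borel_measurable lebesgue"
    by (rule borel_measurable_LIMSEQ_real[OF lim Gm])
  have HC: "\<bar>H x\<bar> \<le> C" for x
    using LIMSEQ_le_const2[OF tendsto_rabs[OF lim]] C by blast
  have "wave_null (\<lambda>x. w x * H x)" if w: "wave_null w" for w
  proof -
    have wm: "w \<in> borel_measurable lebesgue" "integrable cell_measure w"
      using w by (auto simp: wave_null_def)
    have "cell_integral (\<lambda>x. w x * H x * wave k b x) = 0" for k b
    proof -
      have "(\<lambda>n. LINT x|cell_measure. w x * G n x * wave k b x) \<longlonglongrightarrow> (LINT x|cell_measure. w x * H x * wave k b x)"
      proof (rule integral_dominated_convergence[where w = "\<lambda>x. C * \<bar>w x\<bar>"])
        show "integrable cell_measure (\<lambda>x. C * \<bar>w x\<bar>)" using wm by auto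
        show "(\<lambda>x. w x * H x * wave k b x) \<in> borel_measurable cell_measure"
          "(\<lambda>x. w x * G n x * wave k b x) \<in> borel_measurable cell_measure" for n
          by (intro measurable_cell borel_measurable_times wm Hm Gm wave_borel_measurable)+
        show "AE x in cell_measure. (\<lambda>n. w x * G n x * wave k b x) \<longlonglongrightarrow> w x * H x * wave k b x"
          by (intro AE_I2 tendsto_intros lim)
        show "AE x in cell_measure. norm (w x * G n x * wave k b x) \<le> C * \<bar>w x\<bar>" for n
        proof (rule AE_I2)
          fix x
          have "\<bar>G n x\<bar> * \<bar>wave k b x\<bar> \<le> C * 1"
            using C[of n x] wave_abs_le_1[of k b x] by (intro mult_mono) auto
          from mult_left_mono[OF this abs_ge_zero[of "w x"]]
          show "norm (w x * G n x * wave k b x) \<le> C * \<bar>w x\<bar>" by (simp add: abs_mult mult_ac)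
        qed
      qed
      moreover have "wave_null (\<lambda>x. w x * G n x)" for n
        using G w by (simp add: preserves_null_def)
      ultimately show ?thesis
        by (simp add: wave_null_def cell_integral_eq LIMSEQ_const_iff)
    qed
    then show ?thesis
      using integrable_cell_mult_bounded[OF wm Hm HC] borel_measurable_times[OF wm(1) Hm]
      by (simp add: wave_null_def)
  qed
  then show ?thesis using Hm HC by (auto simp: preserves_null_def)
qed

lemma preserves_null_polynomial:
  assumes "real_polynomial_function (p :: real \<Rightarrow> real)" "preserves_null G"
  shows "preserves_null (\<lambda>x. p (G x))"
  using assms(1)
proof (induction rule: real_polynomial_function.induct)
  case (linear f)
  then have "f t = f 1 * t" for t
    using linear_cmul[OF bounded_linear.linear, of f t 1] by simp
  then show ?case using preserves_null_mult[OF preserves_null_const assms(2)] by (metis (no_types, lifting) ext)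
qed (auto intro: preserves_null_const preserves_null_add preserves_null_mult)

lemma preserves_null_continuous:
  assumes h: "continuous_on UNIV (h :: real \<Rightarrow> real)" and G: "preserves_null G"
  shows "preserves_null (\<lambda>x. h (G x))"
proof -
  obtain C where C: "\<And>x. \<bar>G x\<bar> \<le> C" using G by (auto simp: preserves_null_def)
  have hC: "continuous_on {-C..C} h" using h by (rule continuous_on_subset) simp
  have GC: "G x \<in> {-C..C}" for x using C[of x] by (auto simp: abs_le_iff)
  have "\<exists>p. real_polynomial_function p \<and> (\<forall>t\<in>{-C..C}. \<bar>h t - p t\<bar> < 1 / real (Suc n))" for n
    by (rule Stone_Weierstrass_real_polynomial_function[OF compact_Icc hC, of "1 / real (Suc n)"]) auto
  then obtain p where p: "\<And>n. real_polynomial_function (p n)"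
    "\<And>n t. t \<in> {-C..C} \<Longrightarrow> \<bar>h t - p n t\<bar> < 1 / real (Suc n)" by metis
  have "compact (h ` {-C..C})" by (rule compact_continuous_image[OF hC compact_Icc])
  then obtain B where B: "\<And>t. t \<in> {-C..C} \<Longrightarrow> \<bar>h t\<bar> \<le> B"
    by (fastforce dest!: compact_imp_bounded simp: bounded_iff)
  show ?thesis
  proof (rule preserves_null_limit[where C = "B + 1"])
    show "preserves_null (\<lambda>x. p n (G x))" for n by (rule preserves_null_polynomial[OF p(1) G])
    have "1 / real (Suc n) \<le> 1" for n by (simp add: divide_le_eq_1)
    then show "\<bar>p n (G x)\<bar> \<le> B + 1" for n x
      using p(2)[OF GC, of x n] B[OF GC, of x] by (smt (verit))
    show "(\<lambda>n. p n (G x)) \<longlonglongrightarrow> h (G x)" for x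
    proof -
      have "(\<lambda>n. p n (G x) - h (G x)) \<longlonglongrightarrow> 0"
      proof (rule Lim_null_comparison)
        show "(\<lambda>n. 1 / real (Suc n)) \<longlonglongrightarrow> 0"
          using LIMSEQ_inverse_real_of_nat by (simp add: divide_inverse)
        show "\<forall>\<^sub>F n in sequentially. norm (p n (G x) - h (G x)) \<le> 1 / real (Suc n)"
          using p(2)[OF GC, of x]
          by (intro always_eventually allI) (simp add: abs_minus_commute less_imp_le)
      qed
      then show ?thesis by (rule LIM_zero_cancel)
    qed
  qed
qed

lemma preserves_null_superlevel:
  assumes G: "preserves_null G"
  shows "preserves_null (\<lambda>x. indicator {c<..} (G x))"
proof (rule preserves_null_limit[where C = 1])
  show "preserves_null (\<lambda>x. min 1 (max 0 (real n * (G x - c))))" for n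
    by (rule preserves_null_continuous[OF _ G, of "\<lambda>t. min 1 (max 0 (real n * (t - c)))"])
       (intro continuous_intros)
  show "\<bar>min 1 (max 0 (real n * (G x - c)))\<bar> \<le> 1" for n x by simp
  show "(\<lambda>n. min 1 (max 0 (real n * (G x - c)))) \<longlonglongrightarrow> indicator {c<..} (G x)" for x
  proof (cases "c < G x")
    case True
    have "filterlim (\<lambda>n. real n * (G x - c)) at_top sequentially"
      by (rule filterlim_at_top_mult_tendsto_pos[OF tendsto_const _ filterlim_real_sequentially]) (use True in simp)
    then have "\<forall>\<^sub>F n in sequentially. 1 \<le> real n * (G x - c)" by (simp add: filterlim_at_top)
    then have "\<forall>\<^sub>F n in sequentially. min 1 (max 0 (real n * (G x - c))) = indicator {c<..} (G x)"
      by eventually_elim (use True in auto)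
    then show ?thesis by (rule tendsto_eventually)
  next
    case False
    then have "real n * (G x - c) \<le> 0" for n by (intro mult_nonneg_nonpos) auto
    then have "min 1 (max 0 (real n * (G x - c))) = indicator {c<..} (G x)" for n
      using False by (simp add: max_absorb1)
    then show ?thesis by simp
  qed
qed

text \<open>
  Within the period \<open>(0, 1)\<close>, an interval is the set where a shifted cosine exceeds its
  value at the endpoints.
\<close>

lemma interval_eq_cos_superlevel:
  fixes a b t :: real
  assumes "0 \<le> a" "a < b" "b \<le> 1" "0 < t" "t < 1"
  shows "cos (pi * (b - a)) < cos (2 * pi * (t - (a + b) / 2)) \<longleftrightarrow> a < t \<and> t < b"
proof -
  define s where "s = \<bar>t - (a + b) / 2\<bar>"
  have mid: "a < t \<and> t < b \<longleftrightarrow> 2 * s < b - a" by (auto simp: s_def abs_less_iff field_simps)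
  have s: "cos (2 * pi * (t - (a + b) / 2)) = cos (2 * pi * s)"
  proof -
    have "\<bar>2 * pi * (t - (a + b) / 2)\<bar> = 2 * pi * s" by (simp add: s_def abs_mult)
    then show ?thesis by (metis cos_abs_real)
  qed
  show ?thesis
  proof (cases "s \<le> 1 / 2")
    case True
    have "cos (pi * (b - a)) < cos (2 * pi * s) \<longleftrightarrow> 2 * pi * s < pi * (b - a)"
    proof (rule cos_mono_less_eq)
      show "2 * pi * s \<le> pi" using True mult_left_mono[of "2 * s" 1 pi] by simp
      show "pi * (b - a) \<le> pi" using assms mult_left_mono[of "b - a" 1 pi] by simp
    qed (use assms in \<open>auto simp: s_def\<close>)
    also have "\<dots> \<longleftrightarrow> pi * (2 * s) < pi * (b - a)" by (simp add: mult_ac)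
    also have "\<dots> \<longleftrightarrow> 2 * s < b - a" using pi_gt_zero by (rule mult_less_cancel_left_pos)
    finally show ?thesis unfolding s mid .
  next
    case False
    have r: "b - a \<le> 2 * (1 - s)" "s < 1" using assms by (auto simp: s_def abs_if field_simps split: if_splits)
    have "cos (2 * pi * s) = cos (2 * pi * (1 - s))"
      using cos_periodic[of "- (2 * pi * s)"] by (simp add: algebra_simps)
    also have "\<dots> \<le> cos (pi * (b - a))"
    proof (rule cos_monotone_0_pi_le)
      show "pi * (b - a) \<le> 2 * pi * (1 - s)" using mult_left_mono[OF r(1), of pi] by simp
      show "2 * pi * (1 - s) \<le> pi" using False mult_left_mono[of "2 * (1 - s)" 1 pi] by simp
    qed (use assms in auto)
    finally show ?thesis unfolding s mid using False assms by auto
  qed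
qed

text \<open>
  The indicator of a box in the cell is a product of indicators of superlevel sets of plane
  waves, hence a multiplier, and the multiplied function still has mean zero.
\<close>

theorem fourier_complete:
  fixes u :: "real^'n \<Rightarrow> real"
  assumes u: "u \<in> L2_per" and zero: "\<And>k. fourier u k = 0"
  shows "AE x in lebesgue. u x = 0"
proof -
  have null: "wave_null u"
    using L2_inner_wave[OF u] zero u
    by (auto simp: wave_null_def L2_inner_def L2_per_integrable)
  have box_in_cell: "(LINT x|cell_measure. indicator (box a b) x * u x) = 0"
    if ab: "\<And>i. 0 \<le> a $ i" "\<And>i. a $ i < b $ i" "\<And>i. b $ i \<le> 1" for a b :: "real^'n"
  proof -
    define G :: "'n \<Rightarrow> real^'n \<Rightarrow> real" where "G i x = indicator {cos (pi * (b $ i - a $ i))<..}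
        (wave (axis i 1) (- pi * (a $ i + b $ i)) x)" for i and x :: "real^'n"
    have "preserves_null (\<lambda>x. \<Prod>i\<in>UNIV. G i x)"
      unfolding G_def by (intro preserves_null_prod preserves_null_superlevel preserves_null_wave) auto
    then have "wave_null (\<lambda>x. u x * (\<Prod>i\<in>UNIV. G i x))"
      using null by (simp add: preserves_null_def)
    then have "(LINT x|cell_measure. u x * (\<Prod>i\<in>UNIV. G i x)) = 0"
      using wave_null_integral by (simp add: cell_integral_eq)
    moreover have "(\<Prod>i\<in>UNIV. G i x) = indicator (box a b) x" if x: "x \<in> unit_cell" for x
    proof -
      have "G i x = indicator {a $ i<..<b $ i} (x $ i)" for i
      proof -
        have "lattice_vec (axis i 1) \<bullet> x = x $ i"
          by (simp add: inner_vec_def axis_def if_distrib[of "\<lambda>z. z * _"] if_distrib[of of_int] cong: if_cong)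
        then have "wave (axis i 1) (- pi * (a $ i + b $ i)) x = cos (2 * pi * (x $ i - (a $ i + b $ i) / 2))"
          unfolding wave_def by (intro arg_cong[of _ _ cos]) (simp add: field_simps)
        then show ?thesis
          using interval_eq_cos_superlevel[OF ab, of "x $ i"] x
          by (auto simp: G_def indicator_def mem_unit_cell)
      qed
      then have "(\<Prod>i\<in>UNIV. G i x) = (\<Prod>i\<in>UNIV. indicator {a $ i<..<b $ i} (x $ i))" by simp
      also have "\<dots> = indicator (box a b) x"
      proof (cases "x \<in> box a b")
        case True
        then show ?thesis by (simp add: mem_box_cart)
      next
        case False
        then obtain i where "x $ i \<notin> {a $ i<..<b $ i}" by (auto simp: mem_box_cart)
        then have "\<exists>i\<in>UNIV. indicator {a $ i<..<b $ i} (x $ i) = (0::real)"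
          by (intro bexI[of _ i] indicator_simps(2)) auto
        then show ?thesis using False by (subst prod_zero) auto
      qed
      finally show ?thesis .
    qed
    moreover have "(LINT x|cell_measure. indicator (box a b) x * u x)
        = (LINT x|cell_measure. u x * (\<Prod>i\<in>UNIV. G i x))"
      using calculation(2) by (intro Bochner_Integration.integral_cong) (auto simp: mult.commute)
    ultimately show ?thesis by simp
  qed
  have "AE x in lebesgue. indicator unit_cell x * u x = 0"
  proof (rule AE_zero_if_box_integrals_zero)
    show "integrable lebesgue (\<lambda>x. indicator unit_cell x * u x)"
      using L2_per_integrable[OF u] by (subst (asm) integrable_restrict_space) auto
    fix a b :: "real^'n"
    define a' b' where "a' = (\<chi> i. max (a $ i) 0)" and "b' = (\<chi> i. min (b $ i) 1)"
    have "indicator (box a b) x * indicator unit_cell x = (indicator unit_cell x * indicator (box a' b') x :: real)" for x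
      by (auto simp: indicator_def mem_box_cart a'_def b'_def)
    then have "(LINT x:box a b|lebesgue. indicator unit_cell x * u x)
        = (LINT x|lebesgue. indicator unit_cell x *\<^sub>R (indicator (box a' b') x * u x))"
      by (simp only: set_lebesgue_integral_def real_scaleR_def flip: mult.assoc)
    also have "\<dots> = (LINT x|cell_measure. indicator (box a' b') x * u x)"
      by (rule integral_restrict_space[symmetric]) simp
    also have "\<dots> = 0"
    proof (cases "\<forall>i. a' $ i < b' $ i")
      case True
      then show ?thesis by (intro box_in_cell) (auto simp: a'_def b'_def)
    next
      case False
      then have "box a' b' = {}" by (auto simp: interval_eq_empty_cart not_less)
      then show ?thesis by simp
    qed
    finally show "(LINT x:box a b|lebesgue. indicator unit_cell x * u x) = 0" .
  qed
  then have "AE x in cell_measure. u x = 0"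
    unfolding AE_cell_iff by eventually_elim (auto simp: indicator_def)
  then show ?thesis using u by (intro periodic_AE_zero) (auto simp: L2_per_iff)
qed

lemma fourier_eq_imp_AE:
  assumes "u \<in> L2_per" "v \<in> L2_per" "\<And>k. fourier u k = fourier v k"
  shows "AE x in lebesgue. u x = v x"
  using fourier_complete[of "\<lambda>x. u x - v x"] assms L2_per_diff[OF assms(1,2)]
  by (simp add: fourier_diff)

section \<open>Fourier multipliers\<close>

lemma bessel:
  assumes u: "u \<in> L2_per" and F: "finite F" "\<And>k. - k \<in> F \<longleftrightarrow> k \<in> F"
  shows "(\<Sum>k\<in>F. (cmod (fourier u k))\<^sup>2) \<le> (L2_norm u)\<^sup>2"
proof -
  let ?t = "trig_poly (fourier u) F"
  have ut: "L2_inner u ?t = (\<Sum>k\<in>F. (cmod (fourier u k))\<^sup>2)"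
    unfolding L2_inner_trig_poly[OF u] Re_mult_cnj_self ..
  have "0 \<le> L2_inner (\<lambda>x. u x - ?t x) (\<lambda>x. u x - ?t x)" by simp
  also have "\<dots> = L2_inner u u - 2 * L2_inner u ?t + L2_inner ?t ?t"
    using u L2_per_diff[OF u trig_poly_L2_per]
    by (simp add: L2_inner_diff_left L2_inner_diff_right L2_inner_commute[of ?t u])
  finally show ?thesis
    using ut L2_norm_trig_poly[OF F hermitian_fourier, of u] by (simp add: L2_norm_sq)
qed

text \<open>
  The distance of two partial sums is governed by the increasing and bounded, hence convergent,
  sequence of the partial sums of \<open>\<bar>c k\<bar>\<^sup>2\<close>.
\<close>

lemma riesz_fischer:
  assumes c: "hermitian c" and B: "\<And>N. (\<Sum>k\<in>freq_cube N. (cmod (c k))\<^sup>2) \<le> B"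
  obtains u where "u \<in> L2_per" "\<And>k. fourier u k = c k"
    "(\<lambda>N. L2_norm (\<lambda>x. trig_poly c (freq_cube N) x - u x)) \<longlonglongrightarrow> 0"
proof -
  let ?t = "\<lambda>N. trig_poly c (freq_cube N)"
  define S where "S N = (\<Sum>k\<in>freq_cube N. (cmod (c k))\<^sup>2)" for N
  have "incseq S"
    unfolding S_def by (intro incseq_SucI sum_mono2) (auto intro: freq_cube_mono[THEN subsetD, rotated])
  then have "convergent S"
    using B by (intro Bseq_monoseq_convergent incseq_imp_monoseq BseqI'[of S B])
      (auto simp: S_def sum_nonneg abs_of_nonneg)
  then have CS: "Cauchy S" by (rule convergent_Cauchy)
  have diff: "(L2_norm (\<lambda>x. ?t N x - ?t M x))\<^sup>2 = S N - S M" if "M \<le> N" for M N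
  proof -
    have sub: "freq_cube M \<subseteq> (freq_cube N :: (int^'n) set)" using that by (rule freq_cube_mono)
    have "(\<lambda>x. ?t N x - ?t M x) = trig_poly c (freq_cube N - freq_cube M)"
      unfolding trig_poly_def fun_eq_iff by (intro allI) (rule sum_diff[OF finite_freq_cube sub, symmetric])
    then show ?thesis
      using c sum_diff[OF finite_freq_cube sub, of "\<lambda>k. (cmod (c k))\<^sup>2"]
      by (simp add: L2_norm_trig_poly S_def)
  qed
  have dist: "(L2_norm (\<lambda>x. ?t i x - ?t j x))\<^sup>2 = \<bar>S i - S j\<bar>" for i j
  proof (cases "j \<le> i")
    case True
    then show ?thesis using diff[of j i] by (metis abs_of_nonneg zero_le_power2)
  next
    case False
    have "L2_norm (\<lambda>x. ?t i x - ?t j x) = L2_norm (\<lambda>x. ?t j x - ?t i x)"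
      using L2_norm_uminus[of "\<lambda>x. ?t j x - ?t i x"] by simp
    then show ?thesis using False diff[of i j] by (metis abs_minus_commute abs_of_nonneg nat_le_linear zero_le_power2)
  qed
  have Cauchy: "\<exists>N. \<forall>i\<ge>N. \<forall>j\<ge>N. L2_norm (\<lambda>x. ?t i x - ?t j x) < e" if "0 < e" for e
  proof -
    obtain N where N: "\<forall>i\<ge>N. \<forall>j\<ge>N. \<bar>S i - S j\<bar> < e\<^sup>2"
      using CS \<open>0 < e\<close> unfolding Cauchy_def dist_real_def by (metis zero_less_power)
    have "L2_norm (\<lambda>x. ?t i x - ?t j x) < e" if "i \<ge> N" "j \<ge> N" for i j
      using N that \<open>0 < e\<close> dist[of i j] by (intro power_less_imp_less_base[of _ 2 e]) auto
    then show ?thesis by blast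
  qed
  obtain u where u: "u \<in> L2_per" and lim: "(\<lambda>N. L2_norm (\<lambda>x. ?t N x - u x)) \<longlonglongrightarrow> 0"
    using L2_complete[of ?t, OF trig_poly_L2_per Cauchy] by blast
  have "fourier u k = c k" for k
  proof -
    have "(\<lambda>N. cmod (fourier (?t N) k - fourier u k)) \<longlonglongrightarrow> 0"
    proof (rule tendsto_sandwich[OF _ _ tendsto_const])
      show "(\<lambda>N. 2 * L2_norm (\<lambda>x. ?t N x - u x)) \<longlonglongrightarrow> 0" using tendsto_mult_right_zero[OF lim] by simp
      show "\<forall>\<^sub>F N in sequentially. cmod (fourier (?t N) k - fourier u k) \<le> 2 * L2_norm (\<lambda>x. ?t N x - u x)"
        using norm_fourier_le[OF L2_per_diff[OF trig_poly_L2_per u]] u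
        by (auto simp: fourier_diff intro!: always_eventually)
    qed auto
    then have "(\<lambda>N. fourier (?t N) k) \<longlonglongrightarrow> fourier u k"
      by (simp add: tendsto_norm_zero_iff LIM_zero_iff)
    moreover have "\<forall>\<^sub>F N in sequentially. fourier (?t N) k = c k"
      using eventually_mem_freq_cube[of k] by eventually_elim (use c in \<open>simp add: fourier_trig_poly\<close>)
    ultimately show ?thesis
      by (rule LIMSEQ_unique[OF _ tendsto_eventually])
  qed
  from that[OF u this lim] show thesis .
qed

text \<open>
  By completeness, the limit provided by \<open>riesz_fischer\<close> for the coefficients of \<open>u\<close> is
  \<open>u\<close> itself, so \<open>u\<close> is the limit of its partial sums.
\<close>

lemma parseval:
  assumes u: "u \<in> L2_per" and v: "v \<in> L2_per"
  shows "(\<lambda>N. \<Sum>k\<in>freq_cube N. Re (fourier u k * cnj (fourier v k))) \<longlonglongrightarrow> L2_inner u v"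
proof -
  let ?t = "\<lambda>N. trig_poly (fourier u) (freq_cube N)"
  have B: "(\<Sum>k\<in>freq_cube N. (cmod (fourier u k))\<^sup>2) \<le> (L2_norm u)\<^sup>2" for N
    by (rule bessel[OF u]) auto
  obtain u' where u': "u' \<in> L2_per" "\<And>k. fourier u' k = fourier u k"
    and lim: "(\<lambda>N. L2_norm (\<lambda>x. ?t N x - u' x)) \<longlonglongrightarrow> 0"
    by (rule riesz_fischer[OF hermitian_fourier[of u] B]) (rule that)
  have eq: "L2_inner v u' = L2_inner v u"
    by (rule L2_inner_cong_AE) (use fourier_eq_imp_AE[OF u'(1) u u'(2)] u v u' in auto)
  have "(\<lambda>N. L2_inner v (?t N) - L2_inner v u') \<longlonglongrightarrow> 0"
  proof (rule tendsto_rabs_zero_cancel, rule tendsto_sandwich[OF _ _ tendsto_const])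
    show "(\<lambda>N. L2_norm v * L2_norm (\<lambda>x. ?t N x - u' x)) \<longlonglongrightarrow> 0"
      using tendsto_mult_right_zero[OF lim] by simp
    show "\<forall>\<^sub>F N in sequentially. \<bar>L2_inner v (?t N) - L2_inner v u'\<bar> \<le> L2_norm v * L2_norm (\<lambda>x. ?t N x - u' x)"
      using L2_Cauchy_Schwarz[OF v L2_per_diff[OF trig_poly_L2_per u'(1)]] v u'
      by (auto simp: L2_inner_diff_right intro!: always_eventually)
  qed auto
  then have "(\<lambda>N. L2_inner v (?t N)) \<longlonglongrightarrow> L2_inner v u'" by (rule LIM_zero_cancel)
  then show ?thesis by (simp add: L2_inner_trig_poly[OF v] eq L2_inner_commute[of u v])
qed

lemma L2_inner_eq_if_fourier:
  assumes "u \<in> L2_per" "v \<in> L2_per" "u' \<in> L2_per" "v' \<in> L2_per"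
    and "\<And>k. Re (fourier u k * cnj (fourier v k)) = Re (fourier u' k * cnj (fourier v' k))"
  shows "L2_inner u v = L2_inner u' v'"
  using parseval[OF assms(1,2)] parseval[OF assms(3,4)] unfolding assms(5) by (rule LIMSEQ_unique)

lemma L2_norm_le_if_fourier_le:
  assumes u: "u \<in> L2_per" and v: "v \<in> L2_per" and C: "0 \<le> C"
    and le: "\<And>k. cmod (fourier u k) \<le> C * cmod (fourier v k)"
  shows "L2_norm u \<le> C * L2_norm v"
proof (rule power2_le_imp_le)
  have 1: "Re (fourier w k * cnj (fourier w k)) = (cmod (fourier w k))\<^sup>2" for w :: "real^'n \<Rightarrow> real" and k
    by (rule Re_mult_cnj_self)
  have "(\<lambda>N. \<Sum>k\<in>freq_cube N. (cmod (fourier u k))\<^sup>2) \<longlonglongrightarrow> L2_inner u u"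
    using parseval[OF u u] by (simp only: 1)
  moreover have "(\<lambda>N. C\<^sup>2 * (\<Sum>k\<in>freq_cube N. (cmod (fourier v k))\<^sup>2)) \<longlonglongrightarrow> C\<^sup>2 * L2_inner v v"
    using parseval[OF v v] by (intro tendsto_mult tendsto_const) (simp only: 1)
  moreover have "(\<Sum>k\<in>freq_cube N. (cmod (fourier u k))\<^sup>2) \<le> C\<^sup>2 * (\<Sum>k\<in>freq_cube N. (cmod (fourier v k))\<^sup>2)" for N
    unfolding sum_distrib_left power_mult_distrib[symmetric] by (intro sum_mono power_mono le) simp
  ultimately have "L2_inner u u \<le> C\<^sup>2 * L2_inner v v" by (blast intro: LIMSEQ_le)
  then show "(L2_norm u)\<^sup>2 \<le> (C * L2_norm v)\<^sup>2" by (simp add: L2_norm_sq power_mult_distrib)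
qed (use C in simp)

text \<open>
  A choice is made because coefficients determine a function only up to null sets.  A real
  symbol makes the operator self-adjoint; it has to be even so that real functions are mapped
  to real functions.
\<close>

definition fourier_mult :: "(int^'n \<Rightarrow> real) \<Rightarrow> (real^'n \<Rightarrow> real) \<Rightarrow> real^'n \<Rightarrow> real" where
  "fourier_mult m u = (SOME v. v \<in> L2_per \<and> (\<forall>k. fourier v k = of_real (m k) * fourier u k))"

lemma fourier_mult:
  assumes m: "\<And>k. m (- k) = m k" "\<And>k. \<bar>m k\<bar> \<le> C" and u: "u \<in> L2_per"
  shows "fourier_mult m u \<in> L2_per" "fourier (fourier_mult m u) k = of_real (m k) * fourier u k"
proof -
  let ?c = "\<lambda>k. of_real (m k) * fourier u k"
  have "hermitian ?c" using m(1) by (simp add: hermitian_def fourier_uminus)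
  moreover have "(\<Sum>k\<in>freq_cube N. (cmod (?c k))\<^sup>2) \<le> C\<^sup>2 * (L2_norm u)\<^sup>2" for N
  proof -
    have "(\<Sum>k\<in>freq_cube N. (cmod (?c k))\<^sup>2) \<le> (\<Sum>k\<in>freq_cube N. C\<^sup>2 * (cmod (fourier u k))\<^sup>2)"
    proof (rule sum_mono)
      fix k
      have "(m k)\<^sup>2 \<le> C\<^sup>2" using m(2)[of k] by (metis abs_ge_zero power2_abs power_mono)
      then show "(cmod (?c k))\<^sup>2 \<le> C\<^sup>2 * (cmod (fourier u k))\<^sup>2"
        by (simp add: norm_mult power_mult_distrib mult_right_mono)
    qed
    also have "\<dots> \<le> C\<^sup>2 * (L2_norm u)\<^sup>2"
      unfolding sum_distrib_left[symmetric] by (intro mult_left_mono bessel[OF u]) auto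
    finally show ?thesis .
  qed
  ultimately obtain v where "v \<in> L2_per" "\<forall>k. fourier v k = ?c k"
    by (rule riesz_fischer[of ?c]) blast
  then have "\<exists>v. v \<in> L2_per \<and> (\<forall>k. fourier v k = ?c k)" by blast
  from someI_ex[OF this]
  show "fourier_mult m u \<in> L2_per" "fourier (fourier_mult m u) k = of_real (m k) * fourier u k"
    by (simp_all add: fourier_mult_def)
qed

section \<open>The equation in terms of Fourier coefficients\<close>

lemma locally_integrable_measurable:
  fixes u :: "real^'n \<Rightarrow> real"
  assumes "locally_integrable u" shows "u \<in> borel_measurable lebesgue"
proof (rule borel_measurable_LIMSEQ_real)
  show "(\<lambda>x. indicator (cball 0 (real n)) x *\<^sub>R u x) \<in> borel_measurable lebesgue" for n
    using assms compact_cball[of 0 "real n"]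
    unfolding locally_integrable_def set_integrable_def by (blast intro: borel_measurable_integrable)
  show "(\<lambda>n. indicator (cball 0 (real n)) x *\<^sub>R u x) \<longlonglongrightarrow> u x" for x
  proof (rule tendsto_eventually)
    obtain m :: nat where "norm x \<le> real m" using real_arch_simple by blast
    then show "\<forall>\<^sub>F n in sequentially. indicator (cball 0 (real n)) x *\<^sub>R u x = u x"
      by (intro eventually_sequentiallyI[of m]) (simp add: indicator_def)
  qed
qed

lemma L2_per_cong_AE:
  fixes u :: "real^'n \<Rightarrow> real"
  assumes v: "v \<in> L2_per" and u: "u \<in> borel_measurable lebesgue" and eq: "AE x in lebesgue. u x = v x"
  shows "u \<in> L2_per"
  unfolding L2_per_iff
proof (intro conjI u)
  show "periodic u"
    unfolding periodic_def
  proof (intro allI impI)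
    fix k :: "real^'n" assume "\<forall>i. k $ i \<in> \<int>"
    then have "AE x in lebesgue. v (x + k) = v x" using v by (auto simp: L2_per_iff periodic_def)
    then show "AE x in lebesgue. u (x + k) = u x"
      using eq AE_lebesgue_translation[OF eq, of k] by eventually_elim simp
  qed
  have "AE x in cell_measure. u x = v x" by (rule AE_lebesgue_cell[OF eq])
  then have "AE x in cell_measure. (v x)\<^sup>2 = (u x)\<^sup>2" by eventually_elim simp
  then show "integrable cell_measure (\<lambda>x. (u x)\<^sup>2)"
    using v u by (subst integrable_cong_AE[where g = "\<lambda>x. (v x)\<^sup>2"])
      (auto simp: L2_per_iff intro!: borel_measurable_power measurable_cell)
qed

text \<open>
  The weak Hessian \<open>H\<close> and the square integrable periodic derivatives of \<open>\<phi>\<close> come from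
  separate existence statements; uniqueness of weak derivatives identifies them.
\<close>

lemma weak_hessian_fourier:
  fixes \<phi> :: "real^'n \<Rightarrow> real"
  assumes \<phi>: "\<phi> \<in> H_per 2" and H: "has_weak_hessian \<phi> H"
  shows "(\<lambda>x. H x $ i $ j) \<in> L2_per"
    and "fourier (\<lambda>x. H x $ i $ j) k = - of_real (4 * pi\<^sup>2 * of_int (k $ i) * of_int (k $ j)) * fourier \<phi> k"
proof -
  obtain g' where g': "has_weak_partial \<phi> i (g' i)" "has_weak_partial (g' i) j (\<lambda>x. H x $ i $ j)"
    using H unfolding has_weak_hessian_def by blast
  have \<phi>L: "\<phi> \<in> L2_per" using \<phi> by (simp add: numeral_2_eq_2)
  obtain g where g: "g \<in> L2_per" "has_weak_partial \<phi> i g" "\<exists>h\<in>L2_per. has_weak_partial g j h"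
    using \<phi> unfolding numeral_2_eq_2 H_per.simps by blast
  then obtain h where h: "h \<in> L2_per" "has_weak_partial g j h" by blast
  have "AE x in lebesgue. g' i x = g x"
    by (rule weak_partial_unique[OF g'(1) g(2)]) simp
  then have eq: "AE x in lebesgue. H x $ i $ j = h x"
    by (rule weak_partial_unique[OF g'(2) h(2)])
  have Hm: "(\<lambda>x. H x $ i $ j) \<in> borel_measurable lebesgue"
    using g'(2) by (intro locally_integrable_measurable) (simp add: has_weak_partial_def)
  show "(\<lambda>x. H x $ i $ j) \<in> L2_per"
    by (rule L2_per_cong_AE[OF h(1) Hm eq])
  have "fourier (\<lambda>x. H x $ i $ j) k = fourier h k"
    using h by (intro fourier_cong_AE[OF eq Hm]) auto
  also have "\<dots> = - of_real (4 * pi\<^sup>2 * of_int (k $ i) * of_int (k $ j)) * fourier \<phi> k"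
    unfolding fourier_weak_partial[OF g(1) h] fourier_weak_partial[OF \<phi>L g(1,2)]
    by (simp add: power2_eq_square)
  finally show "fourier (\<lambda>x. H x $ i $ j) k = - of_real (4 * pi\<^sup>2 * of_int (k $ i) * of_int (k $ j)) * fourier \<phi> k" .
qed

lemma has_weak_partial_scale:
  assumes "has_weak_partial u i g" shows "has_weak_partial (\<lambda>x. c * u x) i (\<lambda>x. c * g x)"
  using assms unfolding has_weak_partial_def locally_integrable_def by (simp add: mult.assoc)

lemma has_weak_partial_scaled_wave:
  "has_weak_partial (\<lambda>x. c * wave k b x) i (\<lambda>x. (c * (2 * pi * of_int (k $ i))) * wave k (b + pi / 2) x)"
  using has_weak_partial_scale[OF has_weak_partial_wave, of c k b i] by (simp add: mult.assoc)

lemma scaled_wave_H_per: "(\<lambda>x. c * wave k b x) \<in> H_per m"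
proof (induction m arbitrary: c b)
  case (Suc m)
  then show ?case using has_weak_partial_scaled_wave[of c k b] by fastforce
qed auto

lemma wave_H_per: "wave k b \<in> H_per m"
  using scaled_wave_H_per[of 1 k b m] by simp

lemma wave_weak_hessian:
  "has_weak_hessian (wave k b) (\<lambda>x. \<chi> i j. - (4 * pi\<^sup>2 * of_int (k $ i) * of_int (k $ j)) * wave k b x)"
  unfolding has_weak_hessian_def
proof (intro exI[of _ "\<lambda>i x. (2 * pi * of_int (k $ i)) * wave k (b + pi / 2) x"] allI conjI)
  fix i j
  show "has_weak_partial (wave k b) i (\<lambda>x. (2 * pi * of_int (k $ i)) * wave k (b + pi / 2) x)"
    by (rule has_weak_partial_wave)
  have *: "wave k (b + pi / 2 + pi / 2) x = - wave k b x" for x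
    using wave_add_pi[of k b x] by (simp add: add.assoc)
  show "has_weak_partial (\<lambda>x. (2 * pi * of_int (k $ i)) * wave k (b + pi / 2) x) j
      (\<lambda>x. (\<chi> i j. - (4 * pi\<^sup>2 * of_int (k $ i) * of_int (k $ j)) * wave k b x) $ i $ j)"
    using has_weak_partial_scaled_wave[of "2 * pi * of_int (k $ i)" k "b + pi / 2" j] unfolding *
    by (simp add: power2_eq_square mult_ac)
qed

definition bounded_coeff :: "(real^'n \<Rightarrow> real^'n^'n) \<Rightarrow> bool" where
  "bounded_coeff A \<longleftrightarrow> (\<forall>i j. (\<lambda>x. A x $ i $ j) \<in> borel_measurable lebesgue \<and>
     periodic (\<lambda>x. A x $ i $ j) \<and> (\<exists>C. AE x in lebesgue. \<bar>A x $ i $ j\<bar> \<le> C))"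

lemma bounded_coeff_mult: "bounded_coeff A \<Longrightarrow> q \<in> L2_per \<Longrightarrow> (\<lambda>x. A x $ i $ j * q x) \<in> L2_per"
  unfolding bounded_coeff_def using L2_per_mult_bounded by blast

text \<open>
  The equation only has to be tested with plane waves: for the Fourier coefficients of a test
  function and its Hessian are related by multiplication with \<open>- 4\<pi>\<^sup>2 k\<^sub>i k\<^sub>j\<close>, and the
  general identity is obtained from the one for plane waves by Parseval's formula.
\<close>

lemma is_solution_iff_fourier:
  fixes A :: "real^'n \<Rightarrow> real^'n^'n"
  assumes f: "f \<in> L2_per" and A: "bounded_coeff A"
  shows "is_solution A f q \<longleftrightarrow> q \<in> L2_per \<and>
    (\<forall>k. (\<Sum>i\<in>UNIV. \<Sum>j\<in>UNIV. of_real (4 * pi\<^sup>2 * of_int (k $ i) * of_int (k $ j))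
         * fourier (\<lambda>x. A x $ i $ j * q x) k) = fourier f k)"
    (is "_ \<longleftrightarrow> q \<in> L2_per \<and> (\<forall>k. ?S k = fourier f k)")
proof (cases "q \<in> L2_per")
  case q: True
  note Aq = bounded_coeff_mult[OF A q]
  have test: "L2_inner q (\<lambda>x. - (A x \<bullet> H x))
      = - (\<Sum>i\<in>UNIV. \<Sum>j\<in>UNIV. L2_inner (\<lambda>x. A x $ i $ j * q x) (\<lambda>x. H x $ i $ j))"
    if H: "\<And>i j. (\<lambda>x. H x $ i $ j) \<in> L2_per" for H
  proof -
    have int: "integrable cell_measure (\<lambda>x. A x $ i $ j * q x * H x $ i $ j)" for i j
      by (rule L2_mult_integrable[OF Aq H])
    have "L2_inner q (\<lambda>x. - (A x \<bullet> H x))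
        = - (LINT x|cell_measure. (\<Sum>i\<in>UNIV. \<Sum>j\<in>UNIV. A x $ i $ j * q x * H x $ i $ j))"
      unfolding L2_inner_uminus_right L2_inner_eq
      by (simp add: inner_vec_def sum_distrib_left mult_ac)
    also have "\<dots> = - (\<Sum>i\<in>UNIV. \<Sum>j\<in>UNIV. L2_inner (\<lambda>x. A x $ i $ j * q x) (\<lambda>x. H x $ i $ j))"
      using int by (simp add: L2_inner_eq Bochner_Integration.integrable_sum)
    finally show ?thesis .
  qed
  show ?thesis
  proof
    assume sol: "is_solution A f q"
    have wave: "(\<Sum>i\<in>UNIV. \<Sum>j\<in>UNIV. (4 * pi\<^sup>2 * of_int (k $ i) * of_int (k $ j))
        * L2_inner (\<lambda>x. A x $ i $ j * q x) (wave k b)) = L2_inner f (wave k b)" for k b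
    proof -
      let ?H = "\<lambda>x. (\<chi> i j. - (4 * pi\<^sup>2 * of_int (k $ i) * of_int (k $ j)) * wave k b x) :: real^'n^'n"
      have "L2_inner f (wave k b) = L2_inner q (\<lambda>x. - (A x \<bullet> ?H x))"
        using sol[unfolded is_solution_def, THEN conjunct2, rule_format, OF wave_H_per wave_weak_hessian] ..
      also have "\<dots> = - (\<Sum>i\<in>UNIV. \<Sum>j\<in>UNIV. L2_inner (\<lambda>x. A x $ i $ j * q x) (\<lambda>x. ?H x $ i $ j))"
        by (rule test) (simp only: vec_lambda_beta L2_per_scale[OF wave_L2_per])
      also have "\<dots> = (\<Sum>i\<in>UNIV. \<Sum>j\<in>UNIV. (4 * pi\<^sup>2 * of_int (k $ i) * of_int (k $ j))
          * L2_inner (\<lambda>x. A x $ i $ j * q x) (wave k b))"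
        by (simp only: vec_lambda_beta L2_inner_scale_right) (simp add: sum_negf)
      finally show ?thesis ..
    qed
    have "?S k = fourier f k" for k
      using wave[of k 0] wave[of k "pi / 2"]
      by (simp add: complex_eq_iff L2_inner_wave Aq f)
    then show "q \<in> L2_per \<and> (\<forall>k. ?S k = fourier f k)" using q by blast
  next
    assume S: "q \<in> L2_per \<and> (\<forall>k. ?S k = fourier f k)"
    show "is_solution A f q"
      unfolding is_solution_def
    proof (intro conjI q ballI allI impI)
      fix \<phi> :: "real^'n \<Rightarrow> real" and H assume \<phi>: "\<phi> \<in> H_per 2" and hess: "has_weak_hessian \<phi> H"
      note H = weak_hessian_fourier[OF \<phi> hess]
      have \<phi>L: "\<phi> \<in> L2_per" using \<phi> by (simp add: numeral_2_eq_2)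
      have "(\<lambda>N. - (\<Sum>i\<in>UNIV. \<Sum>j\<in>UNIV. \<Sum>k\<in>freq_cube N.
            Re (fourier (\<lambda>x. A x $ i $ j * q x) k * cnj (fourier (\<lambda>x. H x $ i $ j) k))))
          \<longlonglongrightarrow> - (\<Sum>i\<in>UNIV. \<Sum>j\<in>UNIV. L2_inner (\<lambda>x. A x $ i $ j * q x) (\<lambda>x. H x $ i $ j))"
        by (intro tendsto_minus tendsto_sum parseval Aq H)
      moreover have "- (\<Sum>i\<in>UNIV. \<Sum>j\<in>UNIV. \<Sum>k\<in>freq_cube N.
            Re (fourier (\<lambda>x. A x $ i $ j * q x) k * cnj (fourier (\<lambda>x. H x $ i $ j) k)))
          = (\<Sum>k\<in>freq_cube N. Re (fourier f k * cnj (fourier \<phi> k)))" for N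
      proof -
        have "(\<Sum>i\<in>UNIV. \<Sum>j\<in>UNIV. \<Sum>k\<in>freq_cube N.
            Re (fourier (\<lambda>x. A x $ i $ j * q x) k * cnj (fourier (\<lambda>x. H x $ i $ j) k)))
          = (\<Sum>k\<in>freq_cube N. \<Sum>i\<in>UNIV. \<Sum>j\<in>UNIV.
            Re (fourier (\<lambda>x. A x $ i $ j * q x) k * cnj (fourier (\<lambda>x. H x $ i $ j) k)))"
          by (subst sum.swap[of _ UNIV "freq_cube N"]) (subst sum.swap[of _ UNIV "freq_cube N"], rule refl)
        also have "\<dots> = (\<Sum>k\<in>freq_cube N. - Re (?S k * cnj (fourier \<phi> k)))"
        proof (rule sum.cong)
          fix k
          have "- (?S k * cnj (fourier \<phi> k)) = (\<Sum>i\<in>UNIV. \<Sum>j\<in>UNIV.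
              fourier (\<lambda>x. A x $ i $ j * q x) k * cnj (fourier (\<lambda>x. H x $ i $ j) k))"
            unfolding sum_distrib_right sum_negf[symmetric] H(2) by (intro sum.cong refl) (simp add: mult_ac)
          then show "(\<Sum>i\<in>UNIV. \<Sum>j\<in>UNIV. Re (fourier (\<lambda>x. A x $ i $ j * q x) k * cnj (fourier (\<lambda>x. H x $ i $ j) k)))
              = - Re (?S k * cnj (fourier \<phi> k))"
            by (simp only: Re_sum[symmetric] uminus_complex.sel(1)[symmetric])
        qed simp
        also have "\<dots> = (\<Sum>k\<in>freq_cube N. - Re (fourier f k * cnj (fourier \<phi> k)))"
          using S by (simp only: simp_thms)
        finally show ?thesis by (simp only: sum_negf minus_minus)
      qed
      ultimately have "(\<lambda>N. \<Sum>k\<in>freq_cube N. Re (fourier f k * cnj (fourier \<phi> k)))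
          \<longlonglongrightarrow> L2_inner q (\<lambda>x. - (A x \<bullet> H x))"
        by (simp only: test[OF H(1)])
      then show "L2_inner q (\<lambda>x. - (A x \<bullet> H x)) = L2_inner f \<phi>"
        using parseval[OF f \<phi>L] by (rule LIMSEQ_unique)
    qed
  qed
qed (simp add: is_solution_def)

lemma is_invariant_measure_iff:
  "is_invariant_measure A r \<longleftrightarrow> is_solution A (\<lambda>x. 0) r \<and> cell_integral r = 1"
  unfolding is_invariant_measure_def is_solution_def by (auto simp: L2_inner_def)

lemma is_solution_cong_AE:
  assumes A: "bounded_coeff A" and f: "f \<in> L2_per" and q: "q \<in> L2_per" "q' \<in> L2_per"
    and eq: "AE x in lebesgue. q x = q' x"
  shows "is_solution A f q \<longleftrightarrow> is_solution A f q'"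
proof -
  have "fourier (\<lambda>x. A x $ i $ j * q x) k = fourier (\<lambda>x. A x $ i $ j * q' x) k" for i j k
    by (rule fourier_cong_AE)
       (use eq in eventually_elim, use bounded_coeff_mult[OF A] q in \<open>auto intro: L2_per_measurable\<close>)
  then show ?thesis using q by (simp add: is_solution_iff_fourier[OF f A])
qed

lemma is_solution_linear:
  assumes A: "bounded_coeff A" and f: "f \<in> L2_per" "g \<in> L2_per"
    and u: "is_solution A f u" and v: "is_solution A g v"
  shows "is_solution A (\<lambda>x. f x + c * g x) (\<lambda>x. u x + c * v x)"
proof -
  have uv: "u \<in> L2_per" "v \<in> L2_per" using u v by (auto simp: is_solution_def)
  have "fourier (\<lambda>x. A x $ i $ j * (u x + c * v x)) k
      = fourier (\<lambda>x. A x $ i $ j * u x) k + of_real c * fourier (\<lambda>x. A x $ i $ j * v x) k" for i j k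
  proof -
    have "fourier (\<lambda>x. A x $ i $ j * u x + c * (A x $ i $ j * v x)) k
        = fourier (\<lambda>x. A x $ i $ j * u x) k + of_real c * fourier (\<lambda>x. A x $ i $ j * v x) k"
      using bounded_coeff_mult[OF A uv(1)] bounded_coeff_mult[OF A uv(2)]
      by (subst fourier_add) (auto simp: fourier_scale)
    then show ?thesis by (simp add: distrib_left mult.left_commute)
  qed
  moreover have "fourier (\<lambda>x. f x + c * g x) k = fourier f k + of_real c * fourier g k" for k
    using f by (subst fourier_add) (auto simp: fourier_scale)
  moreover have "(\<lambda>x. f x + c * g x) \<in> L2_per" "(\<lambda>x. u x + c * v x) \<in> L2_per" using f uv by auto
  ultimately show ?thesis
    using u v f
    by (simp add: is_solution_iff_fourier[OF _ A] distrib_left sum.distrib mult.left_commute[of _ "of_real c"]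
        flip: sum_distrib_left)
qed

text \<open>Frequency zero corresponds to constant test functions.\<close>

lemma is_solution_imp_mean_zero:
  assumes "f \<in> L2_per" "bounded_coeff A" "is_solution A f q"
  shows "f \<in> L2_per0"
proof -
  have "fourier f 0 = 0"
    using assms by (subst (asm) is_solution_iff_fourier) (auto dest!: spec[of _ 0])
  then show ?thesis using assms(1) by (simp add: L2_per0_def fourier_0)
qed

section \<open>Contractions on functions of mean zero\<close>

lemma L2_per0_iff: "u \<in> L2_per0 \<longleftrightarrow> u \<in> L2_per \<and> fourier u 0 = 0"
  by (simp add: L2_per0_def fourier_0)

lemma L2_norm_cong_AE:
  "AE x in lebesgue. u x = v x \<Longrightarrow> u \<in> borel_measurable lebesgue \<Longrightarrow> v \<in> borel_measurable lebesgue \<Longrightarrow>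
    L2_norm u = L2_norm v"
  unfolding L2_norm_def using L2_inner_cong_AE[of u v u v] by simp

text \<open>
  Banach's fixed point theorem.  All iterates satisfy \<open>\<parallel>P n\<parallel> \<le> h / (1 - \<kappa>)\<close>, and shifting the
  indices by \<open>n\<close> gains a factor \<open>\<kappa>\<^sup>n\<close>; equality of functions means equality almost
  everywhere.
\<close>

lemma L2_per0_fixpoint:
  fixes F :: "(real^'n \<Rightarrow> real) \<Rightarrow> real^'n \<Rightarrow> real"
  assumes maps: "\<And>u. u \<in> L2_per0 \<Longrightarrow> F u \<in> L2_per0" and \<kappa>: "0 \<le> \<kappa>" "\<kappa> < 1"
    and contr: "\<And>u v. u \<in> L2_per0 \<Longrightarrow> v \<in> L2_per0 \<Longrightarrow>
      L2_norm (\<lambda>x. F u x - F v x) \<le> \<kappa> * L2_norm (\<lambda>x. u x - v x)"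
  obtains p where "p \<in> L2_per0" "AE x in lebesgue. F p x = p x"
proof -
  define P where "P n = (F ^^ n) (\<lambda>x. 0)" for n
  have PS: "P (Suc n) = F (P n)" for n by (simp add: P_def)
  have P0: "P n \<in> L2_per0" for n
  proof (induction n)
    case 0 show ?case by (simp add: P_def L2_per0_def)
  next
    case (Suc n) then show ?case using maps by (simp add: PS)
  qed
  then have P: "P n \<in> L2_per" for n by (auto simp: L2_per0_def)
  define h where "h = L2_norm (P 1)"
  have bound: "L2_norm (P n) \<le> h / (1 - \<kappa>)" for n
  proof (induction n)
    case 0
    have "L2_norm (P 0) = 0" by (simp add: P_def L2_norm_def L2_inner_def)
    then show ?case using \<kappa> by (simp add: h_def)
  next
    case (Suc n)
    have "L2_norm (P (Suc n)) = L2_norm (\<lambda>x. (P (Suc n) x - P 1 x) + P 1 x)" by simp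
    also have "\<dots> \<le> L2_norm (\<lambda>x. P (Suc n) x - P 1 x) + h"
      unfolding h_def by (rule L2_norm_triangle[OF L2_per_diff[OF P P] P])
    also have "L2_norm (\<lambda>x. P (Suc n) x - P 1 x) \<le> \<kappa> * L2_norm (P n)"
      using contr[OF P0[of n] P0[of 0]] PS[of n] PS[of 0] by (simp add: P_def)
    also have "\<dots> \<le> \<kappa> * (h / (1 - \<kappa>))" using Suc \<kappa> by (intro mult_left_mono) auto
    also have "\<kappa> * (h / (1 - \<kappa>)) + h = h / (1 - \<kappa>)" using \<kappa> by (simp add: field_simps)
    finally show ?case by simp
  qed
  have geom: "L2_norm (\<lambda>x. P (n + m) x - P n x) \<le> \<kappa> ^ n * (h / (1 - \<kappa>))" for m n
  proof (induction n)
    case 0 then show ?case using bound[of m] by (simp add: P_def)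
  next
    case (Suc n)
    have "L2_norm (\<lambda>x. P (Suc n + m) x - P (Suc n) x) \<le> \<kappa> * L2_norm (\<lambda>x. P (n + m) x - P n x)"
      using contr[OF P0 P0, of "n + m" n] by (simp add: PS)
    also have "\<dots> \<le> \<kappa> * (\<kappa> ^ n * (h / (1 - \<kappa>)))" using Suc \<kappa> by (intro mult_left_mono) auto
    finally show ?case by (simp add: mult.assoc)
  qed
  have "\<exists>N. \<forall>i\<ge>N. \<forall>j\<ge>N. L2_norm (\<lambda>x. P i x - P j x) < e" if "0 < e" for e
  proof -
    have "(\<lambda>n. \<kappa> ^ n * (h / (1 - \<kappa>))) \<longlonglongrightarrow> 0"
      using tendsto_mult_left_zero[OF LIMSEQ_power_zero[of \<kappa>], of "h / (1 - \<kappa>)"] \<kappa> by simp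
    then have "\<forall>\<^sub>F n in sequentially. \<kappa> ^ n * (h / (1 - \<kappa>)) < e / 2"
      using \<open>0 < e\<close> by (intro order_tendstoD(2)) auto
    then obtain N where N: "\<kappa> ^ N * (h / (1 - \<kappa>)) < e / 2"
      by (auto simp: eventually_sequentially)
    have near: "L2_norm (\<lambda>x. P i x - P N x) < e / 2" if "i \<ge> N" for i
      using order.strict_trans1[OF geom[of N "i - N"] N] that by simp
    have "L2_norm (\<lambda>x. P i x - P j x) < e" if "i \<ge> N" "j \<ge> N" for i j
    proof -
      have "L2_norm (\<lambda>x. P i x - P j x) \<le> L2_norm (\<lambda>x. P i x - P N x) + L2_norm (\<lambda>x. P N x - P j x)"
        by (rule L2_norm_triangle3[OF P P P])
      moreover have "L2_norm (\<lambda>x. P N x - P j x) = L2_norm (\<lambda>x. P j x - P N x)"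
        using L2_norm_uminus[of "\<lambda>x. P j x - P N x"] by simp
      ultimately show ?thesis using near[OF that(1)] near[OF that(2)] by simp
    qed
    then show ?thesis by blast
  qed
  then obtain p where p: "p \<in> L2_per" and lim: "(\<lambda>n. L2_norm (\<lambda>x. P n x - p x)) \<longlonglongrightarrow> 0"
    using L2_complete[of P, OF P] by blast
  have "\<bar>cell_integral p\<bar> \<le> L2_norm (\<lambda>x. P n x - p x)" for n
    using cell_integral_le_norm[OF L2_per_diff[OF P p], of n] P0[of n]
    by (simp add: cell_integral_diff[OF P p] L2_per0_def)
  then have "\<bar>cell_integral p\<bar> \<le> 0" using lim by (intro LIMSEQ_le_const[OF lim]) auto
  then have p0: "p \<in> L2_per0" using p by (simp add: L2_per0_def)
  have Fp: "F p \<in> L2_per" using maps[OF p0] by (simp add: L2_per0_def)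
  have "L2_norm (\<lambda>x. F p x - p x) \<le> \<kappa> * L2_norm (\<lambda>x. P n x - p x) + L2_norm (\<lambda>x. P (Suc n) x - p x)" for n
  proof -
    have "L2_norm (\<lambda>x. F p x - p x) \<le> L2_norm (\<lambda>x. F p x - P (Suc n) x) + L2_norm (\<lambda>x. P (Suc n) x - p x)"
      by (rule L2_norm_triangle3[OF Fp P p])
    moreover have "L2_norm (\<lambda>x. F p x - P (Suc n) x) = L2_norm (\<lambda>x. F (P n) x - F p x)"
      using L2_norm_uminus[of "\<lambda>x. F (P n) x - F p x"] by (simp add: PS)
    ultimately show ?thesis using contr[OF P0[of n] p0] by simp
  qed
  moreover have "(\<lambda>n. \<kappa> * L2_norm (\<lambda>x. P n x - p x) + L2_norm (\<lambda>x. P (Suc n) x - p x)) \<longlonglongrightarrow> \<kappa> * 0 + 0"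
    by (intro tendsto_intros lim LIMSEQ_Suc[OF lim])
  ultimately have "L2_norm (\<lambda>x. F p x - p x) \<le> 0"
    by (intro LIMSEQ_le_const[where X = "\<lambda>n. \<kappa> * L2_norm (\<lambda>x. P n x - p x) + L2_norm (\<lambda>x. P (Suc n) x - p x)"]) auto
  then have "L2_norm (\<lambda>x. F p x - p x) = 0" using L2_norm_nonneg[of "\<lambda>x. F p x - p x"] by linarith
  then have "AE x in lebesgue. F p x - p x = 0"
    using L2_norm_eq_0_iff[OF L2_per_diff[OF Fp p]] by blast
  then have "AE x in lebesgue. F p x = p x" by eventually_elim simp
  then show thesis using that p0 by blast
qed

section \<open>Riesz transforms and the inverse Laplacian\<close>

definition freq_sq :: "int^'n \<Rightarrow> real" where
  "freq_sq k = (\<Sum>i\<in>UNIV. (of_int (k $ i))\<^sup>2)"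

lemma freq_sq_uminus: "freq_sq (- k) = freq_sq k"
  by (simp add: freq_sq_def)

lemma freq_sq_ge_1:
  assumes "k \<noteq> 0" shows "1 \<le> freq_sq k"
proof -
  obtain i where "k $ i \<noteq> 0" using assms by (auto simp: vec_eq_iff)
  then have "1 \<le> \<bar>k $ i\<bar>" by linarith
  then have "1 \<le> (k $ i)\<^sup>2" using one_le_power[of "\<bar>k $ i\<bar>" 2] by simp
  then have "1 \<le> (real_of_int (k $ i))\<^sup>2" by (metis of_int_1_le_iff of_int_power)
  also have "\<dots> \<le> freq_sq k" unfolding freq_sq_def by (rule member_le_sum) auto
  finally show ?thesis .
qed

text \<open>
  The symbol of the second derivative \<open>\<partial>\<^sub>i \<partial>\<^sub>j\<close> composed with the inverse Laplacian,
  and the symbol of the inverse negative Laplacian.  Division by zero makes both vanish at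
  frequency zero.
\<close>

definition hess_symbol :: "'n \<Rightarrow> 'n \<Rightarrow> int^'n \<Rightarrow> real" where
  "hess_symbol i j k = of_int (k $ i) * of_int (k $ j) / freq_sq k"

definition inv_laplace_symbol :: "int^'n \<Rightarrow> real" where
  "inv_laplace_symbol k = 1 / (4 * pi\<^sup>2 * freq_sq k)"

lemma freq_sq_0 [simp]: "freq_sq 0 = 0"
  by (simp add: freq_sq_def)

lemma hess_symbol_uminus: "hess_symbol i j (- k) = hess_symbol i j k"
  by (simp add: hess_symbol_def freq_sq_uminus)

lemma hess_symbol_0 [simp]: "hess_symbol i j 0 = 0"
  by (simp add: hess_symbol_def)

lemma hess_symbol_square_sum:
  assumes "k \<noteq> 0" shows "(\<Sum>i\<in>UNIV. \<Sum>j\<in>UNIV. (hess_symbol i j k)\<^sup>2) = 1"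
proof -
  have "(\<Sum>i\<in>UNIV. \<Sum>j\<in>UNIV. (hess_symbol i j k)\<^sup>2)
      = (\<Sum>i\<in>UNIV. \<Sum>j\<in>UNIV. (of_int (k $ i))\<^sup>2 * (of_int (k $ j))\<^sup>2) / (freq_sq k)\<^sup>2"
    by (simp add: hess_symbol_def power_divide power_mult_distrib flip: sum_divide_distrib)
  also have "(\<Sum>i\<in>UNIV. \<Sum>j\<in>UNIV. (of_int (k $ i))\<^sup>2 * (of_int (k $ j))\<^sup>2) = (freq_sq k)\<^sup>2"
    unfolding freq_sq_def power2_eq_square[of "sum _ _"] by (rule sum_product[symmetric])
  finally show ?thesis using freq_sq_ge_1[OF assms] by simp
qed

lemma hess_symbol_trace:
  assumes "k \<noteq> 0" shows "(\<Sum>i\<in>UNIV. hess_symbol i i k) = 1"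
  using freq_sq_ge_1[OF assms]
  by (simp add: hess_symbol_def freq_sq_def power2_eq_square flip: sum_divide_distrib)

lemma hess_symbol_le_1: "\<bar>hess_symbol i j k\<bar> \<le> 1"
proof (cases "k = 0")
  case False
  have "(hess_symbol i j k)\<^sup>2 \<le> (\<Sum>j\<in>UNIV. (hess_symbol i j k)\<^sup>2)"
    by (rule member_le_sum) auto
  also have "\<dots> \<le> (\<Sum>i\<in>UNIV. \<Sum>j\<in>UNIV. (hess_symbol i j k)\<^sup>2)"
    by (rule member_le_sum[of i UNIV "\<lambda>i. \<Sum>j\<in>UNIV. (hess_symbol i j k)\<^sup>2"]) (auto intro: sum_nonneg)
  finally show ?thesis using hess_symbol_square_sum[OF False] by (simp add: abs_square_le_1)
qed simp

lemma inv_laplace_symbol_bound: "\<bar>inv_laplace_symbol k\<bar> \<le> 1 / (4 * pi\<^sup>2)"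
proof (cases "k = 0")
  case False
  have "4 * pi\<^sup>2 * 1 \<le> 4 * pi\<^sup>2 * freq_sq k"
    using freq_sq_ge_1[OF False] by (intro mult_left_mono) auto
  then show ?thesis
    using freq_sq_ge_1[OF False] by (simp add: inv_laplace_symbol_def frac_le)
qed (simp add: inv_laplace_symbol_def)

definition riesz :: "'n \<Rightarrow> 'n \<Rightarrow> (real^'n \<Rightarrow> real) \<Rightarrow> real^'n \<Rightarrow> real" where
  "riesz i j = fourier_mult (hess_symbol i j)"

lemma riesz_L2_per: "u \<in> L2_per \<Longrightarrow> riesz i j u \<in> L2_per"
  and fourier_riesz: "u \<in> L2_per \<Longrightarrow> fourier (riesz i j u) k = of_real (hess_symbol i j k) * fourier u k"
  unfolding riesz_def
  by (rule fourier_mult[of "hess_symbol i j" 1]; simp add: hess_symbol_uminus hess_symbol_le_1)+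

definition inv_laplace :: "(real^'n \<Rightarrow> real) \<Rightarrow> real^'n \<Rightarrow> real" where
  "inv_laplace = fourier_mult inv_laplace_symbol"

lemma inv_laplace_L2_per: "u \<in> L2_per \<Longrightarrow> inv_laplace u \<in> L2_per"
  and fourier_inv_laplace: "u \<in> L2_per \<Longrightarrow> fourier (inv_laplace u) k = of_real (inv_laplace_symbol k) * fourier u k"
  unfolding inv_laplace_def
  by (rule fourier_mult[of inv_laplace_symbol "1 / (4 * pi\<^sup>2)", OF _ inv_laplace_symbol_bound];
      simp add: inv_laplace_symbol_def freq_sq_uminus)+

lemma L2_norm_inv_laplace:
  assumes u: "u \<in> L2_per" shows "L2_norm (inv_laplace u) \<le> 1 / (4 * pi\<^sup>2) * L2_norm u"
proof (rule L2_norm_le_if_fourier_le[OF inv_laplace_L2_per[OF u] u])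
  show "cmod (fourier (inv_laplace u) k) \<le> 1 / (4 * pi\<^sup>2) * cmod (fourier u k)" for k
    unfolding fourier_inv_laplace[OF u] norm_mult norm_of_real
    by (rule mult_right_mono[OF inv_laplace_symbol_bound norm_ge_zero])
qed simp

lemma riesz_self_adjoint:
  assumes "u \<in> L2_per" "v \<in> L2_per"
  shows "L2_inner u (riesz i j v) = L2_inner (riesz i j u) v"
  using assms by (intro L2_inner_eq_if_fourier) (auto simp: riesz_L2_per fourier_riesz algebra_simps)

lemma riesz_trace:
  assumes "u \<in> L2_per0"
  shows "AE x in lebesgue. (\<Sum>i\<in>UNIV. riesz i i u x) = u x"
proof (rule fourier_eq_imp_AE)
  have u: "u \<in> L2_per" "fourier u 0 = 0" using assms by (auto simp: L2_per0_iff)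
  show "(\<lambda>x. \<Sum>i\<in>UNIV. riesz i i u x) \<in> L2_per" "u \<in> L2_per"
    using u by (auto intro: riesz_L2_per)
  fix k
  have "fourier (\<lambda>x. \<Sum>i\<in>UNIV. riesz i i u x) k = of_real (\<Sum>i\<in>UNIV. hess_symbol i i k) * fourier u k"
    using u by (simp add: fourier_sum riesz_L2_per fourier_riesz sum_distrib_right)
  then show "fourier (\<lambda>x. \<Sum>i\<in>UNIV. riesz i i u x) k = fourier u k"
    using u hess_symbol_trace[of k] by (cases "k = 0") auto
qed

text \<open>Parseval's formula reduces this to the identity \<open>hess_symbol_square_sum\<close> at each
  nonzero frequency.\<close>

lemma riesz_square_sum:
  assumes "u \<in> L2_per0"
  shows "(\<Sum>i\<in>UNIV. \<Sum>j\<in>UNIV. (L2_norm (riesz i j u))\<^sup>2) = (L2_norm u)\<^sup>2"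
proof -
  have u: "u \<in> L2_per" "fourier u 0 = 0" using assms by (auto simp: L2_per0_iff)
  have "(\<lambda>N. \<Sum>i\<in>UNIV. \<Sum>j\<in>UNIV. \<Sum>k\<in>freq_cube N. Re (fourier (riesz i j u) k * cnj (fourier (riesz i j u) k)))
      \<longlonglongrightarrow> (\<Sum>i\<in>UNIV. \<Sum>j\<in>UNIV. L2_inner (riesz i j u) (riesz i j u))"
    by (intro tendsto_sum parseval riesz_L2_per u)
  moreover have "(\<Sum>i\<in>UNIV. \<Sum>j\<in>UNIV. \<Sum>k\<in>freq_cube N. Re (fourier (riesz i j u) k * cnj (fourier (riesz i j u) k)))
      = (\<Sum>k\<in>freq_cube N. Re (fourier u k * cnj (fourier u k)))" for N
  proof -
    have "(\<Sum>i\<in>UNIV. \<Sum>j\<in>UNIV. \<Sum>k\<in>freq_cube N. Re (fourier (riesz i j u) k * cnj (fourier (riesz i j u) k)))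
        = (\<Sum>k\<in>freq_cube N. \<Sum>i\<in>UNIV. \<Sum>j\<in>UNIV. Re (fourier (riesz i j u) k * cnj (fourier (riesz i j u) k)))"
      by (subst sum.swap[of _ UNIV "freq_cube N"]) (subst sum.swap[of _ UNIV "freq_cube N"], rule refl)
    also have "\<dots> = (\<Sum>k\<in>freq_cube N. Re (fourier u k * cnj (fourier u k)))"
    proof (rule sum.cong)
      fix k
      have "(\<Sum>i\<in>UNIV. \<Sum>j\<in>UNIV. Re (fourier (riesz i j u) k * cnj (fourier (riesz i j u) k)))
          = (\<Sum>i\<in>UNIV. \<Sum>j\<in>UNIV. (hess_symbol i j k)\<^sup>2) * (cmod (fourier u k))\<^sup>2"
        unfolding Re_mult_cnj_self fourier_riesz[OF u(1)]
        by (simp add: norm_mult power_mult_distrib sum_distrib_right)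
      also have "\<dots> = (cmod (fourier u k))\<^sup>2"
        using u(2) hess_symbol_square_sum[of k] by (cases "k = 0") auto
      finally show "(\<Sum>i\<in>UNIV. \<Sum>j\<in>UNIV. Re (fourier (riesz i j u) k * cnj (fourier (riesz i j u) k)))
          = Re (fourier u k * cnj (fourier u k))" unfolding Re_mult_cnj_self .
    qed simp
    finally show ?thesis .
  qed
  ultimately have "(\<Sum>i\<in>UNIV. \<Sum>j\<in>UNIV. L2_inner (riesz i j u) (riesz i j u)) = L2_inner u u"
    using LIMSEQ_unique[OF _ parseval[OF u(1) u(1)]] by simp
  then show ?thesis by (simp add: L2_norm_sq)
qed

lemma L2_norm_sq_eq_integral: "(L2_norm u)\<^sup>2 = (LINT x|cell_measure. (u x)\<^sup>2)"
  by (subst L2_norm_sq) (simp add: L2_inner_eq power2_eq_square)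

section \<open>Coefficients satisfying the Cordes condition\<close>

locale cordes_coefficient =
  fixes A :: "real^'n \<Rightarrow> real^'n^'n" and l L \<delta> :: real
  assumes l_pos: "0 < l" and L_pos: "0 < L" and A_class: "A \<in> coeff_class l L"
    and \<delta>_pos: "0 < \<delta>" and \<delta>_le_1: "\<delta> \<le> 1" and A_cordes: "cordes \<delta> A"
begin

abbreviation \<kappa> :: real where "\<kappa> \<equiv> sqrt (1 - \<delta>)"

lemma \<kappa>_nonneg: "0 \<le> \<kappa>" and \<kappa>_less_1: "\<kappa> < 1"
  using \<delta>_pos \<delta>_le_1 by (auto simp: real_less_lsqrt)

text \<open>The scalar that makes \<open>\<gamma> A\<close> closest to the identity matrix.\<close>

definition \<gamma> :: "real^'n \<Rightarrow> real" where
  "\<gamma> x = trace (A x) / (norm (A x))\<^sup>2"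

definition B :: "'n \<Rightarrow> 'n \<Rightarrow> real^'n \<Rightarrow> real" where
  "B i j x = \<gamma> x * A x $ i $ j"

definition elliptic_at :: "real \<Rightarrow> real^'n \<Rightarrow> bool" where
  "elliptic_at C x \<longleftrightarrow> (\<forall>i j. \<bar>A x $ i $ j\<bar> \<le> C) \<and> 1 / C \<le> \<gamma> x \<and> \<gamma> x \<le> L / l\<^sup>2
      \<and> (\<Sum>i\<in>UNIV. \<Sum>j\<in>UNIV. ((if i = j then 1 else 0) - B i j x)\<^sup>2) \<le> 1 - \<delta>"

text \<open>
  The square of the distance of \<open>\<gamma> A\<close> to the identity equals
  \<open>n - (tr A)\<^sup>2 / \<bar>A\<bar>\<^sup>2\<close>, which the Cordes condition bounds by
  \<open>1 - \<delta>\<close>.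
\<close>

lemma pointwise_bounds:
  obtains C where "0 < C"
    "AE x in lebesgue. elliptic_at C x"
proof -
  let ?n = "real CARD('n)"
  have n: "1 \<le> ?n" by (simp add: Suc_leI)
  obtain K where K: "AE x in lebesgue. norm (A x) \<le> K"
    using A_class by (auto simp: coeff_class_def)
  have diag: "AE x in lebesgue. l \<le> A x $ i $ i \<and> A x $ i $ i \<le> L" for i
  proof -
    have 1: "(A x *v axis i 1) \<bullet> axis i 1 = A x $ i $ i" for x
      by (simp add: inner_axis matrix_vector_mult_basis column_def)
    have "axis i (1::real) \<noteq> 0" by (simp add: axis_eq_0_iff)
    then have "AE x in lebesgue. l * (norm (axis i (1::real) :: real^'n))\<^sup>2 \<le> (A x *v axis i 1) \<bullet> axis i 1
        \<and> (A x *v axis i 1) \<bullet> axis i 1 \<le> L * (norm (axis i (1::real) :: real^'n))\<^sup>2"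
      using A_class unfolding coeff_class_def by blast
    then show ?thesis unfolding 1 by simp
  qed
  then have "AE x in lebesgue. \<forall>i. l \<le> A x $ i $ i \<and> A x $ i $ i \<le> L"
    by (simp add: AE_all_countable)
  moreover note K
  moreover have "AE x in lebesgue. (norm (A x))\<^sup>2 / (trace (A x))\<^sup>2 \<le> 1 / (?n - 1 + \<delta>)"
    using A_cordes by (simp add: cordes_def)
  \<comment> \<open>The first entry bounds the coefficients, the second one bounds \<open>1 / \<gamma> \<le> \<bar>A\<bar>\<^sup>2 / (n l)\<close>;
    adding one keeps it positive.\<close>
  ultimately have ae: "AE x in lebesgue. elliptic_at (max K (K\<^sup>2 / (?n * l) + 1)) x"
  proof eventually_elim
    case (elim x)
    define t N where "t = trace (A x)" and "N = (norm (A x))\<^sup>2"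
    have N_eq: "N = (\<Sum>i\<in>UNIV. \<Sum>j\<in>UNIV. (A x $ i $ j)\<^sup>2)"
      unfolding N_def power2_norm_eq_inner by (simp add: inner_vec_def power2_eq_square)
    have t_eq: "t = (\<Sum>i\<in>UNIV. A x $ i $ i)" by (simp add: t_def trace_def)
    have t_low: "?n * l \<le> t" using elim(1) sum_mono[of UNIV "\<lambda>i. l" "\<lambda>i. A x $ i $ i"] by (simp add: t_eq)
    have t_up: "t \<le> ?n * L" using elim(1) sum_mono[of UNIV "\<lambda>i. A x $ i $ i" "\<lambda>i. L"] by (simp add: t_eq)
    have N_low: "?n * l\<^sup>2 \<le> N"
    proof -
      have "?n * l\<^sup>2 = (\<Sum>i\<in>(UNIV :: 'n set). l\<^sup>2)" by simp
      also have "\<dots> \<le> (\<Sum>i\<in>UNIV. (A x $ i $ i)\<^sup>2)"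
        using elim(1) l_pos by (intro sum_mono power_mono) auto
      also have "\<dots> \<le> N"
        unfolding N_eq by (intro sum_mono member_le_sum) auto
      finally show ?thesis .
    qed
    have nl: "0 < ?n * l" using n l_pos by simp
    have t_pos: "0 < t" using t_low nl by linarith
    have "0 < ?n * l\<^sup>2" using n l_pos by simp
    then have N_pos: "0 < N" using N_low by linarith
    have N_up: "N \<le> K\<^sup>2" unfolding N_def using elim(2) by (intro power_mono) auto
    have K_nonneg: "0 \<le> K" using elim(2) norm_ge_zero order_trans by blast
    have \<gamma>_eq: "\<gamma> x = t / N" by (simp add: \<gamma>_def t_def N_def)
    have "\<bar>A x $ i $ j\<bar> \<le> K" for i j
      using component_le_norm_cart[of "A x $ i" j] Finite_Cartesian_Product.norm_nth_le[of "A x" i] elim(2) by linarith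
    moreover have "1 / max K (K\<^sup>2 / (?n * l) + 1) \<le> \<gamma> x"
    proof -
      have "1 / max K (K\<^sup>2 / (?n * l) + 1) \<le> 1 / (N / (?n * l))"
      proof (rule divide_left_mono)
        have "N / (?n * l) \<le> K\<^sup>2 / (?n * l)" using N_up nl by (simp add: divide_right_mono)
        then show "N / (?n * l) \<le> max K (K\<^sup>2 / (?n * l) + 1)" by simp
        have "0 \<le> K\<^sup>2 / (?n * l)" using nl by simp
        then have "0 < max K (K\<^sup>2 / (?n * l) + 1)" by linarith
        moreover have "0 < N / (?n * l)" using N_pos nl by simp
        ultimately show "0 < max K (K\<^sup>2 / (?n * l) + 1) * (N / (?n * l))" by (rule mult_pos_pos)
      qed simp
      also have "\<dots> = (?n * l) / N" by simp
      also have "\<dots> \<le> t / N" using t_low N_pos by (simp add: divide_right_mono)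
      finally show ?thesis by (simp add: \<gamma>_eq)
    qed
    moreover have "\<gamma> x \<le> L / l\<^sup>2"
    proof -
      have "t / N \<le> (?n * L) / (?n * l\<^sup>2)"
        using t_up N_low L_pos l_pos n by (intro frac_le) auto
      also have "\<dots> = L / l\<^sup>2" using n by simp
      finally show ?thesis by (simp add: \<gamma>_eq)
    qed
    moreover have "(\<Sum>i\<in>UNIV. \<Sum>j\<in>UNIV. ((if i = j then 1 else 0) - B i j x)\<^sup>2) \<le> 1 - \<delta>"
    proof -
      have "((if i = j then 1 else 0) - B i j x)\<^sup>2
          = (if i = j then 1 - 2 * \<gamma> x * A x $ i $ i else 0) + (\<gamma> x)\<^sup>2 * (A x $ i $ j)\<^sup>2" for i j
        by (simp add: B_def power2_diff power_mult_distrib)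
      then have "(\<Sum>i\<in>UNIV. \<Sum>j\<in>UNIV. ((if i = j then 1 else 0) - B i j x)\<^sup>2)
          = (\<Sum>i\<in>UNIV. 1 - 2 * \<gamma> x * A x $ i $ i) + (\<gamma> x)\<^sup>2 * N"
        by (simp add: sum.distrib N_eq sum_distrib_left)
      also have "\<dots> = ?n - 2 * \<gamma> x * t + (\<gamma> x)\<^sup>2 * N"
        by (simp add: sum_subtractf t_eq sum_distrib_left)
      also have "\<dots> = ?n - t\<^sup>2 / N"
        using N_pos by (simp add: \<gamma>_eq power2_eq_square field_simps)
      also have "\<dots> \<le> 1 - \<delta>"
      proof -
        have c: "0 < ?n - 1 + \<delta>" using n \<delta>_pos by linarith
        have "N / t\<^sup>2 \<le> 1 / (?n - 1 + \<delta>)" using elim(3) by (simp add: N_def t_def)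
        then have "N * (?n - 1 + \<delta>) \<le> t\<^sup>2" using c t_pos by (simp add: field_simps)
        then have "?n - 1 + \<delta> \<le> t\<^sup>2 / N" using N_pos by (simp add: field_simps)
        then show ?thesis by linarith
      qed
      finally show ?thesis .
    qed
    ultimately show ?case unfolding elliptic_at_def by (simp add: le_max_iff_disj)
  qed
  have "0 < max K (K\<^sup>2 / (?n * l) + 1)"
  proof -
    have "0 \<le> K\<^sup>2 / (?n * l)" using n l_pos by simp
    then show ?thesis by linarith
  qed
  then show thesis using ae by (rule that)
qed

lemma continuous_A_measurable:
  "continuous_on UNIV F \<Longrightarrow> (\<lambda>x. F (A x) :: real) \<in> borel_measurable lebesgue"
  using A_class unfolding coeff_class_def
  by (auto intro: measurable_compose[OF _ borel_measurable_continuous_onI])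

lemma A_entry_measurable: "(\<lambda>x. A x $ i $ j) \<in> borel_measurable lebesgue"
  by (rule continuous_A_measurable[of "\<lambda>M. M $ i $ j"]) (intro continuous_intros)

lemma \<gamma>_measurable: "\<gamma> \<in> borel_measurable lebesgue"
  unfolding \<gamma>_def[abs_def] trace_def
  by (intro borel_measurable_divide borel_measurable_power borel_measurable_sum A_entry_measurable
      continuous_A_measurable[of norm] continuous_intros)

lemma A_periodic: "periodic A"
  using A_class by (simp add: coeff_class_def)

lemma \<gamma>_periodic: "periodic \<gamma>"
  unfolding \<gamma>_def[abs_def] by (rule periodic_comp[OF A_periodic])

lemma bounded_coeff_A: "bounded_coeff A"
proof -
  obtain C where "0 < C" and C: "AE x in lebesgue. elliptic_at C x"
    by (rule pointwise_bounds)
  have "AE x in lebesgue. \<bar>A x $ i $ j\<bar> \<le> C" for i j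
    using C by eventually_elim (simp add: elliptic_at_def)
  moreover have "periodic (\<lambda>x. A x $ i $ j)" for i j
    using A_periodic by (rule periodic_comp[where F = "\<lambda>M. M $ i $ j"])
  ultimately show ?thesis unfolding bounded_coeff_def using A_entry_measurable by blast
qed

lemma \<gamma>_bounds: "AE x in lebesgue. 0 < \<gamma> x \<and> \<gamma> x \<le> L / l\<^sup>2"
proof -
  obtain C where "0 < C" and C: "AE x in lebesgue. elliptic_at C x"
    by (rule pointwise_bounds)
  have "0 < 1 / C" using \<open>0 < C\<close> by simp
  show ?thesis using C
  proof eventually_elim
    case (elim x)
    then have "1 / C \<le> \<gamma> x" "\<gamma> x \<le> L / l\<^sup>2" by (simp_all add: elliptic_at_def)
    then show ?case using \<open>0 < 1 / C\<close> by linarith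
  qed
qed

lemma \<gamma>_mult: "p \<in> L2_per \<Longrightarrow> (\<lambda>x. \<gamma> x * p x) \<in> L2_per"
proof (rule L2_per_mult_bounded[OF _ \<gamma>_measurable \<gamma>_periodic])
  show "AE x in lebesgue. \<bar>\<gamma> x\<bar> \<le> L / l\<^sup>2" using \<gamma>_bounds by eventually_elim simp
qed

lemma \<gamma>_div: "q \<in> L2_per \<Longrightarrow> (\<lambda>x. (1 / \<gamma> x) * q x) \<in> L2_per"
proof -
  assume q: "q \<in> L2_per"
  obtain C where "0 < C" and C: "AE x in lebesgue. elliptic_at C x"
    by (rule pointwise_bounds)
  show ?thesis
  proof (rule L2_per_mult_bounded[OF q])
    show "(\<lambda>x. 1 / \<gamma> x) \<in> borel_measurable lebesgue"
      using \<gamma>_measurable by (intro borel_measurable_divide borel_measurable_const)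
    show "periodic (\<lambda>x. 1 / \<gamma> x)" by (rule periodic_comp[OF \<gamma>_periodic])
    show "AE x in lebesgue. \<bar>1 / \<gamma> x\<bar> \<le> C"
      using C
    proof eventually_elim
      case (elim x)
      then have g: "1 / C \<le> \<gamma> x" by (simp add: elliptic_at_def)
      have "0 < 1 / C" using \<open>0 < C\<close> by simp
      then have "0 < \<gamma> x" using g by linarith
      then show ?case using g \<open>0 < C\<close> by (simp add: field_simps)
    qed
  qed
qed

lemma \<gamma>_mult_div: "AE x in lebesgue. \<gamma> x * ((1 / \<gamma> x) * q x) = q x"
  using \<gamma>_bounds by eventually_elim simp

lemma B_mult: "p \<in> L2_per \<Longrightarrow> (\<lambda>x. B i j x * p x) \<in> L2_per"
  using bounded_coeff_mult[OF bounded_coeff_A \<gamma>_mult, of p i j] by (simp add: B_def mult_ac)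

lemma B_close_to_identity:
  "AE x in lebesgue. (\<Sum>i\<in>UNIV. \<Sum>j\<in>UNIV. ((if i = j then 1 else 0) - B i j x)\<^sup>2) \<le> \<kappa>\<^sup>2"
proof -
  obtain C where "0 < C" and C: "AE x in lebesgue. elliptic_at C x"
    by (rule pointwise_bounds)
  then show ?thesis using \<delta>_le_1 by (auto simp: elliptic_at_def elim!: eventually_mono)
qed

text \<open>
  The operator \<open>D\<^sup>2 : (\<gamma> A p)\<close> preconditioned by the inverse Laplacian; it is the adjoint
  of \<open>g \<mapsto> \<gamma> A : D\<^sup>2 \<Delta>\<^sup>-\<^sup>1 g\<close>.
\<close>

definition T :: "(real^'n \<Rightarrow> real) \<Rightarrow> real^'n \<Rightarrow> real" where
  "T p x = (\<Sum>i\<in>UNIV. \<Sum>j\<in>UNIV. riesz i j (\<lambda>y. B i j y * p y) x)"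

lemma T_L2_per: "p \<in> L2_per \<Longrightarrow> T p \<in> L2_per"
  unfolding T_def[abs_def] by (intro L2_per_sum riesz_L2_per B_mult)

lemma fourier_T:
  assumes "p \<in> L2_per"
  shows "fourier (T p) k = (\<Sum>i\<in>UNIV. \<Sum>j\<in>UNIV. of_real (hess_symbol i j k) * fourier (\<lambda>x. B i j x * p x) k)"
  unfolding T_def[abs_def] using assms
  by (simp add: fourier_sum L2_per_sum riesz_L2_per B_mult fourier_riesz)

lemma T_L2_per0: "p \<in> L2_per \<Longrightarrow> T p \<in> L2_per0"
  by (simp add: L2_per0_iff T_L2_per fourier_T)

lemma fourier_T_diff:
  assumes "u \<in> L2_per" "v \<in> L2_per"
  shows "fourier (T (\<lambda>x. u x - v x)) k = fourier (T u) k - fourier (T v) k"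
proof -
  have "fourier (\<lambda>x. B i j x * (u x - v x)) k = fourier (\<lambda>x. B i j x * u x) k - fourier (\<lambda>x. B i j x * v x) k" for i j
    using fourier_diff[OF B_mult[OF assms(1)] B_mult[OF assms(2)], of i j i j k] by (simp add: right_diff_distrib)
  then show ?thesis
    using assms by (simp add: fourier_T L2_per_diff right_diff_distrib sum_subtractf)
qed

text \<open>
  For \<open>w = p - T p\<close>, self-adjointness of the Riesz transforms turns \<open>\<langle>w, w\<rangle>\<close> into the
  integral of \<open>(I - \<gamma> A) : R w\<close> against \<open>p\<close>, where \<open>R w\<close> is the matrix of Riesz
  transforms, of trace \<open>w\<close> and norm \<open>\<parallel>w\<parallel>\<close>.
\<close>

lemma T_near_identity:
  assumes p: "p \<in> L2_per0"
  shows "L2_norm (\<lambda>x. p x - T p x) \<le> \<kappa> * L2_norm p"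
proof -
  define w where "w x = p x - T p x" for x
  have pL: "p \<in> L2_per" using p by (simp add: L2_per0_iff)
  have w0: "w \<in> L2_per0"
    using p T_L2_per0[OF pL] L2_per_diff[OF pL T_L2_per[OF pL]]
    by (simp add: w_def[abs_def] L2_per0_iff fourier_diff)
  then have wL: "w \<in> L2_per" by (simp add: L2_per0_iff)
  \<comment> \<open>The integrand \<open>(I - \<gamma> A) : R w\<close>.\<close>
  define y where "y x = (\<Sum>i\<in>UNIV. riesz i i w x) - (\<Sum>i\<in>UNIV. \<Sum>j\<in>UNIV. B i j x * riesz i j w x)" for x
  have R: "riesz i j w \<in> L2_per" for i j using wL by (rule riesz_L2_per)
  have trL: "(\<lambda>x. \<Sum>i\<in>UNIV. riesz i i w x) \<in> L2_per" by (intro L2_per_sum R)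
  have BRL: "(\<lambda>x. \<Sum>i\<in>UNIV. \<Sum>j\<in>UNIV. B i j x * riesz i j w x) \<in> L2_per"
    by (intro L2_per_sum B_mult R)
  have yL: "y \<in> L2_per" unfolding y_def[abs_def] by (rule L2_per_diff[OF trL BRL])
  have "L2_inner w w = L2_inner w p - L2_inner w (T p)"
    using L2_inner_diff_right[OF wL pL T_L2_per[OF pL]] by (simp add: w_def[abs_def])
  also have "L2_inner w p = L2_inner p (\<lambda>x. \<Sum>i\<in>UNIV. riesz i i w x)"
    by (subst L2_inner_commute, rule L2_inner_cong_AE)
       (use riesz_trace[OF w0] pL wL trL in \<open>auto simp: eq_commute\<close>)
  also have "L2_inner w (T p) = L2_inner p (\<lambda>x. \<Sum>i\<in>UNIV. \<Sum>j\<in>UNIV. B i j x * riesz i j w x)"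
  proof -
    have "L2_inner w (T p) = (\<Sum>i\<in>UNIV. \<Sum>j\<in>UNIV. L2_inner w (riesz i j (\<lambda>y. B i j y * p y)))"
      unfolding T_def[abs_def]
      by (simp add: L2_inner_sum_right wL L2_per_sum riesz_L2_per B_mult pL)
    also have "\<dots> = (\<Sum>i\<in>UNIV. \<Sum>j\<in>UNIV. L2_inner p (\<lambda>x. B i j x * riesz i j w x))"
    proof (intro sum.cong refl)
      fix i j
      have "L2_inner w (riesz i j (\<lambda>y. B i j y * p y)) = L2_inner (riesz i j w) (\<lambda>y. B i j y * p y)"
        by (rule riesz_self_adjoint[OF wL B_mult[OF pL]])
      then show "L2_inner w (riesz i j (\<lambda>y. B i j y * p y)) = L2_inner p (\<lambda>x. B i j x * riesz i j w x)"
        by (simp add: L2_inner_def mult_ac)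
    qed
    also have "\<dots> = L2_inner p (\<lambda>x. \<Sum>i\<in>UNIV. \<Sum>j\<in>UNIV. B i j x * riesz i j w x)"
      by (simp add: L2_inner_sum_right pL L2_per_sum B_mult R)
    finally show ?thesis .
  qed
  also have "L2_inner p (\<lambda>x. \<Sum>i\<in>UNIV. riesz i i w x)
      - L2_inner p (\<lambda>x. \<Sum>i\<in>UNIV. \<Sum>j\<in>UNIV. B i j x * riesz i j w x) = L2_inner p y"
    unfolding y_def[abs_def] by (rule L2_inner_diff_right[OF pL trL BRL, symmetric])
  also have "\<dots> \<le> L2_norm p * L2_norm y"
    using L2_Cauchy_Schwarz[OF pL yL] by linarith
  finally have wy: "(L2_norm w)\<^sup>2 \<le> L2_norm p * L2_norm y" by (simp add: L2_norm_sq)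
  have "(L2_norm y)\<^sup>2 \<le> \<kappa>\<^sup>2 * (L2_norm w)\<^sup>2"
  proof -
    have int: "integrable cell_measure (\<lambda>x. (riesz i j w x)\<^sup>2)" for i j
      using R by (simp add: L2_per_iff)
    have "AE x in lebesgue. (y x)\<^sup>2 \<le> \<kappa>\<^sup>2 * (\<Sum>i\<in>UNIV. \<Sum>j\<in>UNIV. (riesz i j w x)\<^sup>2)"
      using B_close_to_identity
    proof eventually_elim
      case (elim x)
      define a :: "real^'n^'n" where "a = (\<chi> i j. (if i = j then 1 else 0) - B i j x)"
      define b :: "real^'n^'n" where "b = (\<chi> i j. riesz i j w x)"
      have "(if i = j then 1 else 0) * c = (if i = j then c else 0)" for i j :: 'n and c :: real by simp
      then have "y x = a \<bullet> b"
        by (simp add: y_def a_def b_def inner_vec_def left_diff_distrib sum_subtractf)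
      then have "(y x)\<^sup>2 \<le> (a \<bullet> a) * (b \<bullet> b)" using Cauchy_Schwarz_ineq by simp
      also have "a \<bullet> a = (\<Sum>i\<in>UNIV. \<Sum>j\<in>UNIV. ((if i = j then 1 else 0) - B i j x)\<^sup>2)"
        by (simp only: a_def inner_vec_def vec_lambda_beta power2_eq_square inner_real_def)
      also have "b \<bullet> b = (\<Sum>i\<in>UNIV. \<Sum>j\<in>UNIV. (riesz i j w x)\<^sup>2)"
        by (simp add: b_def inner_vec_def power2_eq_square)
      finally show ?case
        using elim by (meson mult_right_mono order_trans sum_nonneg zero_le_power2)
    qed
    then have "(LINT x|cell_measure. (y x)\<^sup>2)
        \<le> (LINT x|cell_measure. \<kappa>\<^sup>2 * (\<Sum>i\<in>UNIV. \<Sum>j\<in>UNIV. (riesz i j w x)\<^sup>2))"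
      using yL int by (intro integral_mono_AE AE_lebesgue_cell) (auto simp: L2_per_iff)
    also have "\<dots> = \<kappa>\<^sup>2 * (\<Sum>i\<in>UNIV. \<Sum>j\<in>UNIV. LINT x|cell_measure. (riesz i j w x)\<^sup>2)"
      using int by (simp only: integral_mult_right_zero Bochner_Integration.integral_sum
          Bochner_Integration.integrable_sum)
    also have "\<dots> = \<kappa>\<^sup>2 * (L2_norm w)\<^sup>2"
      using riesz_square_sum[OF w0] by (simp only: L2_norm_sq_eq_integral)
    finally show ?thesis unfolding L2_norm_sq_eq_integral .
  qed
  then have "L2_norm y \<le> \<kappa> * L2_norm w"
    unfolding power_mult_distrib[symmetric]
    by (rule power2_le_imp_le) (intro mult_nonneg_nonneg \<kappa>_nonneg L2_norm_nonneg)
  then have "L2_norm p * L2_norm y \<le> L2_norm p * (\<kappa> * L2_norm w)"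
    by (rule mult_left_mono) simp
  with wy have "L2_norm w * L2_norm w \<le> (\<kappa> * L2_norm p) * L2_norm w"
    by (simp add: power2_eq_square mult_ac)
  then have "L2_norm w \<le> \<kappa> * L2_norm p"
  proof (cases "L2_norm w = 0")
    case True
    then show ?thesis using mult_nonneg_nonneg[OF \<kappa>_nonneg L2_norm_nonneg[of p]] by simp
  next
    case False
    then have "0 < L2_norm w" using L2_norm_nonneg[of w] by (simp only: less_le) simp
    with \<open>L2_norm w * L2_norm w \<le> (\<kappa> * L2_norm p) * L2_norm w\<close> show ?thesis
      by (rule mult_right_le_imp_le)
  qed
  then show ?thesis by (simp add: w_def[abs_def])
qed

text \<open>In the variable \<open>p = q / \<gamma>\<close> the equation reads \<open>T p = (- \<Delta>)\<^sup>-\<^sup>1 f\<close>.\<close>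

lemma is_solution_iff_T:
  assumes f: "f \<in> L2_per0" and p: "p \<in> L2_per"
  shows "is_solution A f (\<lambda>x. \<gamma> x * p x) \<longleftrightarrow> (\<forall>k. fourier (T p) k = fourier (inv_laplace f) k)"
proof -
  have fL: "f \<in> L2_per" "fourier f 0 = 0" using f by (auto simp: L2_per0_iff)
  have Bp: "(\<lambda>x. A x $ i $ j * (\<gamma> x * p x)) = (\<lambda>x. B i j x * p x)" for i j
    by (simp add: B_def mult_ac)
  have "((\<Sum>i\<in>UNIV. \<Sum>j\<in>UNIV. of_real (4 * pi\<^sup>2 * of_int (k $ i) * of_int (k $ j))
         * fourier (\<lambda>x. B i j x * p x) k) = fourier f k) \<longleftrightarrow> fourier (T p) k = fourier (inv_laplace f) k" for k
  proof (cases "k = 0")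
    case True
    then show ?thesis using fL p by (simp add: fourier_T fourier_inv_laplace)
  next
    case False
    define s where "s = 4 * pi\<^sup>2 * freq_sq k"
    have s: "s \<noteq> 0" using freq_sq_ge_1[OF False] by (simp add: s_def)
    have "4 * pi\<^sup>2 * of_int (k $ i) * of_int (k $ j) = s * hess_symbol i j k" for i j
      using freq_sq_ge_1[OF False] by (simp add: s_def hess_symbol_def)
    then have "(\<Sum>i\<in>UNIV. \<Sum>j\<in>UNIV. of_real (4 * pi\<^sup>2 * of_int (k $ i) * of_int (k $ j))
         * fourier (\<lambda>x. B i j x * p x) k) = of_real s * fourier (T p) k"
      by (simp only: fourier_T[OF p] sum_distrib_left of_real_mult mult.assoc)
    moreover have "fourier f k = of_real s * fourier (inv_laplace f) k"
      using s by (simp add: fourier_inv_laplace[OF fL(1)] inv_laplace_symbol_def s_def)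
    ultimately show ?thesis using s by simp
  qed
  then show ?thesis
    by (simp only: is_solution_iff_fourier[OF fL(1) bounded_coeff_A] Bp \<gamma>_mult[OF p] simp_thms)
qed

text \<open>
  Besides the final bound this contains uniqueness: for \<open>f = 0\<close> it forces \<open>p = 0\<close>.
\<close>

lemma L2_norm_le_of_T:
  assumes p: "p \<in> L2_per0" and f: "f \<in> L2_per"
    and eq: "\<And>k. fourier (T p) k = fourier (inv_laplace f) k"
  shows "L2_norm p \<le> C_cordes \<delta> * (1 / (4 * pi\<^sup>2) * L2_norm f)"
proof -
  have pL: "p \<in> L2_per" using p by (simp add: L2_per0_iff)
  have "L2_norm p = L2_norm (\<lambda>x. (p x - T p x) + T p x)" by simp
  also have "\<dots> \<le> L2_norm (\<lambda>x. p x - T p x) + L2_norm (T p)"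
    by (rule L2_norm_triangle[OF L2_per_diff[OF pL T_L2_per[OF pL]] T_L2_per[OF pL]])
  also have "L2_norm (\<lambda>x. p x - T p x) \<le> \<kappa> * L2_norm p" by (rule T_near_identity[OF p])
  also have "L2_norm (T p) \<le> 1 / (4 * pi\<^sup>2) * L2_norm f"
    using L2_norm_le_if_fourier_le[of "T p" "inv_laplace f" 1] L2_norm_inv_laplace[OF f]
      T_L2_per[OF pL] inv_laplace_L2_per[OF f] eq by simp
  finally have "(1 - \<kappa>) * L2_norm p \<le> 1 / (4 * pi\<^sup>2) * L2_norm f" by (simp add: algebra_simps)
  then show ?thesis using \<kappa>_less_1 by (simp add: C_cordes_def field_simps)
qed

lemma T_solvable:
  assumes f: "f \<in> L2_per"
  obtains p where "p \<in> L2_per0" "\<And>k. fourier (T p) k = fourier (inv_laplace f) k"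
proof -
  let ?h = "inv_laplace f"
  \<comment> \<open>The fixed points of this map are the solutions of \<open>T u = h\<close>.\<close>
  define F where "F u x = ?h x + (u x - T u x)" for u x
  have h0: "?h \<in> L2_per0" using f by (simp add: L2_per0_iff inv_laplace_L2_per fourier_inv_laplace inv_laplace_symbol_def)
  have hL: "?h \<in> L2_per" using h0 by (simp add: L2_per0_iff)
  have uT: "(\<lambda>x. u x - T u x) \<in> L2_per" if "u \<in> L2_per" for u
    by (rule L2_per_diff[OF that T_L2_per[OF that]])
  have fF: "fourier (F u) k = fourier ?h k + (fourier u k - fourier (T u) k)" if u: "u \<in> L2_per" for u k
    unfolding F_def[abs_def] fourier_add[OF hL uT[OF u]] fourier_diff[OF u T_L2_per[OF u]] ..
  have FL: "F u \<in> L2_per" if "u \<in> L2_per" for u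
    unfolding F_def[abs_def] by (rule L2_per_add[OF hL uT[OF that]])
  obtain p where p: "p \<in> L2_per0" "AE x in lebesgue. F p x = p x"
  proof (rule L2_per0_fixpoint[of F \<kappa>])
    show "F u \<in> L2_per0" if "u \<in> L2_per0" for u
      using that h0 T_L2_per0[of u] by (simp add: L2_per0_iff FL fF)
    show "L2_norm (\<lambda>x. F u x - F v x) \<le> \<kappa> * L2_norm (\<lambda>x. u x - v x)"
      if u: "u \<in> L2_per0" and v: "v \<in> L2_per0" for u v
    proof -
      have uv: "u \<in> L2_per" "v \<in> L2_per" using u v by (auto simp: L2_per0_iff)
      have d: "(\<lambda>x. u x - v x) \<in> L2_per" by (rule L2_per_diff[OF uv])
      have d0: "(\<lambda>x. u x - v x) \<in> L2_per0" using u v d uv by (simp add: L2_per0_iff fourier_diff)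
      have "fourier (\<lambda>x. F u x - F v x) k = fourier (\<lambda>x. (u x - v x) - T (\<lambda>x. u x - v x) x) k" for k
        unfolding fourier_diff[OF FL[OF uv(1)] FL[OF uv(2)]] fF[OF uv(1)] fF[OF uv(2)]
          fourier_diff[OF d T_L2_per[OF d]] fourier_T_diff[OF uv] fourier_diff[OF uv] by simp
      then have "L2_norm (\<lambda>x. F u x - F v x) \<le> 1 * L2_norm (\<lambda>x. (u x - v x) - T (\<lambda>x. u x - v x) x)"
        by (intro L2_norm_le_if_fourier_le[OF L2_per_diff[OF FL[OF uv(1)] FL[OF uv(2)]] uT[OF d]]) simp_all
      then show ?thesis using T_near_identity[OF d0] by simp
    qed
  qed (use \<kappa>_nonneg \<kappa>_less_1 in auto)
  have pL: "p \<in> L2_per" using p by (simp add: L2_per0_iff)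
  have "fourier (T p) k = fourier ?h k" for k
    using fourier_cong_AE[OF p(2), of k] FL[OF pL] pL fF[OF pL, of k] by (simp add: L2_per_measurable)
  then show thesis using that p(1) by blast
qed

lemma solution_exists:
  assumes f: "f \<in> L2_per0"
  obtains q where "is_solution A f q" "L2_norm q \<le> L / l\<^sup>2 * (C_cordes \<delta> * (1 / (4 * pi\<^sup>2) * L2_norm f))"
proof -
  have fL: "f \<in> L2_per" using f by (simp add: L2_per0_iff)
  obtain p where p: "p \<in> L2_per0" "\<And>k. fourier (T p) k = fourier (inv_laplace f) k"
    by (rule T_solvable[OF fL]) (rule that)
  have pL: "p \<in> L2_per" using p by (simp add: L2_per0_iff)
  have "L2_norm (\<lambda>x. \<gamma> x * p x) \<le> L2_norm (\<lambda>x. L / l\<^sup>2 * p x)"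
  proof (rule L2_norm_mono_AE[OF \<gamma>_mult[OF pL] L2_per_scale[OF pL]])
    show "AE x in lebesgue. \<bar>\<gamma> x * p x\<bar> \<le> \<bar>L / l\<^sup>2 * p x\<bar>"
      using \<gamma>_bounds
    proof eventually_elim
      case (elim x)
      then have "\<bar>\<gamma> x\<bar> \<le> \<bar>L / l\<^sup>2\<bar>" by linarith
      then show ?case unfolding abs_mult by (rule mult_right_mono) simp
    qed
  qed
  also have "\<dots> = L / l\<^sup>2 * L2_norm p" unfolding L2_norm_scale using L_pos by simp
  also have "\<dots> \<le> L / l\<^sup>2 * (C_cordes \<delta> * (1 / (4 * pi\<^sup>2) * L2_norm f))"
    using L_pos by (intro mult_left_mono L2_norm_le_of_T[OF p(1) fL p(2)]) auto
  finally show thesis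
    using is_solution_iff_T[OF f pL] p(2) by (intro that) auto
qed

text \<open>
  Solutions of the homogeneous equation are determined by the mean of \<open>p = q / \<gamma>\<close>, so they
  form a line, spanned by the invariant measure.
\<close>

lemma homogeneous_solution:
  assumes r: "is_invariant_measure A r" and w: "is_solution A (\<lambda>x. 0) w"
  shows "AE x in lebesgue. w x = cell_integral w * r x"
proof -
  have r': "is_solution A (\<lambda>x. 0) r" "cell_integral r = 1" using r by (auto simp: is_invariant_measure_iff)
  have L: "r \<in> L2_per" "w \<in> L2_per" using r' w by (auto simp: is_solution_def)
  have zero0: "(\<lambda>x. 0) \<in> L2_per0" by (simp add: L2_per0_def)
  have zero_if_mean_zero: "AE x in lebesgue. v x = 0"
    if v: "is_solution A (\<lambda>x. 0) v" and mean: "cell_integral (\<lambda>x. (1 / \<gamma> x) * v x) = 0" for v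
  proof -
    define p where "p x = (1 / \<gamma> x) * v x" for x
    have vL: "v \<in> L2_per" using v by (simp add: is_solution_def)
    have pL: "p \<in> L2_per" unfolding p_def[abs_def] by (rule \<gamma>_div[OF vL])
    have p0: "p \<in> L2_per0" using pL mean by (simp add: L2_per0_def p_def[abs_def])
    have eq: "AE x in lebesgue. \<gamma> x * p x = v x" unfolding p_def by (rule \<gamma>_mult_div)
    have "is_solution A (\<lambda>x. 0) (\<lambda>x. \<gamma> x * p x)"
      using v is_solution_cong_AE[OF bounded_coeff_A _ \<gamma>_mult[OF pL] vL eq] by simp
    then have "\<And>k. fourier (T p) k = fourier (inv_laplace (\<lambda>x. 0)) k"
      using is_solution_iff_T[OF zero0 pL] by blast
    from L2_norm_le_of_T[OF p0 _ this] have "L2_norm p \<le> 0"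
      by (simp add: L2_norm_def L2_inner_def)
    then have "AE x in lebesgue. p x = 0"
      using L2_norm_eq_0_iff[OF pL] L2_norm_nonneg[of p] by linarith
    then show ?thesis using eq by eventually_elim simp
  qed
  define a b where "a = cell_integral (\<lambda>x. (1 / \<gamma> x) * w x)" and "b = cell_integral (\<lambda>x. (1 / \<gamma> x) * r x)"
  \<comment> \<open>Otherwise the invariant measure itself would vanish.\<close>
  have "b \<noteq> 0"
  proof
    assume "b = 0"
    then have "AE x in lebesgue. r x = 0" using zero_if_mean_zero[OF r'(1)] by (simp add: b_def)
    then have "cell_integral r = cell_integral (\<lambda>x::real^'n. 0)"
      using L by (intro cell_integral_cong_AE) auto
    then show False using r'(2) by simp
  qed
  define c where "c = a / b"
  have "is_solution A (\<lambda>x. 0) (\<lambda>x. w x + (- c) * r x)"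
    using is_solution_linear[OF bounded_coeff_A _ _ w r'(1), of "- c"] by simp
  moreover have "cell_integral (\<lambda>x. (1 / \<gamma> x) * (w x + (- c) * r x)) = 0"
  proof -
    have "cell_integral (\<lambda>x. (1 / \<gamma> x) * w x + (- c) * ((1 / \<gamma> x) * r x)) = a + (- c) * b"
      unfolding a_def b_def cell_integral_add[OF \<gamma>_div[OF L(2)] L2_per_scale[OF \<gamma>_div[OF L(1)]]]
      by (simp only: cell_integral_scale)
    also have "\<dots> = 0" using \<open>b \<noteq> 0\<close> by (simp add: c_def)
    finally show ?thesis by (simp only: distrib_left mult.left_commute)
  qed
  ultimately have "AE x in lebesgue. w x + (- c) * r x = 0" by (rule zero_if_mean_zero)
  then have eq: "AE x in lebesgue. w x = c * r x" by eventually_elim simp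
  have "cell_integral w = cell_integral (\<lambda>x. c * r x)"
    using L by (intro cell_integral_cong_AE eq) auto
  then have "cell_integral w = c" using r'(2) by (simp add: cell_integral_scale)
  then show ?thesis using eq by simp
qed

lemma solution_difference:
  assumes r: "is_invariant_measure A r" and f: "f \<in> L2_per"
    and q: "is_solution A f q1" "is_solution A f q2"
  shows "AE x in lebesgue. q1 x - q2 x = cell_integral (\<lambda>y. q1 y - q2 y) * r x"
proof (rule homogeneous_solution[OF r])
  show "is_solution A (\<lambda>x. 0) (\<lambda>x. q1 x - q2 x)"
    using is_solution_linear[OF bounded_coeff_A f f q, of "- 1"] by simp
qed

end

theorem theorem3p2:
  fixes A :: "real^'n \<Rightarrow> real^'n^'n"
    and f r :: "real^'n \<Rightarrow> real"
    and l L \<delta> :: real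
  assumes "f \<in> L2_per"
    and "l > 0" and "L > 0"
    and "A \<in> coeff_class l L"
    and "0 < \<delta>" and "\<delta> \<le> 1"
    and "cordes \<delta> A"
    and "is_invariant_measure A r"
  shows "((\<exists>q. is_solution A f q) \<longleftrightarrow> f \<in> L2_per0)
    \<and> (f \<in> L2_per0 \<longrightarrow>
        (\<forall>q1 q2. is_solution A f q1 \<and> is_solution A f q2 \<longrightarrow>
           (AE x in lebesgue. q1 x - q2 x = cell_integral (\<lambda>y. q1 y - q2 y) * r x))
      \<and> (\<forall>m. (\<exists>q. is_solution A f q \<and> cell_integral q = m)
           \<and> (\<forall>q1 q2. is_solution A f q1 \<and> cell_integral q1 = m
                     \<and> is_solution A f q2 \<and> cell_integral q2 = m
                \<longrightarrow> (AE x in lebesgue. q1 x = q2 x))))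
    \<and> (f \<in> L2_per0 \<longrightarrow>
        (\<forall>q0. q0 \<in> L2_per0 \<and> is_solution A f q0 \<longrightarrow>
           L2_norm q0 \<le> real CARD('n) * L / (pi\<^sup>2 * l\<^sup>2) * C_cordes \<delta>
                         * (1 + L2_norm r) * L2_norm f))"
proof -
  interpret cordes_coefficient A l L \<delta> by unfold_locales (use assms in auto)
  note f = assms(1) and r = assms(8)
  have rS: "is_solution A (\<lambda>x. 0) r" and r1: "cell_integral r = 1"
    using r by (auto simp: is_invariant_measure_iff)
  have rL: "r \<in> L2_per" using rS by (simp add: is_solution_def)
  have solL: "q \<in> L2_per" if "is_solution A f q" for q using that by (simp add: is_solution_def)
  note diff = solution_difference[OF r f]
  have exists_m: "\<exists>q. is_solution A f q \<and> cell_integral q = m" if f0: "f \<in> L2_per0" for m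
  proof -
    obtain q where q: "is_solution A f q" using solution_exists[OF f0] by blast
    let ?q = "\<lambda>x. q x + (m - cell_integral q) * r x"
    have "is_solution A f ?q"
      using is_solution_linear[OF bounded_coeff_A f _ q rS] by simp
    moreover have "cell_integral ?q = m"
      using cell_integral_add[OF solL[OF q] L2_per_scale[OF rL]] by (simp add: cell_integral_scale r1)
    ultimately show ?thesis by blast
  qed
  have unique_m: "AE x in lebesgue. q1 x = q2 x"
    if q: "is_solution A f q1" "is_solution A f q2" and eq: "cell_integral q1 = cell_integral q2" for q1 q2
  proof -
    have "cell_integral (\<lambda>y. q1 y - q2 y) = 0"
      using cell_integral_diff[OF solL[OF q(1)] solL[OF q(2)]] eq by simp
    then show ?thesis using diff[OF q] by simp
  qed
  have bound: "L2_norm q0 \<le> real CARD('n) * L / (pi\<^sup>2 * l\<^sup>2) * C_cordes \<delta> * (1 + L2_norm r) * L2_norm f"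
    if f0: "f \<in> L2_per0" and q0: "q0 \<in> L2_per0" "is_solution A f q0" for q0
  proof -
    obtain q where q: "is_solution A f q"
      and qn: "L2_norm q \<le> L / l\<^sup>2 * (C_cordes \<delta> * (1 / (4 * pi\<^sup>2) * L2_norm f))"
      using solution_exists[OF f0] by blast
    note qL = solL[OF q]
    let ?c = "- cell_integral q"
    have "AE x in lebesgue. q0 x - q x = ?c * r x"
      using diff[OF q0(2) q] cell_integral_diff[OF solL[OF q0(2)] qL] q0(1) by (simp add: L2_per0_def)
    then have "AE x in lebesgue. q0 x = q x + ?c * r x" by eventually_elim simp
    then have "L2_norm q0 = L2_norm (\<lambda>x. q x + ?c * r x)"
      using solL[OF q0(2)] L2_per_add[OF qL L2_per_scale[OF rL, of ?c]]
      by (intro L2_norm_cong_AE) auto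
    also have "\<dots> \<le> L2_norm q + L2_norm (\<lambda>x. ?c * r x)"
      by (rule L2_norm_triangle[OF qL L2_per_scale[OF rL]])
    also have "\<dots> \<le> L2_norm q + L2_norm q * L2_norm r"
      using cell_integral_le_norm[OF qL] unfolding L2_norm_scale
      by (intro add_left_mono mult_right_mono) auto
    also have "\<dots> = L2_norm q * (1 + L2_norm r)" by (simp add: algebra_simps)
    also have "\<dots> \<le> (real CARD('n) * L / (pi\<^sup>2 * l\<^sup>2) * C_cordes \<delta> * L2_norm f) * (1 + L2_norm r)"
    proof (rule mult_right_mono)
      \<comment> \<open>The smallest nonzero eigenvalue of the negative Laplacian is \<open>4 \<pi>\<^sup>2\<close>, and \<open>\<gamma>\<close> is at
        most \<open>L / l\<^sup>2\<close>, so the bound is reached with a factor \<open>4 n\<close> to spare.\<close>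
      define K where "K = L / l\<^sup>2 * C_cordes \<delta> * L2_norm f"
      have "0 \<le> C_cordes \<delta>" using \<kappa>_less_1 by (simp add: C_cordes_def)
      then have "0 \<le> K" using L_pos by (simp add: K_def)
      have "L2_norm q \<le> K / (4 * pi\<^sup>2)" using qn by (simp add: K_def mult_ac)
      also have "\<dots> \<le> real CARD('n) * (K / pi\<^sup>2)"
      proof -
        have "K / (4 * pi\<^sup>2) \<le> K / pi\<^sup>2" using \<open>0 \<le> K\<close> by (intro divide_left_mono) auto
        also have "\<dots> \<le> real CARD('n) * (K / pi\<^sup>2)"
          using mult_right_mono[of 1 "real CARD('n)" "K / pi\<^sup>2"] \<open>0 \<le> K\<close> by (simp add: Suc_leI)
        finally show ?thesis .
      qed
      also have "\<dots> = real CARD('n) * L / (pi\<^sup>2 * l\<^sup>2) * C_cordes \<delta> * L2_norm f"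
        by (simp add: K_def mult_ac)
      finally show "L2_norm q \<le> real CARD('n) * L / (pi\<^sup>2 * l\<^sup>2) * C_cordes \<delta> * L2_norm f" .
    qed simp
    finally show ?thesis by (simp add: mult_ac)
  qed
  show ?thesis
  proof (intro conjI impI allI)
    show "(\<exists>q. is_solution A f q) \<longleftrightarrow> f \<in> L2_per0"
    proof
      assume "\<exists>q. is_solution A f q"
      then obtain q where "is_solution A f q" ..
      then show "f \<in> L2_per0" by (rule is_solution_imp_mean_zero[OF f bounded_coeff_A])
    next
      assume "f \<in> L2_per0"
      from exists_m[OF this, of 0] show "\<exists>q. is_solution A f q" by (elim exE conjE) (rule exI)
    qed
  next
    fix q1 q2 assume "is_solution A f q1 \<and> is_solution A f q2"
    then show "AE x in lebesgue. q1 x - q2 x = cell_integral (\<lambda>y. q1 y - q2 y) * r x"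
      by (intro diff) auto
  next
    fix m assume "f \<in> L2_per0"
    then show "\<exists>q. is_solution A f q \<and> cell_integral q = m" by (rule exists_m)
  next
    fix m q1 q2
    assume "is_solution A f q1 \<and> cell_integral q1 = m \<and> is_solution A f q2 \<and> cell_integral q2 = m"
    then show "AE x in lebesgue. q1 x = q2 x" by (intro unique_m) auto
  next
    fix q0 assume "f \<in> L2_per0" "q0 \<in> L2_per0 \<and> is_solution A f q0"
    then show "L2_norm q0 \<le> real CARD('n) * L / (pi\<^sup>2 * l\<^sup>2) * C_cordes \<delta> * (1 + L2_norm r) * L2_norm f"
      by (intro bound) auto
  qed
qed

end
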